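(* Let $\psi\in C_0(\Omega_T)$ (continuous with compact support in $\Omega_T$). Then there is at most one variational solution with obstacle $\psi$.
   Context: Throughout, $p>2$, $q=p/(p-1)$, $\Omega\subset\mathbb R^n$ is a bounded domain with regular boundary, $T>0$, $\Omega_T=\Omega\times(0,T)$, $\partial_p\Omega_T=(\overline\Omega\times\{0\})\cup(\partial\Omega\times[0,T])$. For $\psi\in C(\overline{\Omega_T})$, $\mathcal F_\psi$ is the set of $v\in C(\overline{\Omega_T})\cap L^p(0,T;W^{1,p}(\Omega))$ with $v=\psi$ on $\partial_p\Omega_T$ and $v\ge\psi$ in $\Omega_T$. A function $v\in\mathcal F_\psi$ is a variational solution with obstacle $\psi$ if $$\int\!\!\int_{\Omega_T}\Big(|\nabla v|^{p-2}\nabla v\cdot\nabla(\phi-v)+(\phi-v)\frac{\partial\phi}{\partial t}\Big)\,dx\,dt\ge\frac12\int_\Omega|\phi(x,T)-v(x,T)|^2\,dx$$ for all $\phi\in C^\infty(\Omega_T)\cap\mathcal F_\psi$ with $\partial_t\phi\in L^q(\Omega_T)$. *)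

theory Defs
  imports "HOL-Analysis.Analysis"
begin

definition pdir :: "'b::euclidean_space \<Rightarrow> ('b \<Rightarrow> real) \<Rightarrow> 'b \<Rightarrow> real" where
  "pdir d f z = deriv (\<lambda>s. f (z + s *\<^sub>R d)) 0"

primrec iter_pd :: "'b::euclidean_space list \<Rightarrow> ('b \<Rightarrow> real) \<Rightarrow> 'b \<Rightarrow> real" where
  "iter_pd [] f = f"
| "iter_pd (d # ds) f = pdir d (iter_pd ds f)"

definition smooth_on :: "'b::euclidean_space set \<Rightarrow> ('b \<Rightarrow> real) \<Rightarrow> bool" where
  "smooth_on U f \<longleftrightarrow>
     (\<forall>ds. set ds \<subseteq> Basis \<longrightarrow>
        continuous_on U (iter_pd ds f) \<and>
        (\<forall>z\<in>U. \<forall>d\<in>Basis. (\<lambda>s. iter_pd ds f (z + s *\<^sub>R d)) differentiable (at 0)))"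

definition test_fun :: "'b::euclidean_space set \<Rightarrow> ('b \<Rightarrow> real) \<Rightarrow> bool" where
  "test_fun U \<eta> \<longleftrightarrow> smooth_on UNIV \<eta> \<and> compact (closure {z. \<eta> z \<noteq> 0})
                     \<and> closure {z. \<eta> z \<noteq> 0} \<subseteq> U"

text \<open>C_0(U): continuous on U with compact support contained in U
  (extended by zero outside U).\<close>
definition C0_on :: "'b::euclidean_space set \<Rightarrow> ('b \<Rightarrow> real) \<Rightarrow> bool" where
  "C0_on U f \<longleftrightarrow> continuous_on U f \<and> compact (closure {z. f z \<noteq> 0})
                  \<and> closure {z. f z \<noteq> 0} \<subseteq> U"

definition Lp_on :: "real \<Rightarrow> 'b::euclidean_space set \<Rightarrow> ('b \<Rightarrow> 'c::euclidean_space) \<Rightarrow> bool" where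
  "Lp_on r S f \<longleftrightarrow> f \<in> borel_measurable (lebesgue_on S)
                    \<and> integrable (lebesgue_on S) (\<lambda>z. norm (f z) powr r)"

definition cyl :: "'a::euclidean_space set \<Rightarrow> real \<Rightarrow> ('a \<times> real) set" where
  "cyl \<Omega> T = \<Omega> \<times> {0<..<T}"

definition par_boundary :: "'a::euclidean_space set \<Rightarrow> real \<Rightarrow> ('a \<times> real) set" where
  "par_boundary \<Omega> T = (closure \<Omega> \<times> {0}) \<union> (frontier \<Omega> \<times> {0..T})"

definition dt :: "('a::euclidean_space \<times> real \<Rightarrow> real) \<Rightarrow> 'a \<times> real \<Rightarrow> real" where
  "dt f = pdir (0, 1) f"

definition sgrad :: "('a::euclidean_space \<times> real \<Rightarrow> real) \<Rightarrow> 'a \<times> real \<Rightarrow> 'a" where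
  "sgrad f z = (\<Sum>i\<in>Basis. pdir (i, 0) f z *\<^sub>R i)"

definition weak_sgrad ::
  "('a::euclidean_space \<times> real) set \<Rightarrow> ('a \<times> real \<Rightarrow> real) \<Rightarrow> ('a \<times> real \<Rightarrow> 'a) \<Rightarrow> bool" where
  "weak_sgrad U v g \<longleftrightarrow>
     (\<forall>\<eta> i. test_fun U \<eta> \<and> i \<in> Basis \<longrightarrow>
        (\<integral>z. v z * pdir (i, 0) \<eta> z \<partial>lebesgue_on U) = - (\<integral>z. (g z \<bullet> i) * \<eta> z \<partial>lebesgue_on U))"

text \<open>v in L^p(0,T;W^{1,p}(Omega)) with spatial gradient g, rendered as
  v, g in L^p(Omega_T) with g the weak spatial gradient of v.\<close>
definition par_sobolev ::
  "real \<Rightarrow> 'a::euclidean_space set \<Rightarrow> real \<Rightarrow> ('a \<times> real \<Rightarrow> real) \<Rightarrow> ('a \<times> real \<Rightarrow> 'a) \<Rightarrow> bool" where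
  "par_sobolev p \<Omega> T v g \<longleftrightarrow> Lp_on p (cyl \<Omega> T) v \<and> Lp_on p (cyl \<Omega> T) g \<and> weak_sgrad (cyl \<Omega> T) v g"

definition F_class ::
  "real \<Rightarrow> 'a::euclidean_space set \<Rightarrow> real \<Rightarrow> ('a \<times> real \<Rightarrow> real) \<Rightarrow> ('a \<times> real \<Rightarrow> real) \<Rightarrow> bool" where
  "F_class p \<Omega> T \<psi> v \<longleftrightarrow>
     continuous_on (closure (cyl \<Omega> T)) v \<and> (\<exists>g. par_sobolev p \<Omega> T v g)
     \<and> (\<forall>z\<in>par_boundary \<Omega> T. v z = \<psi> z) \<and> (\<forall>z\<in>cyl \<Omega> T. v z \<ge> \<psi> z)"

definition variational_solution ::
  "real \<Rightarrow> 'a::euclidean_space set \<Rightarrow> real \<Rightarrow> ('a \<times> real \<Rightarrow> real) \<Rightarrow> ('a \<times> real \<Rightarrow> real) \<Rightarrow> bool" where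
  "variational_solution p \<Omega> T \<psi> v \<longleftrightarrow>
     F_class p \<Omega> T \<psi> v \<and>
     (\<exists>g. par_sobolev p \<Omega> T v g \<and>
        (\<forall>\<phi>. smooth_on (cyl \<Omega> T) \<phi> \<and> F_class p \<Omega> T \<psi> \<phi> \<and> Lp_on (p / (p - 1)) (cyl \<Omega> T) (dt \<phi>)
           \<longrightarrow> (\<integral>z. norm (g z) powr (p - 2) * (g z \<bullet> (sgrad \<phi> z - g z))
                    + (\<phi> z - v z) * dt \<phi> z \<partial>lebesgue_on (cyl \<Omega> T))
               \<ge> 1/2 * (\<integral>x. \<bar>\<phi> (x, T) - v (x, T)\<bar>\<^sup>2 \<partial>lebesgue_on \<Omega>)))"

text \<open>Bounded domain with regular (Lipschitz) boundary: near each boundary point,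
  after choosing a unit direction e, Omega is the region above a Lipschitz graph over
  the hyperplane orthogonal to e.\<close>
definition lipschitz_domain :: "'a::euclidean_space set \<Rightarrow> bool" where
  "lipschitz_domain \<Omega> \<longleftrightarrow> open \<Omega> \<and> connected \<Omega> \<and> bounded \<Omega> \<and> \<Omega> \<noteq> {} \<and>
     (\<forall>x0\<in>frontier \<Omega>. \<exists>r>0. \<exists>e. norm e = 1 \<and> (\<exists>L \<gamma>. L-lipschitz_on UNIV \<gamma> \<and>
        \<Omega> \<inter> ball x0 r = {x \<in> ball x0 r. x \<bullet> e > \<gamma> (x - (x \<bullet> e) *\<^sub>R e)}))"

end

theory Submission
  imports Defs
begin

text \<open>
  Let \<open>u\<close>, \<open>v\<close> be two solutions with weak gradients \<open>g\<^sub>u\<close>, \<open>g\<^sub>v\<close>, and put \<open>w = (u + v) / 2\<close>. Both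
  variational inequalities are tested with a smooth competitor \<open>\<phi>\<close> close to \<open>w\<close> and added. The
  competitor is \<open>\<phi> = G(W) + 3 \<delta> \<eta>\<close>. Here \<open>W\<close> is a convolution of the zero extension of \<open>w\<close> with a
  product kernel whose time factor is a smoothed exponential, so that \<open>\<epsilon> W\<^sub>t = f - W\<close> with \<open>f\<close>
  uniformly close to \<open>w\<close>; up to an exact time derivative and small terms, \<open>(\<phi> - w) \<phi>\<^sub>t\<close> is then
  \<open>- G'(W) (f - W)\<^sup>2 / \<epsilon> \<le> 0\<close>. The truncation \<open>G\<close> vanishes on \<open>[-\<delta>, \<delta>]\<close>, which restores the zero
  boundary values, makes the gradient of \<open>G(W)\<close> depend on \<open>w\<close> only away from the lateral boundary,
  and gives \<open>G(W) \<ge> 0\<close> off the support of the obstacle \<open>\<psi>\<close>; on that support \<open>3 \<delta> \<eta>\<close> lifts the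
  competitor above \<open>\<psi>\<close>.

  For \<open>\<delta> \<rightarrow> 0\<close> the gradients of the competitors tend to \<open>(g\<^sub>u + g\<^sub>v) / 2\<close> where \<open>w \<noteq> 0\<close> and to 0 where
  \<open>w = 0\<close>. The limiting integrand is nonpositive: by monotonicity of \<open>|a|\<^sup>p\<^sup>-\<^sup>2 a\<close> on the first set,
  and because it equals \<open>- |g\<^sub>u|\<^sup>p - |g\<^sub>v|\<^sup>p\<close> on the second, so it is not necessary to know that weak
  gradients vanish on level sets. Hence \<open>g\<^sub>u = g\<^sub>v\<close> almost everywhere, and the truncated convolution
  of \<open>u - v\<close>, which has zero spatial gradient and vanishes near the lateral boundary, is 0.
\<close>

section \<open>Smooth functions\<close>

definition pderiv_along :: "'b::euclidean_space \<Rightarrow> ('b \<Rightarrow> real) \<Rightarrow> ('b \<Rightarrow> real) \<Rightarrow> bool" where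
  "pderiv_along d f f' \<longleftrightarrow> (\<forall>z. ((\<lambda>s. f (z + s *\<^sub>R d)) has_real_derivative f' z) (at 0))"

abbreviation smooth :: "('b::euclidean_space \<Rightarrow> real) \<Rightarrow> bool" where
  "smooth \<equiv> smooth_on UNIV"

lemma pderiv_alongD: "pderiv_along d f f' \<Longrightarrow> ((\<lambda>s. f (z + s *\<^sub>R d)) has_real_derivative f' z) (at 0)"
  by (simp add: pderiv_along_def)

lemma pderiv_along_pdir: "pderiv_along d f f' \<Longrightarrow> pdir d f = f'"
  by (auto simp: pderiv_along_def pdir_def intro!: ext DERIV_imp_deriv)

lemma pderiv_along_line:
  assumes "pderiv_along d f f'"
  shows "((\<lambda>s. f (z + s *\<^sub>R d)) has_real_derivative f' (z + t *\<^sub>R d)) (at t)"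
proof -
  have "((\<lambda>s. f ((z + t *\<^sub>R d) + s *\<^sub>R d)) has_real_derivative f' (z + t *\<^sub>R d)) (at 0)"
    using pderiv_alongD[OF assms] .
  then have "((\<lambda>s. f (z + (s + t) *\<^sub>R d)) has_real_derivative f' (z + t *\<^sub>R d)) (at 0)"
    by (simp add: algebra_simps)
  then show ?thesis
    using DERIV_shift[of "\<lambda>s. f (z + s *\<^sub>R d)" "f' (z + t *\<^sub>R d)" 0 t] by simp
qed

lemma pderiv_along_add:
  "pderiv_along d f f' \<Longrightarrow> pderiv_along d g g' \<Longrightarrow> pderiv_along d (\<lambda>z. f z + g z) (\<lambda>z. f' z + g' z)"
  unfolding pderiv_along_def by (auto intro!: derivative_intros)

lemma pderiv_along_const: "pderiv_along d (\<lambda>z. c) (\<lambda>z. 0)"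
  unfolding pderiv_along_def by (auto intro!: derivative_intros)

lemma pderiv_along_mult:
  "pderiv_along d f f' \<Longrightarrow> pderiv_along d g g' \<Longrightarrow> pderiv_along d (\<lambda>z. f z * g z) (\<lambda>z. f' z * g z + f z * g' z)"
  unfolding pderiv_along_def by (auto intro!: derivative_eq_intros)

lemma pderiv_along_compose:
  assumes "\<And>x. (F has_real_derivative F' x) (at x)" "pderiv_along d f f'"
  shows "pderiv_along d (\<lambda>z. F (f z)) (\<lambda>z. F' (f z) * f' z)"
  unfolding pderiv_along_def
proof
  fix z
  show "((\<lambda>s. F (f (z + s *\<^sub>R d))) has_real_derivative F' (f z) * f' z) (at 0)"
    using DERIV_chain2[of F "F' (f z)" "\<lambda>s. f (z + s *\<^sub>R d)" 0 "f' z"] assms(1) pderiv_alongD[OF assms(2)]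
    by simp
qed

lemma pderiv_along_linear: "bounded_linear L \<Longrightarrow> pderiv_along d L (\<lambda>z. L d)"
proof -
  assume L: "bounded_linear L"
  show ?thesis unfolding pderiv_along_def
    by (auto simp: linear_simps[OF L] intro!: derivative_eq_intros)
qed

lemma smooth_coinduct:
  assumes "P f"
    and "\<And>h. P h \<Longrightarrow> continuous_on UNIV h"
    and "\<And>h d. P h \<Longrightarrow> d \<in> Basis \<Longrightarrow> \<exists>h'. P h' \<and> pderiv_along d h h'"
  shows "smooth f"
proof -
  have P: "P (iter_pd ds f)" if "set ds \<subseteq> Basis" for ds
    using that
  proof (induction ds)
    case (Cons d ds)
    then obtain h' where h': "P h'" "pderiv_along d (iter_pd ds f) h'"
      using assms(3)[of "iter_pd ds f" d] by auto
    then show ?case using pderiv_along_pdir[OF h'(2)] by simp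
  qed (simp add: assms(1))
  show ?thesis
    unfolding smooth_on_def
  proof (intro allI impI conjI ballI)
    fix ds :: "'a list" assume ds: "set ds \<subseteq> Basis"
    show "continuous_on UNIV (iter_pd ds f)" using assms(2) P[OF ds] by blast
    fix z d :: 'a assume "d \<in> Basis"
    then obtain h' where "pderiv_along d (iter_pd ds f) h'" using assms(3)[OF P[OF ds]] by blast
    then show "(\<lambda>s. iter_pd ds f (z + s *\<^sub>R d)) differentiable (at 0)"
      using pderiv_alongD real_differentiable_def by blast
  qed
qed

lemma smooth_continuous: "smooth f \<Longrightarrow> continuous_on S f"
proof -
  assume "smooth f"
  then have "continuous_on UNIV (iter_pd [] f)" unfolding smooth_on_def by (metis empty_subsetI empty_set)
  then show ?thesis using continuous_on_subset by fastforce
qed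

lemma iter_pd_append: "iter_pd (ds @ es) f = iter_pd ds (iter_pd es f)"
  by (induction ds) auto

lemma smooth_pdir:
  assumes "smooth f" "d \<in> Basis"
  shows "smooth (pdir d f)"
proof -
  have "iter_pd ds (pdir d f) = iter_pd (ds @ [d]) f" for ds by (simp add: iter_pd_append)
  then show ?thesis using assms by (simp add: smooth_on_def del: iter_pd.simps)
qed

lemma smooth_pderiv_along:
  assumes "smooth f" "d \<in> Basis"
  shows "pderiv_along d f (pdir d f)"
  unfolding pderiv_along_def
proof
  fix z
  have "(\<lambda>s. iter_pd [] f (z + s *\<^sub>R d)) differentiable (at 0)"
    using assms unfolding smooth_on_def by (metis UNIV_I empty_subsetI empty_set)
  then show "((\<lambda>s. f (z + s *\<^sub>R d)) has_real_derivative pdir d f z) (at 0)"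
    unfolding pdir_def by (simp add: DERIV_deriv_iff_real_differentiable)
qed

inductive_set alg :: "('b::euclidean_space \<Rightarrow> real) set \<Rightarrow> ('b \<Rightarrow> real) set" for A where
  base: "f \<in> A \<Longrightarrow> f \<in> alg A"
| const: "(\<lambda>z. c) \<in> alg A"
| add: "f \<in> alg A \<Longrightarrow> g \<in> alg A \<Longrightarrow> (\<lambda>z. f z + g z) \<in> alg A"
| mult: "f \<in> alg A \<Longrightarrow> g \<in> alg A \<Longrightarrow> (\<lambda>z. f z * g z) \<in> alg A"

lemma alg_smooth:
  assumes cont: "\<And>f. f \<in> A \<Longrightarrow> continuous_on UNIV f"
    and der: "\<And>f d. f \<in> A \<Longrightarrow> d \<in> Basis \<Longrightarrow> \<exists>f'. f' \<in> alg A \<and> pderiv_along d f f'"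
    and "f \<in> alg A"
  shows "smooth f"
proof (rule smooth_coinduct[where P="\<lambda>f. f \<in> alg A"])
  fix h assume "h \<in> alg A"
  then show "continuous_on UNIV h"
    by induction (simp_all add: cont continuous_on_add continuous_on_mult)
next
  fix h :: "'a \<Rightarrow> real" and d :: 'a assume "h \<in> alg A" and d: "d \<in> Basis"
  then show "\<exists>h'. h' \<in> alg A \<and> pderiv_along d h h'"
  proof induction
    case (const c)
    then show ?case using pderiv_along_const alg.const by blast
  next
    case (add f g)
    then show ?case using pderiv_along_add alg.add by blast
  next
    case (mult f g)
    then obtain f' g' where "f' \<in> alg A" "pderiv_along d f f'" "g' \<in> alg A" "pderiv_along d g g'" by blast
    then show ?case using mult(1,2)
      by (intro exI[of _ "\<lambda>z. f' z * g z + f z * g' z"] conjI alg.add alg.mult pderiv_along_mult)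
  qed (use der in blast)
qed (use assms in auto)

lemma smooth_const: "smooth (\<lambda>z. c)"
  by (rule alg_smooth[where A="{}", OF _ _ alg.const]) auto

lemma alg_smooth_functions:
  assumes "f \<in> alg (Collect smooth)" shows "smooth f"
proof (rule alg_smooth[OF _ _ assms])
  fix f :: "'a \<Rightarrow> real" and d :: 'a assume "f \<in> Collect smooth" "d \<in> Basis"
  then have "pdir d f \<in> alg (Collect smooth)" "pderiv_along d f (pdir d f)"
    by (simp_all add: alg.base smooth_pdir smooth_pderiv_along)
  then show "\<exists>f'. f' \<in> alg (Collect smooth) \<and> pderiv_along d f f'" by blast
qed (simp add: smooth_continuous)

lemma smooth_add: "smooth f \<Longrightarrow> smooth g \<Longrightarrow> smooth (\<lambda>z. f z + g z)"
  by (rule alg_smooth_functions) (rule alg.add; rule alg.base; simp)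

lemma smooth_mult: "smooth f \<Longrightarrow> smooth g \<Longrightarrow> smooth (\<lambda>z. f z * g z)"
  by (rule alg_smooth_functions) (rule alg.mult; rule alg.base; simp)

lemma smooth_sum: "(\<And>i. i \<in> I \<Longrightarrow> smooth (f i)) \<Longrightarrow> smooth (\<lambda>z. \<Sum>i\<in>I. f i z)"
  by (induction I rule: infinite_finite_induct) (auto intro: smooth_const smooth_add)

lemma smooth_diff: "smooth f \<Longrightarrow> smooth g \<Longrightarrow> smooth (\<lambda>z. f z - g z)"
  using smooth_add[OF _ smooth_mult[OF smooth_const[of "-1"]], of f g] by simp

lemma smooth_linear: "bounded_linear f \<Longrightarrow> smooth f"
  by (rule alg_smooth[where A="{f}", OF _ _ alg.base])
    (auto intro: alg.const linear_continuous_on pderiv_along_linear)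

lemma smooth_real_DERIV:
  assumes "smooth (F :: real \<Rightarrow> real)"
  shows "(F has_real_derivative pdir 1 F x) (at x)"
  using pderiv_along_line[OF smooth_pderiv_along[OF assms], of 1 0 x] by simp

lemma smooth_compose:
  assumes "smooth (F :: real \<Rightarrow> real)" "smooth q"
  shows "smooth (\<lambda>z. F (q z))"
proof -
  define A where "A = {\<lambda>z. F (q z) | F. smooth (F :: real \<Rightarrow> real)} \<union> Collect smooth"
  have A1: "(\<lambda>z. F (q z)) \<in> A" if "smooth F" for F :: "real \<Rightarrow> real"
    unfolding A_def using that by blast
  have A2: "f \<in> A" if "smooth f" for f unfolding A_def using that by blast
  have A3: thesis if "f \<in> A" "\<And>F :: real \<Rightarrow> real. f = (\<lambda>z. F (q z)) \<Longrightarrow> smooth F \<Longrightarrow> thesis"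
    "smooth f \<Longrightarrow> thesis" for f thesis
    using that unfolding A_def by blast
  show ?thesis
  proof (rule alg_smooth[of A])
    fix f assume "f \<in> A"
    then show "continuous_on UNIV f"
    proof (rule A3)
      fix F :: "real \<Rightarrow> real" assume "f = (\<lambda>z. F (q z))" "smooth F"
      then show ?thesis using continuous_on_compose2[OF smooth_continuous[of F UNIV] smooth_continuous[OF assms(2)]] by simp
    qed (rule smooth_continuous)
  next
    fix f :: "'a \<Rightarrow> real" and d :: 'a assume "f \<in> A" and d: "d \<in> Basis"
    from this(1) show "\<exists>f'. f' \<in> alg A \<and> pderiv_along d f f'"
    proof (rule A3)
      fix F :: "real \<Rightarrow> real" assume F: "f = (\<lambda>z. F (q z))" "smooth F"
      have 1: "pderiv_along d f (\<lambda>z. pdir 1 F (q z) * pdir d q z)"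
        unfolding F(1)
        by (intro pderiv_along_compose smooth_real_DERIV smooth_pderiv_along F assms d)
      have "smooth (pdir 1 F)" using F(2) smooth_pdir[of F 1] by simp
      then have "(\<lambda>z. pdir 1 F (q z) * pdir d q z) \<in> alg A"
        using alg.mult[OF alg.base[OF A1] alg.base[OF A2[OF smooth_pdir[OF assms(2) d]]]] by simp
      with 1 show ?thesis by blast
    next
      assume "smooth f"
      then have "pdir d f \<in> alg A" "pderiv_along d f (pdir d f)"
        using d by (simp_all add: alg.base A2 smooth_pdir smooth_pderiv_along)
      then show ?thesis by blast
    qed
  qed (rule alg.base[OF A1[OF assms(1)]])
qed

lemma pderiv_along_reflect:
  assumes "pderiv_along d f f'"
  shows "pderiv_along d (\<lambda>y. f (c - y)) (\<lambda>y. - f' (c - y))"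
  unfolding pderiv_along_def
proof
  fix z
  have "((\<lambda>s. f (c - z + (- s) *\<^sub>R d)) has_real_derivative f' (c - z) * (-1)) (at 0)"
    by (rule DERIV_chain2[of "\<lambda>s. f (c - z + s *\<^sub>R d)" "f' (c - z)" uminus 0 "-1"])
      (use pderiv_alongD[OF assms, of "c - z"] in \<open>auto intro!: derivative_eq_intros\<close>)
  then show "((\<lambda>s. f (c - (z + s *\<^sub>R d))) has_real_derivative - f' (c - z)) (at 0)"
    by (simp add: algebra_simps)
qed

lemma smooth_reflect:
  assumes "smooth f"
  shows "smooth (\<lambda>y. f (c - y))"
proof (rule smooth_coinduct[where P="\<lambda>h. \<exists>f. smooth f \<and> h = (\<lambda>y. f (c - y))"])
  fix h :: "'a \<Rightarrow> real" assume "\<exists>f. smooth f \<and> h = (\<lambda>y. f (c - y))"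
  then obtain f where f: "smooth f" "h = (\<lambda>y. f (c - y))" by blast
  then show "continuous_on UNIV h"
    using continuous_on_compose2[OF smooth_continuous[OF f(1), of UNIV] continuous_on_diff[OF continuous_on_const continuous_on_id], of c UNIV]
    by simp
  fix d :: 'a assume d: "d \<in> Basis"
  show "\<exists>h'. (\<exists>f. smooth f \<and> h' = (\<lambda>y. f (c - y))) \<and> pderiv_along d h h'"
    unfolding f(2)
    by (rule exI, rule conjI[OF _ pderiv_along_reflect[OF smooth_pderiv_along[OF f(1) d]]],
        rule exI[of _ "\<lambda>z. 0 - pdir d f z"], rule conjI, rule smooth_diff[OF smooth_const smooth_pdir[OF f(1) d]]) simp
qed (use assms in auto)

lemma smooth_exp: "smooth (exp :: real \<Rightarrow> real)"
proof (rule smooth_coinduct[where P="\<lambda>f. f = exp"])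
  fix h :: "real \<Rightarrow> real" and d :: real assume "h = exp" "d \<in> Basis"
  then show "\<exists>h'. h' = exp \<and> pderiv_along d h h'"
    by (auto simp: pderiv_along_def intro!: derivative_eq_intros)
qed (auto intro: continuous_on_exp[OF continuous_on_id])

text \<open>Functions of this form are closed under differentiation, and all of them vanish to
  infinite order at 0.\<close>

definition bmp :: "nat \<Rightarrow> real \<Rightarrow> real" where
  "bmp n x = (if x > 0 then (1/x)^n * exp (-1/x) else 0)"

lemma bmp_nonneg: "bmp n x \<ge> 0"
  by (simp add: bmp_def)

lemma bmp_pos: "x > 0 \<Longrightarrow> bmp n x > 0"
  by (simp add: bmp_def)

lemma bmp_nonpos: "x \<le> 0 \<Longrightarrow> bmp n x = 0"
  by (simp add: bmp_def)

lemma bmp_0_le_1: "bmp 0 x \<le> 1"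
  by (simp add: bmp_def)

lemma power_times_exp_bound:
  assumes "(y::real) \<ge> 0" shows "y^n * exp (-y) \<le> fact n"
proof -
  have "y^n / fact n \<le> exp y"
  proof -
    have "(\<lambda>n. y^n /\<^sub>R fact n) sums exp y" by (rule exp_converges)
    moreover have "(\<Sum>k\<in>{n}. y^k /\<^sub>R fact k) \<le> (\<Sum>k. y^k /\<^sub>R fact k)"
      by (rule sum_le_suminf) (use calculation assms in \<open>auto simp: sums_iff\<close>)
    ultimately show ?thesis by (simp add: sums_iff field_simps)
  qed
  then show ?thesis by (simp add: exp_minus field_simps)
qed

lemma bmp_le_fact: "bmp n x \<le> fact n"
  using power_times_exp_bound[of "1/x" n] by (simp add: bmp_def)

lemma bmp_abs_le_square: "\<bar>bmp n x\<bar> \<le> fact (Suc (Suc n)) * \<bar>x\<bar>^2"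
proof (cases "x > 0")
  case True
  then have "bmp n x = x^2 * bmp (Suc (Suc n)) x" by (simp add: bmp_def power2_eq_square)
  then show ?thesis using bmp_le_fact[of "Suc (Suc n)" x] bmp_nonneg[of n x] True
    by (simp add: mult.commute mult_right_mono del: fact_Suc)
next
  case False
  then show ?thesis by (simp add: bmp_def)
qed

lemma bmp_DERIV: "(bmp n has_real_derivative bmp (n+2) x - real n * bmp (n+1) x) (at x)"
proof -
  consider "x > 0" | "x < 0" | "x = 0" by linarith
  then show ?thesis
  proof cases
    case 1
    have d: "((\<lambda>x. 1/x) has_real_derivative - ((1/x) * (1/x))) (at x)"
      using 1 by (auto intro!: derivative_eq_intros simp: power2_eq_square)
    have e: "((\<lambda>x. exp (-1/x)) has_real_derivative exp (-1/x) * ((1/x) * (1/x))) (at x)"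
      using 1 by (auto intro!: derivative_eq_intros simp: power2_eq_square)
    have "((\<lambda>x. (1/x)^n * exp (-1/x)) has_real_derivative
        real n * (- ((1/x) * (1/x)) * (1/x)^(n - Suc 0)) * exp (-1/x) + exp (-1/x) * ((1/x) * (1/x)) * (1/x)^n) (at x)"
      by (rule DERIV_mult[OF DERIV_power[OF d] e])
    also have "real n * (- ((1/x) * (1/x)) * (1/x)^(n - Suc 0)) * exp (-1/x) + exp (-1/x) * ((1/x) * (1/x)) * (1/x)^n
        = bmp (n+2) x - real n * bmp (n+1) x"
      using 1 by (cases n) (simp_all add: bmp_def algebra_simps)
    finally have "((\<lambda>x. (1/x)^n * exp (-1/x)) has_real_derivative bmp (n+2) x - real n * bmp (n+1) x) (at x)" .
    then show ?thesis
      by (rule has_field_derivative_transform_within_open[where S="{0<..}"]) (use 1 in \<open>auto simp: bmp_def\<close>)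
  next
    case 2
    have "((\<lambda>x. 0) has_real_derivative bmp (n+2) x - real n * bmp (n+1) x) (at x)"
      using 2 by (auto simp: bmp_def)
    then show ?thesis
      by (rule has_field_derivative_transform_within_open[where S="{..<0}"]) (use 2 in \<open>auto simp: bmp_def\<close>)
  next
    case 3
    have "((\<lambda>h. (bmp n (0 + h) - bmp n 0) / h) \<longlongrightarrow> 0) (at 0)"
    proof (rule Lim_null_comparison)
      show "\<forall>\<^sub>F h in at 0. norm ((bmp n (0 + h) - bmp n 0) / h) \<le> fact (Suc (Suc n)) * \<bar>h\<bar>"
      proof (rule eventuallyI)
        fix h :: real
        show "norm ((bmp n (0 + h) - bmp n 0) / h) \<le> fact (Suc (Suc n)) * \<bar>h\<bar>"
          using bmp_abs_le_square[of n h]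
          by (cases "h = 0") (simp_all add: bmp_nonpos abs_divide power2_eq_square divide_simps ac_simps del: fact_Suc)
      qed
      show "((\<lambda>h::real. fact (Suc (Suc n)) * \<bar>h\<bar>) \<longlongrightarrow> 0) (at 0)"
        by (intro tendsto_eq_intros) auto
    qed
    then show ?thesis using 3 by (simp add: DERIV_def bmp_nonpos)
  qed
qed

lemma bmp_continuous: "continuous_on S (bmp n)"
  using bmp_DERIV DERIV_isCont continuous_at_imp_continuous_on by blast

lemma smooth_bmp: "smooth (bmp n)"
proof (rule alg_smooth[where A="range bmp"])
  fix f and d :: real assume "f \<in> range bmp" and d: "d \<in> Basis"
  then obtain n where f: "f = bmp n" by auto
  have "(\<lambda>x. bmp (n+2) x + (- real n) * bmp (n+1) x) \<in> alg (range bmp)"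
    by (intro alg.add alg.mult alg.const alg.base) auto
  moreover have "pderiv_along d f (\<lambda>x. bmp (n+2) x + (- real n) * bmp (n+1) x)"
    unfolding pderiv_along_def f
  proof
    fix z
    have "((\<lambda>s. bmp n (z + s)) has_real_derivative bmp (n+2) z - real n * bmp (n+1) z) (at 0)"
      using bmp_DERIV[of n z] DERIV_shift[of "bmp n" _ 0 z] by (simp add: add.commute)
    then show "((\<lambda>s. bmp n (z + s *\<^sub>R d)) has_real_derivative bmp (n+2) z + (- real n) * bmp (n+1) z) (at 0)"
      using d by simp
  qed
  ultimately show "\<exists>f'. f' \<in> alg (range bmp) \<and> pderiv_along d f f'" by blast
qed (auto intro: bmp_continuous alg.base)

section \<open>Smooth truncation and differentiation under the integral\<close>

text \<open>A smooth odd truncation that vanishes on \<open>[-\<delta>, \<delta>]\<close> and differs from the identity by at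
  most \<open>2 \<delta>\<close>; \<open>thr'\<close> is its derivative.\<close>

definition thr :: "real \<Rightarrow> real \<Rightarrow> real" where
  "thr \<delta> s = s * bmp 0 (s\<^sup>2 / \<delta>\<^sup>2 - 1)"

definition thr' :: "real \<Rightarrow> real \<Rightarrow> real" where
  "thr' \<delta> s = bmp 0 (s\<^sup>2 / \<delta>\<^sup>2 - 1) + 2 * (s\<^sup>2 / \<delta>\<^sup>2) * bmp 2 (s\<^sup>2 / \<delta>\<^sup>2 - 1)"

lemma smooth_thr: "smooth (thr \<delta>)"
proof -
  have id: "smooth (\<lambda>s::real. s)" by (rule smooth_linear) (rule bounded_linear_ident)
  have "smooth (\<lambda>s::real. s * s * (1 / \<delta>\<^sup>2) - 1)"
    by (intro smooth_diff smooth_mult id smooth_const)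
  then have "smooth (\<lambda>s. s * bmp 0 (s * s * (1 / \<delta>\<^sup>2) - 1))"
    by (intro smooth_mult id smooth_compose[OF smooth_bmp])
  then show ?thesis by (simp add: thr_def[abs_def] power2_eq_square)
qed

lemma thr_DERIV:
  assumes "\<delta> > 0"
  shows "(thr \<delta> has_real_derivative thr' \<delta> s) (at s)"
proof -
  have 1: "((\<lambda>s. s\<^sup>2 / \<delta>\<^sup>2 - 1) has_real_derivative 2 * s / \<delta>\<^sup>2) (at s)"
    using assms by (auto intro!: derivative_eq_intros simp: field_simps)
  have 2: "(bmp 0 has_real_derivative bmp 2 (s\<^sup>2 / \<delta>\<^sup>2 - 1)) (at (s\<^sup>2 / \<delta>\<^sup>2 - 1))"
    using bmp_DERIV[of 0 "s\<^sup>2 / \<delta>\<^sup>2 - 1"] by (simp add: numeral_2_eq_2)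
  have "((\<lambda>s. s * bmp 0 (s\<^sup>2 / \<delta>\<^sup>2 - 1)) has_real_derivative
    1 * bmp 0 (s\<^sup>2 / \<delta>\<^sup>2 - 1) + (bmp 2 (s\<^sup>2 / \<delta>\<^sup>2 - 1) * (2 * s / \<delta>\<^sup>2)) * s) (at s)"
    by (rule DERIV_mult[OF DERIV_ident DERIV_chain2[OF 2 1]])
  then show ?thesis
    by (simp add: thr_def[abs_def] thr'_def power2_eq_square mult_ac)
qed

lemma thr'_continuous: "continuous_on S (thr' \<delta>)"
proof -
  have "continuous_on S (\<lambda>s. s\<^sup>2 * (1 / \<delta>\<^sup>2) - 1)"
    by (intro continuous_intros)
  then have "continuous_on S (\<lambda>s. bmp n (s\<^sup>2 * (1 / \<delta>\<^sup>2) - 1))" for n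
    using continuous_on_compose2[OF bmp_continuous[of UNIV n], of S] by auto
  then have "continuous_on S (\<lambda>s. bmp 0 (s\<^sup>2 * (1 / \<delta>\<^sup>2) - 1) + 2 * (s\<^sup>2 * (1 / \<delta>\<^sup>2)) * bmp 2 (s\<^sup>2 * (1 / \<delta>\<^sup>2) - 1))"
    by (intro continuous_intros) auto
  then show ?thesis by (simp add: thr'_def[abs_def])
qed

lemma sq_le_1_iff: "(\<delta>::real) > 0 \<Longrightarrow> s\<^sup>2 / \<delta>\<^sup>2 - 1 \<le> 0 \<longleftrightarrow> \<bar>s\<bar> \<le> \<delta>"
  by (simp add: divide_simps power2_le_iff_abs_le)

lemma thr_eq_0: "\<delta> > 0 \<Longrightarrow> \<bar>s\<bar> \<le> \<delta> \<Longrightarrow> thr \<delta> s = 0"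
  using sq_le_1_iff[of \<delta> s] by (simp add: thr_def bmp_nonpos)

lemma thr'_eq_0: "\<delta> > 0 \<Longrightarrow> \<bar>s\<bar> \<le> \<delta> \<Longrightarrow> thr' \<delta> s = 0"
  using sq_le_1_iff[of \<delta> s] by (simp add: thr'_def bmp_nonpos)

lemma thr_abs_le: "\<bar>thr \<delta> s\<bar> \<le> \<bar>s\<bar>"
  using bmp_0_le_1 bmp_nonneg by (simp add: thr_def abs_mult mult_left_le)

lemma thr_nonneg: "\<delta> > 0 \<Longrightarrow> s \<ge> - \<delta> \<Longrightarrow> thr \<delta> s \<ge> 0"
  by (cases "\<bar>s\<bar> \<le> \<delta>") (simp_all add: thr_eq_0, simp add: thr_def bmp_nonneg)

lemma thr'_nonneg: "thr' \<delta> s \<ge> 0"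
  by (simp add: thr'_def bmp_nonneg)

lemma thr'_le_4:
  shows "thr' \<delta> s \<le> 4"
proof (cases "s\<^sup>2 / \<delta>\<^sup>2 - 1 > 0")
  case True
  define x where "x = s\<^sup>2 / \<delta>\<^sup>2 - 1"
  define y where "y = 1 / x"
  have x: "x > 0" using True x_def by simp
  have y: "y > 0" using x y_def by simp
  have "thr' \<delta> s = exp (-y) * (1 + 2 * y + 2 * y\<^sup>2)"
  proof -
    have "(x + 1) * (1 / x)\<^sup>2 = y + y\<^sup>2"
      using x by (simp add: y_def power2_eq_square field_simps)
    moreover have "thr' \<delta> s = exp (-1/x) + 2 * ((x + 1) * (1/x)\<^sup>2) * exp (-1/x)"
      using x by (simp add: thr'_def bmp_def x_def)
    ultimately show ?thesis by (simp add: y_def algebra_simps)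
  qed
  moreover have "1 + 2 * y + 2 * y\<^sup>2 \<le> 4 * exp y"
    using exp_lower_Taylor_quadratic[of y] y by (auto simp: power2_eq_square)
  then have "exp (-y) * (1 + 2 * y + 2 * y\<^sup>2) \<le> exp (-y) * (4 * exp y)" by (intro mult_left_mono) auto
  moreover have "exp (-y) * (4 * exp y) = 4" by (simp add: exp_minus)
  ultimately show ?thesis by linarith
next
  case False
  then show ?thesis by (simp add: thr'_def bmp_nonpos)
qed

lemma thr_close: assumes "\<delta> > 0" shows "\<bar>thr \<delta> s - s\<bar> \<le> 2 * \<delta>"
proof (cases "\<bar>s\<bar> \<le> 2 * \<delta>")
  case True
  have "\<bar>thr \<delta> s - s\<bar> = \<bar>s\<bar> * (1 - bmp 0 (s\<^sup>2 / \<delta>\<^sup>2 - 1))"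
  proof -
    have "thr \<delta> s - s = - (s * (1 - bmp 0 (s\<^sup>2 / \<delta>\<^sup>2 - 1)))" by (simp add: thr_def algebra_simps)
    then show ?thesis using bmp_0_le_1[of "s\<^sup>2 / \<delta>\<^sup>2 - 1"] by (simp add: abs_mult)
  qed
  also have "\<dots> \<le> \<bar>s\<bar>" using bmp_nonneg by (simp add: mult_left_le)
  finally show ?thesis using True by simp
next
  case False
  define x where "x = s\<^sup>2 / \<delta>\<^sup>2 - 1"
  have s2: "s\<^sup>2 / \<delta>\<^sup>2 = (\<bar>s\<bar> / \<delta>)\<^sup>2" by (simp add: power_divide)
  have q: "\<bar>s\<bar> / \<delta> \<ge> 2" using False assms by (simp add: field_simps)
  have "(\<bar>s\<bar> / \<delta>)\<^sup>2 \<ge> 2 * (\<bar>s\<bar> / \<delta>)" using mult_right_mono[OF q, of "\<bar>s\<bar> / \<delta>"] q by (simp add: power2_eq_square)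
  then have x: "x \<ge> \<bar>s\<bar> / \<delta>" "x > 0" using q by (auto simp: x_def s2)
  have "\<bar>thr \<delta> s - s\<bar> = \<bar>s\<bar> * (1 - exp (-1/x))"
  proof -
    have "thr \<delta> s - s = - (s * (1 - exp (-1/x)))" using x by (simp add: thr_def bmp_def x_def[symmetric] algebra_simps)
    then show ?thesis using x by (simp add: abs_mult)
  qed
  also have "\<dots> \<le> \<bar>s\<bar> * (1 / x)"
    using exp_ge_add_one_self[of "-1/x"] by (intro mult_left_mono) auto
  also have "\<dots> \<le> \<delta>" using x assms by (simp add: field_simps)
  finally show ?thesis using assms by simp
qed

lemma thr'_tendsto_1:
  assumes "\<And>n. \<delta> n > 0" "\<delta> \<longlonglongrightarrow> 0" "a \<longlonglongrightarrow> l" "l \<noteq> 0"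
  shows "(\<lambda>n. thr' (\<delta> n) (a n)) \<longlonglongrightarrow> 1"
proof -
  define y where "y n = (\<delta> n)\<^sup>2 / (a n)\<^sup>2" for n
  have y0: "y \<longlonglongrightarrow> 0"
    unfolding y_def using tendsto_divide[OF tendsto_power[OF assms(2), of 2] tendsto_power[OF assms(3), of 2]] assms(4) by simp
  have "((\<lambda>n. exp (- (y n / (1 - y n))) * (1 + 2 * (y n / (1 - y n)\<^sup>2))) \<longlongrightarrow> exp (- (0 / (1 - 0))) * (1 + 2 * (0 / (1 - 0)\<^sup>2))) sequentially"
    by (intro tendsto_intros y0) auto
  then have lim: "(\<lambda>n. exp (- (y n / (1 - y n))) * (1 + 2 * (y n / (1 - y n)\<^sup>2))) \<longlonglongrightarrow> 1" by simp
  have ev: "\<forall>\<^sub>F n in sequentially. y n < 1" "\<forall>\<^sub>F n in sequentially. a n \<noteq> 0"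
    using order_tendstoD(2)[OF y0] tendsto_imp_eventually_ne[OF assms(3,4)] by auto
  have "\<forall>\<^sub>F n in sequentially. exp (- (y n / (1 - y n))) * (1 + 2 * (y n / (1 - y n)\<^sup>2)) = thr' (\<delta> n) (a n)"
    using ev
  proof eventually_elim
    case (elim n)
    have yp: "y n > 0" using elim assms(1)[of n] by (simp add: y_def)
    have e: "(a n)\<^sup>2 / (\<delta> n)\<^sup>2 = 1 / y n" by (simp add: y_def)
    have p: "1 / y n - 1 > 0" using elim yp by (simp add: field_simps)
    have e1: "1 / (1 / y n - 1) = y n / (1 - y n)" using yp elim by (simp add: field_simps)
    have "thr' (\<delta> n) (a n) = exp (- (y n / (1 - y n))) + 2 * ((1 / y n) * (y n / (1 - y n))\<^sup>2) * exp (- (y n / (1 - y n)))"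
      using p by (simp only: thr'_def e bmp_def if_True e1 divide_minus_left power_0 mult_1_left mult_ac)
    also have "(1 / y n) * (y n / (1 - y n))\<^sup>2 = y n / (1 - y n)\<^sup>2"
      using yp by (simp add: power2_eq_square)
    finally show ?case by (simp add: algebra_simps)
  qed
  then show ?thesis using Lim_transform_eventually[OF lim] by simp
qed

lemma DERIV_under_integral:
  fixes F F' :: "real \<Rightarrow> 'b \<Rightarrow> real"
  assumes r: "r > 0"
    and der: "\<And>s y. \<bar>s\<bar> < r \<Longrightarrow> ((\<lambda>s. F s y) has_real_derivative F' s y) (at s)"
    and int: "\<And>s. \<bar>s\<bar> < r \<Longrightarrow> integrable M (F s)"
    and meas: "F' 0 \<in> borel_measurable M"
    and bound: "\<And>s y. \<bar>s\<bar> < r \<Longrightarrow> \<bar>F' s y\<bar> \<le> B y"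
    and B: "integrable M B"
  shows "((\<lambda>s. \<integral>y. F s y \<partial>M) has_real_derivative (\<integral>y. F' 0 y \<partial>M)) (at 0)"
  unfolding DERIV_def tendsto_at_iff_sequentially
proof (intro allI impI)
  fix X :: "nat \<Rightarrow> real" assume X: "\<forall>i. X i \<in> UNIV - {0}" "X \<longlonglongrightarrow> 0"
  obtain N where N: "\<And>n. n \<ge> N \<Longrightarrow> \<bar>X n\<bar> < r"
    using LIMSEQ_D[OF X(2) r] by auto
  define Y where "Y n = X (n + N)" for n
  have Y: "\<And>n. \<bar>Y n\<bar> < r" "\<And>n. Y n \<noteq> 0" "Y \<longlonglongrightarrow> 0"
    using N X LIMSEQ_ignore_initial_segment[OF X(2), of N] by (auto simp: Y_def[abs_def])
  have "(\<lambda>n. \<integral>y. (F (Y n) y - F 0 y) / Y n \<partial>M) \<longlonglongrightarrow> (\<integral>y. F' 0 y \<partial>M)"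
  proof (rule integral_dominated_convergence[where w=B])
    show "(\<lambda>y. (F (Y n) y - F 0 y) / Y n) \<in> borel_measurable M" for n
      using int[of "Y n"] int[of 0] Y r by auto
    show "AE y in M. (\<lambda>n. (F (Y n) y - F 0 y) / Y n) \<longlonglongrightarrow> F' 0 y"
    proof (rule AE_I2)
      fix y
      have "((\<lambda>h. (F (0 + h) y - F 0 y) / h) \<longlongrightarrow> F' 0 y) (at 0)"
        using der[of 0 y] r unfolding DERIV_def by simp
      then show "(\<lambda>n. (F (Y n) y - F 0 y) / Y n) \<longlonglongrightarrow> F' 0 y"
        unfolding tendsto_at_iff_sequentially using Y by (auto simp: o_def)
    qed
    show "AE y in M. norm ((F (Y n) y - F 0 y) / Y n) \<le> B y" for n
    proof (rule AE_I2)
      fix y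
      have "norm (F (Y n) y - F 0 y) \<le> B y * norm (Y n - 0)"
      proof (rule field_differentiable_bound[of "{-r<..<r}" "\<lambda>s. F s y" "\<lambda>s. F' s y"])
        fix s assume "s \<in> {-r<..<r}"
        then have s: "\<bar>s\<bar> < r" by auto
        show "((\<lambda>s. F s y) has_field_derivative F' s y) (at s within {-r<..<r})"
          using der[OF s] has_field_derivative_at_within by blast
        show "norm (F' s y) \<le> B y" using bound[OF s] by simp
      qed (use Y(1)[of n] r in auto)
      then show "norm ((F (Y n) y - F 0 y) / Y n) \<le> B y"
        using Y(2)[of n] by (simp add: divide_simps)
    qed
  qed (use B meas in auto)
  moreover have "(\<integral>y. (F (Y n) y - F 0 y) / Y n \<partial>M) = ((\<integral>y. F (Y n) y \<partial>M) - (\<integral>y. F 0 y \<partial>M)) / Y n" for n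
    using Bochner_Integration.integral_diff[OF int[OF Y(1), of n] int[of 0]] r by simp
  then have "(\<lambda>n. \<integral>y. (F (Y n) y - F 0 y) / Y n \<partial>M) = (\<lambda>n. ((\<integral>y. F (Y n) y \<partial>M) - (\<integral>y. F 0 y \<partial>M)) / Y n)"
    by (rule ext)
  ultimately have "(\<lambda>n. ((\<integral>y. F (X (n + N)) y \<partial>M) - (\<integral>y. F 0 y \<partial>M)) / X (n + N)) \<longlonglongrightarrow> (\<integral>y. F' 0 y \<partial>M)"
    by (simp only: Y_def)
  then show "((\<lambda>h. ((\<integral>y. F (0 + h) y \<partial>M) - (\<integral>y. F 0 y \<partial>M)) / h) \<circ> X) \<longlonglongrightarrow> (\<integral>y. F' 0 y \<partial>M)"
    using LIMSEQ_offset[of "\<lambda>n. ((\<integral>y. F (X n) y \<partial>M) - (\<integral>y. F 0 y \<partial>M)) / X n" N] by (simp add: o_def)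
qed

lemma lborel_distr_translate: "distr lborel borel (\<lambda>x. x + c) = (lborel :: 'b::euclidean_space measure)"
  using lborel_distr_plus[of c] by (subst add.commute)

lemma lborel_distr_reflect: "distr lborel borel (\<lambda>x. c - x) = (lborel :: 'b::euclidean_space measure)"
proof -
  have "(lborel :: 'b measure) = density (distr lborel borel (\<lambda>x. c + (-1) *\<^sub>R x)) (\<lambda>_. ennreal (\<bar>-1::real\<bar> ^ DIM('b)))"
    by (rule lborel_affine) simp
  also have "\<dots> = distr lborel borel (\<lambda>x. c - x)"
    by (simp add: density_1)
  finally show ?thesis by simp
qed

lemma lborel_integral_reflect:
  fixes f :: "'b::euclidean_space \<Rightarrow> 'c::{banach, second_countable_topology}"
  assumes "f \<in> borel_measurable borel"
  shows "(\<integral>x. f (c - x) \<partial>lborel) = (\<integral>x. f x \<partial>lborel)"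
  using integral_distr[of "\<lambda>x. c - x" lborel borel f] assms by (simp add: lborel_distr_reflect)

lemma lborel_integrable_reflect:
  fixes f :: "'b::euclidean_space \<Rightarrow> 'c::{banach, second_countable_topology}"
  assumes "f \<in> borel_measurable borel"
  shows "integrable lborel (\<lambda>x. f (c - x)) \<longleftrightarrow> integrable lborel f"
  using integrable_distr_eq[of "\<lambda>x. c - x" lborel borel f] assms by (simp add: lborel_distr_reflect)

lemma lborel_integral_translate:
  fixes f :: "'b::euclidean_space \<Rightarrow> 'c::{banach, second_countable_topology}"
  assumes "f \<in> borel_measurable borel"
  shows "(\<integral>x. f (x + c) \<partial>lborel) = (\<integral>x. f x \<partial>lborel)"
  using integral_distr[of "\<lambda>x. x + c" lborel borel f] assms by (simp add: lborel_distr_translate)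

lemma lborel_integrable_translate:
  fixes f :: "'b::euclidean_space \<Rightarrow> 'c::{banach, second_countable_topology}"
  assumes "f \<in> borel_measurable borel"
  shows "integrable lborel (\<lambda>x. f (x + c)) \<longleftrightarrow> integrable lborel f"
  using integrable_distr_eq[of "\<lambda>x. x + c" lborel borel f] assms by (simp add: lborel_distr_translate)

lemma integral_pderiv_eq_0:
  fixes F F' :: "'b::euclidean_space \<Rightarrow> real"
  assumes "pderiv_along d F F'" "integrable lborel F" "F' \<in> borel_measurable borel"
    and "\<And>s z. \<bar>s\<bar> < 1 \<Longrightarrow> \<bar>F' (z + s *\<^sub>R d)\<bar> \<le> B z" "integrable lborel B"
  shows "(\<integral>z. F' z \<partial>lborel) = 0"
proof -
  have m: "F \<in> borel_measurable borel" using assms(2) by auto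
  have "((\<lambda>s. \<integral>z. F (z + s *\<^sub>R d) \<partial>lborel) has_real_derivative (\<integral>z. F' (z + 0 *\<^sub>R d) \<partial>lborel)) (at 0)"
    by (rule DERIV_under_integral[where r=1 and B=B])
      (use assms pderiv_along_line[OF assms(1)] in \<open>auto simp: lborel_integrable_translate[OF m]\<close>)
  then have "((\<lambda>s::real. \<integral>z. F z \<partial>lborel) has_real_derivative (\<integral>z. F' z \<partial>lborel)) (at 0)"
    by (simp add: lborel_integral_translate[OF m])
  then show ?thesis using DERIV_unique[OF _ DERIV_const] by blast
qed

lemma continuous_vanish_integrable:
  fixes f :: "'b::euclidean_space \<Rightarrow> real"
  assumes "continuous_on UNIV f" "\<And>z. z \<notin> cball 0 R \<Longrightarrow> f z = 0"
  shows "integrable lborel f"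
proof -
  have "integrable lborel (\<lambda>x. indicator (cball 0 R) x *\<^sub>R f x)"
    by (rule borel_integrable_compact) (use continuous_on_subset[OF assms(1)] in auto)
  also have "(\<lambda>x. indicator (cball 0 R) x *\<^sub>R f x) = f"
    using assms(2) by (auto simp: indicator_def fun_eq_iff)
  finally show ?thesis .
qed

lemma continuous_bounded_on_cball:
  fixes f :: "'b::euclidean_space \<Rightarrow> real"
  assumes "continuous_on UNIV f"
  obtains B where "B \<ge> 0" "\<And>z. z \<in> cball 0 R \<Longrightarrow> \<bar>f z\<bar> \<le> B"
proof -
  have "compact (f ` cball 0 R)"
    using compact_continuous_image[OF continuous_on_subset[OF assms]] by simp
  then obtain B where "\<forall>x\<in>f ` cball 0 R. norm x \<le> B" using compact_imp_bounded bounded_iff by blast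
  then show ?thesis using that[of "max B 0"] by force
qed

lemma pderiv_vanish:
  assumes "pderiv_along d F F'" "open U" "\<And>z. z \<in> U \<Longrightarrow> F z = 0" "z \<in> U"
  shows "F' z = 0"
proof -
  have "\<forall>\<^sub>F s in nhds 0. z + s *\<^sub>R d \<in> U"
  proof -
    have "((\<lambda>s. z + s *\<^sub>R d) \<longlongrightarrow> z + 0 *\<^sub>R d) (nhds 0)" by (intro tendsto_intros filterlim_ident)
    then show ?thesis using topological_tendstoD[OF _ assms(2)] assms(4) by simp
  qed
  then have "\<forall>\<^sub>F s in nhds 0. F (z + s *\<^sub>R d) = 0"
    by eventually_elim (rule assms(3))
  then have "((\<lambda>s::real. 0) has_real_derivative F' z) (at 0)"
    using DERIV_cong_ev[of 0 0 "\<lambda>s. F (z + s *\<^sub>R d)" "\<lambda>s. 0" "F' z" "F' z"] pderiv_alongD[OF assms(1), of z] by simp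
  then show ?thesis using DERIV_unique[OF _ DERIV_const] by blast
qed

lemma integral_pderiv_compact_support:
  fixes F :: "'b::euclidean_space \<Rightarrow> real"
  assumes "smooth F" "d \<in> Basis" "\<And>z. z \<notin> cball 0 R \<Longrightarrow> F z = 0"
  shows "(\<integral>z. pdir d F z \<partial>lborel) = 0"
proof -
  have c: "continuous_on UNIV F" "continuous_on UNIV (pdir d F)"
    using assms by (simp_all add: smooth_continuous smooth_pdir)
  have v: "pdir d F z = 0" if "z \<notin> cball 0 R" for z
    by (rule pderiv_vanish[OF smooth_pderiv_along[OF assms(1,2)], of "- cball 0 R"]) (use assms(3) that in auto)
  obtain B where B: "B \<ge> 0" "\<And>z. z \<in> cball 0 R \<Longrightarrow> \<bar>pdir d F z\<bar> \<le> B"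
    using continuous_bounded_on_cball[OF c(2)] by blast
  show ?thesis
  proof (rule integral_pderiv_eq_0[OF smooth_pderiv_along[OF assms(1,2)], where B="\<lambda>z. B * indicator (cball 0 (R+1)) z"])
    show "integrable lborel F" by (rule continuous_vanish_integrable[OF c(1) assms(3)])
    show "pdir d F \<in> borel_measurable borel" by (rule borel_measurable_continuous_onI[OF c(2)])
    show "integrable lborel (\<lambda>z. B * indicator (cball 0 (R+1)) z :: real)"
      by (intro integrable_mult_right integrable_real_indicator emeasure_lborel_cball_finite) auto
    fix s :: real and z :: 'b assume s: "\<bar>s\<bar> < 1"
    show "\<bar>pdir d F (z + s *\<^sub>R d)\<bar> \<le> B * indicator (cball 0 (R+1)) z"
    proof (cases "z + s *\<^sub>R d \<in> cball 0 R")
      case True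
      have "norm z \<le> norm (z + s *\<^sub>R d) + norm (s *\<^sub>R d)" using norm_triangle_ineq4[of "z + s *\<^sub>R d" "s *\<^sub>R d"] by simp
      then have "z \<in> cball 0 (R+1)" using True s assms(2) by simp
      then show ?thesis using B(2)[OF True] by simp
    qed (use v B in auto)
  qed
qed

lemma integration_by_parts_smooth:
  fixes f g :: "'b::euclidean_space \<Rightarrow> real"
  assumes "smooth f" "smooth g" "d \<in> Basis" "\<And>z. z \<notin> cball 0 R \<Longrightarrow> g z = 0"
  shows "(\<integral>z. f z * pdir d g z \<partial>lborel) = - (\<integral>z. pdir d f z * g z \<partial>lborel)"
proof -
  have D: "pderiv_along d (\<lambda>z. f z * g z) (\<lambda>z. pdir d f z * g z + f z * pdir d g z)"
    by (intro pderiv_along_mult smooth_pderiv_along assms)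
  have v: "pdir d g z = 0" if "z \<notin> cball 0 R" for z
    by (rule pderiv_vanish[OF smooth_pderiv_along[OF assms(2,3)], of "- cball 0 R"]) (use assms(4) that in auto)
  have "(\<integral>z. pdir d (\<lambda>z. f z * g z) z \<partial>lborel) = 0"
    by (rule integral_pderiv_compact_support[where R=R]) (use assms in \<open>auto intro: smooth_mult\<close>)
  then have "(\<integral>z. pdir d f z * g z + f z * pdir d g z \<partial>lborel) = 0"
    by (simp add: pderiv_along_pdir[OF D])
  moreover have "integrable lborel (\<lambda>z. pdir d f z * g z)" "integrable lborel (\<lambda>z. f z * pdir d g z)"
    by (rule continuous_vanish_integrable[where R=R, OF continuous_on_mult[OF smooth_continuous smooth_continuous]];
        use assms v in \<open>simp add: smooth_pdir\<close>)+
  ultimately show ?thesis by simp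
qed

section \<open>Convolution\<close>

definition conv :: "('b::euclidean_space \<Rightarrow> real) \<Rightarrow> ('b \<Rightarrow> real) \<Rightarrow> 'b \<Rightarrow> real" where
  "conv k f z = (\<integral>y. k (z - y) * f y \<partial>lborel)"

lemma conv_integrand_integrable:
  fixes k f :: "'b::euclidean_space \<Rightarrow> real"
  assumes "continuous_on UNIV k" "integrable lborel f" "\<And>y. y \<notin> cball 0 R \<Longrightarrow> f y = 0"
  shows "integrable lborel (\<lambda>y. k (z - y) * f y)"
proof -
  have [measurable]: "k \<in> borel_measurable borel" by (rule borel_measurable_continuous_onI[OF assms(1)])
  have [measurable]: "f \<in> borel_measurable borel" using assms(2) by auto
  obtain B where B: "B \<ge> 0" "\<And>y. y \<in> cball 0 (norm z + R) \<Longrightarrow> \<bar>k y\<bar> \<le> B"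
    using continuous_bounded_on_cball[OF assms(1)] by blast
  show ?thesis
  proof (rule Bochner_Integration.integrable_bound[of lborel "\<lambda>y. B * f y"])
    show "AE y in lborel. norm (k (z - y) * f y) \<le> norm (B * f y)"
    proof (rule AE_I2)
      fix y
      show "norm (k (z - y) * f y) \<le> norm (B * f y)"
      proof (cases "y \<in> cball 0 R")
        case True
        then have "z - y \<in> cball 0 (norm z + R)" using norm_triangle_ineq4[of z y] by simp
        then show ?thesis using B by (simp add: abs_mult mult_right_mono)
      qed (simp add: assms(3))
    qed
  qed (use assms in auto)
qed

lemma integrable_mult_continuous:
  fixes f h :: "'b::euclidean_space \<Rightarrow> real"
  assumes "integrable lborel f" "\<And>y. y \<notin> cball 0 R \<Longrightarrow> f y = 0" "continuous_on UNIV h"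
  shows "integrable lborel (\<lambda>y. f y * h y)"
proof -
  have "continuous_on UNIV (\<lambda>y. h (- y))"
    by (rule continuous_on_compose2[OF assms(3)]) (auto intro: continuous_intros)
  from conv_integrand_integrable[OF this assms(1,2), of R 0]
  show ?thesis by (simp add: mult.commute)
qed

lemma conv_continuous:
  fixes k f :: "'b::euclidean_space \<Rightarrow> real"
  assumes "continuous_on UNIV k" "integrable lborel f" "\<And>y. y \<notin> cball 0 R \<Longrightarrow> f y = 0"
  shows "continuous_on UNIV (conv k f)"
  unfolding continuous_on_sequentially
proof (intro allI ballI impI)
  fix X z assume "(\<forall>n. X n \<in> UNIV) \<and> X \<longlonglongrightarrow> (z::'b)"
  then have X: "X \<longlonglongrightarrow> z" by simp
  have [measurable]: "k \<in> borel_measurable borel" by (rule borel_measurable_continuous_onI[OF assms(1)])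
  have [measurable]: "f \<in> borel_measurable borel" using assms(2) by auto
  obtain C where C: "\<And>n. norm (X n) \<le> C"
    using Bseq_def convergent_imp_Bseq[OF convergentI[OF X]] by (auto simp: Bseq_def)
  obtain B where B: "B \<ge> 0" "\<And>y. y \<in> cball 0 (C + R) \<Longrightarrow> \<bar>k y\<bar> \<le> B"
    using continuous_bounded_on_cball[OF assms(1)] by blast
  have "(\<lambda>n. conv k f (X n)) \<longlonglongrightarrow> conv k f z"
    unfolding conv_def
  proof (rule integral_dominated_convergence[where w="\<lambda>y. B * \<bar>f y\<bar>"])
    show "AE y in lborel. (\<lambda>n. k (X n - y) * f y) \<longlonglongrightarrow> k (z - y) * f y"
    proof (rule AE_I2)
      fix y
      have "isCont k (z - y)" using assms(1) by (simp add: continuous_on_eq_continuous_at)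
      then have "(\<lambda>n. k (X n - y)) \<longlonglongrightarrow> k (z - y)"
        by (rule isCont_tendsto_compose) (intro tendsto_intros X)
      then show "(\<lambda>n. k (X n - y) * f y) \<longlonglongrightarrow> k (z - y) * f y" by (intro tendsto_intros)
    qed
    show "AE y in lborel. norm (k (X n - y) * f y) \<le> B * \<bar>f y\<bar>" for n
    proof (rule AE_I2)
      fix y
      show "norm (k (X n - y) * f y) \<le> B * \<bar>f y\<bar>"
      proof (cases "y \<in> cball 0 R")
        case True
        then have "X n - y \<in> cball 0 (C + R)" using norm_triangle_ineq4[of "X n" y] C[of n] by simp
        then show ?thesis using B by (simp add: abs_mult mult_right_mono)
      qed (simp add: assms(3) B)
    qed
  qed (use assms in auto)
  then show "(conv k f \<circ> X) \<longlonglongrightarrow> conv k f z" by (simp add: o_def)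
qed

lemma conv_pderiv_along:
  fixes k f :: "'b::euclidean_space \<Rightarrow> real"
  assumes "smooth k" "integrable lborel f" "\<And>y. y \<notin> cball 0 R \<Longrightarrow> f y = 0" "d \<in> Basis"
  shows "pderiv_along d (conv k f) (conv (pdir d k) f)"
  unfolding pderiv_along_def
proof
  fix z :: 'b
  have c: "continuous_on UNIV k" "continuous_on UNIV (pdir d k)"
    using assms by (simp_all add: smooth_continuous smooth_pdir)
  have [measurable]: "k \<in> borel_measurable borel" "pdir d k \<in> borel_measurable borel"
    by (rule borel_measurable_continuous_onI, rule c)+
  have [measurable]: "f \<in> borel_measurable borel" using assms(2) by auto
  obtain B where B: "B \<ge> 0" "\<And>y. y \<in> cball 0 (norm z + 1 + R) \<Longrightarrow> \<bar>pdir d k y\<bar> \<le> B"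
    using continuous_bounded_on_cball[OF c(2)] by blast
  have "((\<lambda>s. \<integral>y. k ((z - y) + s *\<^sub>R d) * f y \<partial>lborel) has_real_derivative
      (\<integral>y. pdir d k ((z - y) + 0 *\<^sub>R d) * f y \<partial>lborel)) (at 0)"
  proof (rule DERIV_under_integral[where r=1 and B="\<lambda>y. B * \<bar>f y\<bar>"])
    fix s :: real and y assume s: "\<bar>s\<bar> < 1"
    show "((\<lambda>s. k (z - y + s *\<^sub>R d) * f y) has_real_derivative pdir d k (z - y + s *\<^sub>R d) * f y) (at s)"
      using DERIV_cmult_right[OF pderiv_along_line[OF smooth_pderiv_along[OF assms(1,4)]]] .
    show "\<bar>pdir d k (z - y + s *\<^sub>R d) * f y\<bar> \<le> B * \<bar>f y\<bar>"
    proof (cases "y \<in> cball 0 R")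
      case True
      have "norm (z - y + s *\<^sub>R d) \<le> norm z + norm y + norm (s *\<^sub>R d)"
        using norm_triangle_ineq[of "z - y" "s *\<^sub>R d"] norm_triangle_ineq4[of z y] by linarith
      then have "z - y + s *\<^sub>R d \<in> cball 0 (norm z + 1 + R)" using True s assms(4) by simp
      then show ?thesis using B by (simp add: abs_mult mult_right_mono)
    qed (simp add: assms(3) B)
  next
    fix s :: real assume "\<bar>s\<bar> < 1"
    show "integrable lborel (\<lambda>y. k (z - y + s *\<^sub>R d) * f y)"
      using conv_integrand_integrable[OF c(1) assms(2,3), where z="z + s *\<^sub>R d"] by (simp add: algebra_simps)
  qed (use assms in auto)
  then show "((\<lambda>s. conv k f (z + s *\<^sub>R d)) has_real_derivative conv (pdir d k) f z) (at 0)"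
    by (simp add: conv_def algebra_simps)
qed

lemma smooth_conv:
  fixes k f :: "'b::euclidean_space \<Rightarrow> real"
  assumes "smooth k" "integrable lborel f" "\<And>y. y \<notin> cball 0 R \<Longrightarrow> f y = 0"
  shows "smooth (conv k f)"
proof (rule smooth_coinduct[where P="\<lambda>h. \<exists>k. smooth k \<and> h = conv k f"])
  fix h assume "\<exists>k. smooth k \<and> h = conv k f"
  then obtain k where k: "smooth k" "h = conv k f" by blast
  show "continuous_on UNIV h" unfolding k(2)
    by (rule conv_continuous[OF smooth_continuous[OF k(1)] assms(2,3)])
  fix d :: 'b assume d: "d \<in> Basis"
  show "\<exists>h'. (\<exists>k. smooth k \<and> h' = conv k f) \<and> pderiv_along d h h'"
    using conv_pderiv_along[OF k(1) assms(2,3) d] smooth_pdir[OF k(1) d] k(2) by blast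
qed (use assms in blast)

lemma conv_commute:
  fixes k f :: "'b::euclidean_space \<Rightarrow> real"
  assumes [measurable]: "k \<in> borel_measurable borel" "f \<in> borel_measurable borel"
  shows "conv k f z = (\<integral>y. k y * f (z - y) \<partial>lborel)"
  using lborel_integral_reflect[of "\<lambda>y. k y * f (z - y)" z] by (simp add: conv_def)

lemma conv_bound_integrable:
  fixes k f :: "'b::euclidean_space \<Rightarrow> real"
  assumes "integrable lborel k" and [measurable]: "f \<in> borel_measurable borel"
    and "\<And>y. \<bar>f y\<bar> \<le> M"
  shows "integrable lborel (\<lambda>y. k y * f (z - y))"
proof (rule Bochner_Integration.integrable_bound[of lborel "\<lambda>y. M * k y"])
  have [measurable]: "k \<in> borel_measurable borel" using assms(1) by auto
  show "(\<lambda>y. k y * f (z - y)) \<in> borel_measurable lborel" by simp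
  have M: "M \<ge> 0" using assms(3)[of undefined] by linarith
  show "AE y in lborel. norm (k y * f (z - y)) \<le> norm (M * k y)"
    using mult_left_mono[OF assms(3), of "\<bar>k _\<bar>"] M by (intro AE_I2) (simp add: abs_mult mult.commute[of M])
qed (use assms in auto)

lemma conv_abs_le:
  fixes k f :: "'b::euclidean_space \<Rightarrow> real"
  assumes "integrable lborel k" "\<And>y. k y \<ge> 0" "(\<integral>y. k y \<partial>lborel) = 1"
    and [measurable]: "f \<in> borel_measurable borel" and "\<And>y. \<bar>f y\<bar> \<le> M"
  shows "\<bar>conv k f z\<bar> \<le> M"
proof -
  have [measurable]: "k \<in> borel_measurable borel" using assms(1) by auto
  have "\<bar>conv k f z\<bar> \<le> (\<integral>y. M * k y \<partial>lborel)"
    unfolding conv_commute[OF \<open>k \<in> borel_measurable borel\<close> assms(4)]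
  proof (rule integral_abs_bound_integral)
    fix y
    show "\<bar>k y * f (z - y)\<bar> \<le> M * k y"
      using mult_left_mono[OF assms(5)[of "z - y"], of "k y"] assms(2)[of y] by (simp add: abs_mult mult.commute)
  qed (use assms(1) conv_bound_integrable[OF assms(1,4,5)] in auto)
  then show ?thesis using assms by simp
qed

lemma integral_product:
  fixes f :: "'a::euclidean_space \<Rightarrow> real" and g :: "real \<Rightarrow> real"
  assumes f: "integrable lborel f" and g: "integrable lborel g"
  shows "integrable lborel (\<lambda>z. f (fst z) * g (snd z))"
    and "(\<integral>z. f (fst z) * g (snd z) \<partial>lborel) = (\<integral>x. f x \<partial>lborel) * (\<integral>t. g t \<partial>lborel)"
proof -
  have [measurable]: "f \<in> borel_measurable borel" "g \<in> borel_measurable borel" using f g by auto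
  have *: "integrable (lborel \<Otimes>\<^sub>M lborel) (\<lambda>z. f (fst z) * g (snd z))"
    by (rule lborel_pair.Fubini_integrable) (use f g in \<open>auto simp: abs_mult\<close>)
  then show "integrable lborel (\<lambda>z. f (fst z) * g (snd z))" by (simp add: lborel_prod)
  show "(\<integral>z. f (fst z) * g (snd z) \<partial>lborel) = (\<integral>x. f x \<partial>lborel) * (\<integral>t. g t \<partial>lborel)"
    using lborel_pair.integral_fst'[OF *] by (simp add: lborel_prod)
qed

definition kprod :: "('a::euclidean_space \<Rightarrow> real) \<Rightarrow> (real \<Rightarrow> real) \<Rightarrow> 'a \<times> real \<Rightarrow> real" where
  "kprod \<rho> \<theta> z = \<rho> (fst z) * \<theta> (snd z)"

definition density_fn :: "('b::euclidean_space \<Rightarrow> real) \<Rightarrow> bool" where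
  "density_fn k \<longleftrightarrow> integrable lborel k \<and> (\<forall>y. k y \<ge> 0) \<and> (\<integral>y. k y \<partial>lborel) = 1"

lemma kprod_density: "density_fn \<rho> \<Longrightarrow> density_fn \<theta> \<Longrightarrow> density_fn (kprod \<rho> \<theta>)"
  using integral_product[of \<rho> \<theta>] by (simp add: density_fn_def kprod_def[abs_def])

definition concentrated :: "real \<Rightarrow> real \<Rightarrow> ('a::euclidean_space \<Rightarrow> real) \<Rightarrow> (real \<Rightarrow> real) \<Rightarrow> bool" where
  "concentrated r e \<rho> \<theta> \<longleftrightarrow> density_fn \<rho> \<and> density_fn \<theta> \<and> (\<forall>y. norm y > r \<longrightarrow> \<rho> y = 0)
     \<and> (\<forall>s\<le>0. \<theta> s = 0) \<and> (\<integral>s. \<theta> s * indicator {r<..} s \<partial>lborel) \<le> e"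

lemma conv_approx:
  fixes F :: "'a::euclidean_space \<times> real \<Rightarrow> real"
  assumes k: "concentrated r e' \<rho> \<theta>"
    and F [measurable]: "F \<in> borel_measurable borel" and M: "\<And>y. \<bar>F y\<bar> \<le> M"
    and close: "\<And>z'. norm (fst z - fst z') \<le> r \<Longrightarrow> snd z' \<le> snd z \<Longrightarrow> snd z - snd z' \<le> r \<Longrightarrow> \<bar>F z' - F z\<bar> \<le> e"
    and "e \<ge> 0"
  shows "\<bar>conv (kprod \<rho> \<theta>) F z - F z\<bar> \<le> e + 2 * M * e'"
proof -
  note k' = k[unfolded concentrated_def density_fn_def]
  have M0: "M \<ge> 0" using M[of undefined] by linarith
  have D: "density_fn (kprod \<rho> \<theta>)" using kprod_density k by (auto simp: concentrated_def)
  then have D1: "integrable lborel (kprod \<rho> \<theta>)" "\<And>y. kprod \<rho> \<theta> y \<ge> 0" "(\<integral>y. kprod \<rho> \<theta> y \<partial>lborel) = 1"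
    by (auto simp: density_fn_def)
  have [measurable]: "kprod \<rho> \<theta> \<in> borel_measurable borel" using D1(1) by auto
  have it: "integrable lborel (\<lambda>s. \<theta> s * indicator {r<..} s)"
    using k' by (intro integrable_real_mult_indicator) auto
  have tail: "integrable lborel (\<lambda>y. \<rho> (fst y) * (\<theta> (snd y) * indicator {r<..} (snd y)))"
    "(\<integral>y. \<rho> (fst y) * (\<theta> (snd y) * indicator {r<..} (snd y)) \<partial>lborel) \<le> e'"
    using integral_product[of \<rho>, OF _ it] k' by auto
  have i1: "integrable lborel (\<lambda>y. kprod \<rho> \<theta> y * F (z - y))"
    by (rule conv_bound_integrable[OF D1(1) F M])
  have "conv (kprod \<rho> \<theta>) F z - F z = (\<integral>y. kprod \<rho> \<theta> y * F (z - y) \<partial>lborel) - (\<integral>y. kprod \<rho> \<theta> y * F z \<partial>lborel)"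
    using D1(3) by (simp add: conv_commute)
  also have "\<dots> = (\<integral>y. kprod \<rho> \<theta> y * F (z - y) - kprod \<rho> \<theta> y * F z \<partial>lborel)"
    using i1 D1(1) by simp
  finally have "\<bar>conv (kprod \<rho> \<theta>) F z - F z\<bar> = \<bar>\<integral>y. kprod \<rho> \<theta> y * F (z - y) - kprod \<rho> \<theta> y * F z \<partial>lborel\<bar>" by simp
  also have "\<dots> \<le> (\<integral>y. e * kprod \<rho> \<theta> y + 2 * M * (\<rho> (fst y) * (\<theta> (snd y) * indicator {r<..} (snd y))) \<partial>lborel)"
  proof (rule integral_abs_bound_integral)
    fix y :: "'a \<times> real"
    have eq: "kprod \<rho> \<theta> y * F (z - y) - kprod \<rho> \<theta> y * F z = kprod \<rho> \<theta> y * (F (z - y) - F z)" by (simp add: algebra_simps)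
    have 2: "\<bar>F (z - y) - F z\<bar> \<le> 2 * M" using M[of "z - y"] M[of z] by linarith
    consider "norm (fst y) > r \<or> snd y \<le> 0" | "norm (fst y) \<le> r" "snd y > 0" "snd y \<le> r" | "snd y > r" by linarith
    then show "\<bar>kprod \<rho> \<theta> y * F (z - y) - kprod \<rho> \<theta> y * F z\<bar>
      \<le> e * kprod \<rho> \<theta> y + 2 * M * (\<rho> (fst y) * (\<theta> (snd y) * indicator {r<..} (snd y)))"
    proof cases
      case 1
      then have "kprod \<rho> \<theta> y = 0" using k' by (auto simp: kprod_def)
      then show ?thesis using k' M0 by simp
    next
      case 2
      have "\<bar>F (z - y) - F z\<bar> \<le> e" by (rule close) (use 2 in auto)
      then have "kprod \<rho> \<theta> y * \<bar>F (z - y) - F z\<bar> \<le> kprod \<rho> \<theta> y * e" using D1(2) by (intro mult_left_mono)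
      then show ?thesis unfolding eq using D1(2)[of y] 2 by (simp add: abs_mult mult.commute)
    next
      case 3
      have "kprod \<rho> \<theta> y * \<bar>F (z - y) - F z\<bar> \<le> kprod \<rho> \<theta> y * (2 * M)" using D1(2) 2 by (intro mult_left_mono)
      moreover have "e * kprod \<rho> \<theta> y \<ge> 0" using D1(2) assms(5) by simp
      moreover have "\<rho> (fst y) * (\<theta> (snd y) * indicator {r<..} (snd y)) = kprod \<rho> \<theta> y" using 3 by (simp add: kprod_def)
      ultimately show ?thesis unfolding eq using D1(2)[of y] by (simp add: abs_mult mult_ac)
    qed
  qed (use i1 D1 tail in auto)
  also have "\<dots> = e + 2 * M * (\<integral>y. \<rho> (fst y) * (\<theta> (snd y) * indicator {r<..} (snd y)) \<partial>lborel)"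
    using D1 tail(1) by simp
  also have "\<dots> \<le> e + 2 * M * e'" using tail(2) M0 by (intro add_left_mono mult_left_mono) auto
  finally show ?thesis .
qed

lemma integrable_approx_bounded_continuous:
  fixes f :: "'b::euclidean_space \<Rightarrow> real"
  assumes "integrable lborel f" "e > 0"
  shows "\<exists>F M. continuous_on UNIV F \<and> (\<forall>z. \<bar>F z\<bar> \<le> M) \<and> integrable lborel F \<and> (\<integral>z. \<bar>f z - F z\<bar> \<partial>lborel) < e"
  using assms
proof (induction f arbitrary: e rule: integrable_induct)
  case (base A c)
  define e' where "e' = e / (2 * (1 + \<bar>c\<bar>))"
  have e': "e' > 0" using base by (simp add: e'_def)
  have A: "A \<in> sets lebesgue" using base by auto
  obtain U where U: "open U" "A \<subseteq> U" "U - A \<in> lmeasurable" "emeasure lebesgue (U - A) < ennreal e'"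
    using sets_lebesgue_outer_open[OF A e'] by metis
  obtain C where C: "closed C" "C \<subseteq> A" "A - C \<in> lmeasurable" "emeasure lebesgue (A - C) < ennreal e'"
    using sets_lebesgue_inner_closed[OF A e'] by metis
  have [measurable]: "A \<in> sets borel" "U \<in> sets borel" "C \<in> sets borel" using base U C by auto
  have fU: "emeasure lborel (U - A) < ennreal e'" "emeasure lborel (A - C) < ennreal e'" using U C by auto
  have CU: "closed (- U)" "C \<inter> (- U) = {}" "(1::real) \<noteq> 0" using U C by auto
  obtain G :: "'b \<Rightarrow> real" where G: "continuous_on UNIV G" "\<And>x. G x \<in> closed_segment 1 0"
    "\<And>x. G x = 1 \<longleftrightarrow> x \<in> C" "\<And>x. G x = 0 \<longleftrightarrow> x \<in> -U"
    using Urysohn_strong[OF C(1) CU] by metis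
  have G01: "0 \<le> G x" "G x \<le> 1" for x using G(2)[of x] by (auto simp: closed_segment_eq_real_ivl)
  have [measurable]: "G \<in> borel_measurable borel" by (rule borel_measurable_continuous_onI[OF G(1)])
  have iA: "integrable lborel (indicator A :: 'b \<Rightarrow> real)" using base by (intro integrable_real_indicator) auto
  have iUA: "integrable lborel (indicator (U - A) :: 'b \<Rightarrow> real)" "integrable lborel (indicator (A - C) :: 'b \<Rightarrow> real)"
    using fU by (auto intro!: integrable_real_indicator intro: less_trans)
  have d: "\<bar>indicator A x - G x\<bar> \<le> indicator (U - A) x + indicator (A - C) x" for x
    using G01[of x] G(3)[of x] G(4)[of x] U(2) C(2) by (auto simp: indicator_def)
  have iG: "integrable lborel G"
  proof (rule Bochner_Integration.integrable_bound[of lborel "\<lambda>x. indicator A x + indicator (U - A) x :: real"])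
    show "AE x in lborel. norm (G x) \<le> norm (indicator A x + indicator (U - A) x :: real)"
    proof (rule AE_I2)
      fix x
      show "norm (G x) \<le> norm (indicator A x + indicator (U - A) x :: real)"
        using G01[of x] G(4)[of x] U(2) by (cases "x \<in> U") (auto simp: indicator_def)
    qed
  qed (use iA iUA in auto)
  have "(\<integral>z. \<bar>indicator A z - G z\<bar> \<partial>lborel) \<le> (\<integral>z. indicator (U - A) z + indicator (A - C) z \<partial>lborel)"
    by (rule integral_mono) (use iA iG iUA d in auto)
  also have "\<dots> = measure lborel (U - A) + measure lborel (A - C)"
    using iUA by simp
  also have "\<dots> < 2 * e'"
  proof -
    have "measure lborel S < e'" if "emeasure lborel S < ennreal e'" for S :: "'b set"
    proof -
      have "emeasure lborel S \<noteq> top" using that by auto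
      then have "ennreal (measure lborel S) < ennreal e'" using that emeasure_eq_ennreal_measure[of lborel S] by simp
      then show ?thesis by (simp add: ennreal_less_iff)
    qed
    from this[OF fU(1)] this[OF fU(2)] show ?thesis by simp
  qed
  finally have lt: "(\<integral>z. \<bar>indicator A z - G z\<bar> \<partial>lborel) < 2 * e'" .
  have "(\<integral>z. \<bar>indicator A z *\<^sub>R c - c * G z\<bar> \<partial>lborel) = (\<integral>z. \<bar>c\<bar> * \<bar>indicator A z - G z\<bar> \<partial>lborel)"
    by (intro Bochner_Integration.integral_cong refl) (simp add: abs_mult[symmetric] algebra_simps)
  also have "\<dots> = \<bar>c\<bar> * (\<integral>z. \<bar>indicator A z - G z\<bar> \<partial>lborel)" by simp
  also have "\<dots> \<le> \<bar>c\<bar> * (2 * e')" using lt by (intro mult_left_mono) auto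
  also have "\<dots> < e" using base(3) by (simp add: e'_def field_simps)
  finally have "(\<integral>z. \<bar>indicator A z *\<^sub>R c - c * G z\<bar> \<partial>lborel) < e" .
  moreover have "continuous_on UNIV (\<lambda>z. c * G z)" using G by (intro continuous_intros)
  moreover have "\<bar>c * G z\<bar> \<le> \<bar>c\<bar>" for z using G01[of z] by (simp add: abs_mult mult_left_le)
  ultimately show ?case using iG by (intro exI[of _ "\<lambda>z. c * G z"] exI[of _ "\<bar>c\<bar>"]) auto
next
  case (add f g)
  obtain F M where F: "continuous_on UNIV F" "\<forall>z. \<bar>F z\<bar> \<le> M" "integrable lborel F" "(\<integral>z. \<bar>f z - F z\<bar> \<partial>lborel) < e/2"
    using add(3)[of "e/2"] add(5) by auto
  obtain G N where G: "continuous_on UNIV G" "\<forall>z. \<bar>G z\<bar> \<le> N" "integrable lborel G" "(\<integral>z. \<bar>g z - G z\<bar> \<partial>lborel) < e/2"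
    using add(4)[of "e/2"] add(5) by auto
  have "(\<integral>z. \<bar>(f z + g z) - (F z + G z)\<bar> \<partial>lborel) \<le> (\<integral>z. \<bar>f z - F z\<bar> + \<bar>g z - G z\<bar> \<partial>lborel)"
    by (rule integral_mono) (use add F G in auto)
  also have "\<dots> = (\<integral>z. \<bar>f z - F z\<bar> \<partial>lborel) + (\<integral>z. \<bar>g z - G z\<bar> \<partial>lborel)"
    by (rule Bochner_Integration.integral_add) (use add F G in auto)
  finally have "(\<integral>z. \<bar>(f z + g z) - (F z + G z)\<bar> \<partial>lborel) < e" using F G by linarith
  moreover have "\<bar>F z + G z\<bar> \<le> M + N" for z using F(2) G(2) abs_triangle_ineq[of "F z" "G z"] by (meson add_mono order_trans)
  ultimately show ?case using F G
    by (intro exI[of _ "\<lambda>z. F z + G z"] exI[of _ "M + N"]) (auto intro: continuous_on_add)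
next
  case (lim f s)
  have "(\<lambda>i. \<integral>z. \<bar>f z - s i z\<bar> \<partial>lborel) \<longlonglongrightarrow> (\<integral>z. 0 \<partial>(lborel :: 'b measure))"
  proof (rule integral_dominated_convergence[where w="\<lambda>z. 3 * \<bar>f z\<bar>"])
    show "AE z in lborel. (\<lambda>i. \<bar>f z - s i z\<bar>) \<longlonglongrightarrow> 0"
    proof (rule AE_I2)
      fix z
      have "(\<lambda>i. \<bar>f z - s i z\<bar>) \<longlonglongrightarrow> \<bar>f z - f z\<bar>"
        using lim(2)[of z] by (intro tendsto_intros) auto
      then show "(\<lambda>i. \<bar>f z - s i z\<bar>) \<longlonglongrightarrow> 0" by simp
    qed
    show "AE z in lborel. norm \<bar>f z - s i z\<bar> \<le> 3 * \<bar>f z\<bar>" for i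
    proof (rule AE_I2)
      fix z
      show "norm \<bar>f z - s i z\<bar> \<le> 3 * \<bar>f z\<bar>" using lim(3)[of z i] by (simp add: abs_le_iff) linarith
    qed
  qed (use lim in auto)
  then have "(\<lambda>i. \<integral>z. \<bar>f z - s i z\<bar> \<partial>lborel) \<longlonglongrightarrow> 0" by simp
  then have "\<forall>\<^sub>F i in sequentially. (\<integral>z. \<bar>f z - s i z\<bar> \<partial>lborel) < e/2"
    using lim(6) by (intro order_tendstoD(2)[where y=0]) auto
  then obtain i where i: "(\<integral>z. \<bar>f z - s i z\<bar> \<partial>lborel) < e/2" by (meson eventually_happens trivial_limit_sequentially)
  obtain F M where F: "continuous_on UNIV F" "\<forall>z. \<bar>F z\<bar> \<le> M" "integrable lborel F" "(\<integral>z. \<bar>s i z - F z\<bar> \<partial>lborel) < e/2"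
    using lim(5)[of "e/2" i] lim(6) by auto
  have "(\<integral>z. \<bar>f z - F z\<bar> \<partial>lborel) \<le> (\<integral>z. \<bar>f z - s i z\<bar> + \<bar>s i z - F z\<bar> \<partial>lborel)"
    by (rule integral_mono) (use lim F in auto)
  also have "\<dots> = (\<integral>z. \<bar>f z - s i z\<bar> \<partial>lborel) + (\<integral>z. \<bar>s i z - F z\<bar> \<partial>lborel)"
    by (rule Bochner_Integration.integral_add) (use lim F in auto)
  finally show ?case using F i by fastforce
qed

lemma conv_measurable:
  fixes k f :: "'b::euclidean_space \<Rightarrow> real"
  assumes [measurable]: "k \<in> borel_measurable borel" "f \<in> borel_measurable borel"
  shows "conv k f \<in> borel_measurable borel"
proof -
  have "(\<lambda>z. \<integral>y. (\<lambda>(z, y). k (z - y) * f y) (z, y) \<partial>lborel) \<in> borel_measurable borel"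
    by (rule lborel.borel_measurable_lebesgue_integral) measurable
  then show ?thesis by (simp add: conv_def[abs_def])
qed

lemma conv_L1_contraction:
  fixes k f :: "'b::euclidean_space \<Rightarrow> real"
  assumes k: "density_fn k" and f: "integrable lborel f"
  shows "integrable lborel (conv k f)" "(\<integral>z. \<bar>conv k f z\<bar> \<partial>lborel) \<le> (\<integral>z. \<bar>f z\<bar> \<partial>lborel)"
proof -
  have ki: "integrable lborel k" "\<And>y. k y \<ge> 0" "(\<integral>y. k y \<partial>lborel) = 1" using k by (auto simp: density_fn_def)
  have [measurable]: "k \<in> borel_measurable borel" "f \<in> borel_measurable borel" using ki f by auto
  have [measurable]: "conv k f \<in> borel_measurable borel" by (rule conv_measurable) auto
  have k1: "(\<integral>\<^sup>+y. ennreal (k y) \<partial>lborel) = 1" using nn_integral_eq_integral[OF ki(1)] ki by simp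
  have "(\<integral>\<^sup>+z. ennreal (norm (conv k f z)) \<partial>lborel) \<le> (\<integral>\<^sup>+z. \<integral>\<^sup>+y. ennreal (k (z - y)) * ennreal \<bar>f y\<bar> \<partial>lborel \<partial>lborel)"
  proof (rule nn_integral_mono)
    fix z
    have "ennreal (norm (conv k f z)) \<le> (\<integral>\<^sup>+y. ennreal (norm (k (z - y) * f y)) \<partial>lborel)"
      unfolding conv_def by (cases "integrable lborel (\<lambda>y. k (z - y) * f y)")
        (rule integral_norm_bound_ennreal, auto simp: not_integrable_integral_eq)
    also have "\<dots> = (\<integral>\<^sup>+y. ennreal (k (z - y)) * ennreal \<bar>f y\<bar> \<partial>lborel)"
      by (intro nn_integral_cong) (simp add: abs_mult ki(2) ennreal_mult)
    finally show "ennreal (norm (conv k f z)) \<le> (\<integral>\<^sup>+y. ennreal (k (z - y)) * ennreal \<bar>f y\<bar> \<partial>lborel)" .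
  qed
  also have "\<dots> = (\<integral>\<^sup>+y. \<integral>\<^sup>+z. ennreal (k (z - y)) * ennreal \<bar>f y\<bar> \<partial>lborel \<partial>lborel)"
    by (rule lborel_pair.Fubini') measurable
  also have "\<dots> = (\<integral>\<^sup>+y. ennreal \<bar>f y\<bar> \<partial>lborel)"
  proof (rule nn_integral_cong)
    fix y
    have "(\<integral>\<^sup>+z. ennreal (k (z - y)) * ennreal \<bar>f y\<bar> \<partial>lborel) = (\<integral>\<^sup>+z. ennreal (k (z - y)) \<partial>lborel) * ennreal \<bar>f y\<bar>"
      by (rule nn_integral_multc) measurable
    also have "(\<integral>\<^sup>+z. ennreal (k (z - y)) \<partial>lborel) = (\<integral>\<^sup>+z. ennreal (k z) \<partial>distr lborel borel (\<lambda>x. x + (- y)))"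
      by (subst nn_integral_distr) auto
    also have "\<dots> = 1" by (simp only: lborel_distr_translate k1)
    finally show "(\<integral>\<^sup>+z. ennreal (k (z - y)) * ennreal \<bar>f y\<bar> \<partial>lborel) = ennreal \<bar>f y\<bar>" by simp
  qed
  finally have le: "(\<integral>\<^sup>+z. ennreal (norm (conv k f z)) \<partial>lborel) \<le> (\<integral>\<^sup>+y. ennreal \<bar>f y\<bar> \<partial>lborel)" .
  have fin: "(\<integral>\<^sup>+y. ennreal \<bar>f y\<bar> \<partial>lborel) = ennreal (\<integral>z. \<bar>f z\<bar> \<partial>lborel)"
    using f by (intro nn_integral_eq_integral) auto
  show i: "integrable lborel (conv k f)"
    unfolding integrable_iff_bounded using le fin by (auto intro: le_less_trans)
  have "ennreal (\<integral>z. \<bar>conv k f z\<bar> \<partial>lborel) = (\<integral>\<^sup>+z. ennreal \<bar>conv k f z\<bar> \<partial>lborel)"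
    using i by (intro nn_integral_eq_integral[symmetric]) auto
  then have "ennreal (\<integral>z. \<bar>conv k f z\<bar> \<partial>lborel) \<le> ennreal (\<integral>z. \<bar>f z\<bar> \<partial>lborel)" using le fin by simp
  then show "(\<integral>z. \<bar>conv k f z\<bar> \<partial>lborel) \<le> (\<integral>z. \<bar>f z\<bar> \<partial>lborel)" by (simp add: ennreal_le_iff)
qed

lemma bounded_integrand_conv:
  fixes k f :: "'b::euclidean_space \<Rightarrow> real"
  assumes "\<And>y. \<bar>k y\<bar> \<le> B" and [measurable]: "k \<in> borel_measurable borel" and "integrable lborel f"
  shows "integrable lborel (\<lambda>y. k (z - y) * f y)"
proof (rule Bochner_Integration.integrable_bound[of lborel "\<lambda>y. B * f y"])
  have [measurable]: "f \<in> borel_measurable borel" using assms(3) by auto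
  show "(\<lambda>y. k (z - y) * f y) \<in> borel_measurable lborel" by simp
  show "AE y in lborel. norm (k (z - y) * f y) \<le> norm (B * f y)"
  proof (rule AE_I2)
    fix y
    have "\<bar>k (z - y)\<bar> \<le> \<bar>B\<bar>" using assms(1)[of "z - y"] by linarith
    then show "norm (k (z - y) * f y) \<le> norm (B * f y)" by (simp add: abs_mult mult_right_mono)
  qed
qed (use assms in auto)

lemma conv_pointwise_tendsto:
  fixes F :: "'a::euclidean_space \<times> real \<Rightarrow> real"
  assumes k: "\<And>n. concentrated (r n) (r n) (\<rho> n) (\<theta> n)" and r: "r \<longlonglongrightarrow> 0"
    and F: "continuous_on UNIV F" and M: "\<And>y. \<bar>F y\<bar> \<le> M"
  shows "(\<lambda>n. conv (kprod (\<rho> n) (\<theta> n)) F z) \<longlonglongrightarrow> F z"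
proof (rule LIMSEQ_I)
  fix e :: real assume e: "e > 0"
  have M0: "M \<ge> 0" using M[of undefined] by linarith
  have mF: "F \<in> borel_measurable borel" by (rule borel_measurable_continuous_onI[OF F])
  have "isCont F z" using F by (simp add: continuous_on_eq_continuous_at del: split_paired_All)
  then obtain d where d: "d > 0" "\<And>z'. dist z' z < d \<Longrightarrow> dist (F z') (F z) < e/2"
    unfolding continuous_at_eps_delta using e by (metis half_gt_zero)
  have "\<forall>\<^sub>F n in sequentially. r n < d/2 \<and> 2 * M * r n < e/2"
  proof (rule eventually_conj)
    show "\<forall>\<^sub>F n in sequentially. r n < d/2" using order_tendstoD(2)[OF r, of "d/2"] d by simp
    have "(\<lambda>n. 2 * M * r n) \<longlonglongrightarrow> 2 * M * 0" by (intro tendsto_intros r)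
    then show "\<forall>\<^sub>F n in sequentially. 2 * M * r n < e/2" using e by (intro order_tendstoD(2)[of _ "2 * M * 0"]) auto
  qed
  then obtain N where N: "\<And>n. n \<ge> N \<Longrightarrow> r n < d/2 \<and> 2 * M * r n < e/2" unfolding eventually_sequentially by blast
  show "\<exists>N. \<forall>n\<ge>N. norm (conv (kprod (\<rho> n) (\<theta> n)) F z - F z) < e"
  proof (intro exI[of _ N] allI impI)
    fix n assume n: "n \<ge> N"
    have "\<bar>conv (kprod (\<rho> n) (\<theta> n)) F z - F z\<bar> \<le> e/2 + 2 * M * r n"
    proof (rule conv_approx[OF k mF M])
      fix z' assume z': "norm (fst z - fst z') \<le> r n" "snd z' \<le> snd z" "snd z - snd z' \<le> r n"
      have "dist z' z \<le> norm (fst z - fst z') + norm (snd z - snd z')"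
        unfolding dist_norm by (metis fst_diff snd_diff norm_minus_commute norm_Pair_le prod.collapse)
      then have "dist z' z < d" using z' N[OF n] by auto
      then show "\<bar>F z' - F z\<bar> \<le> e/2" using d(2)[of z'] by (simp add: dist_real_def)
    qed (use e in auto)
    then show "norm (conv (kprod (\<rho> n) (\<theta> n)) F z - F z) < e" using N[OF n] by auto
  qed
qed

lemma conv_L1_tendsto:
  fixes f :: "'a::euclidean_space \<times> real \<Rightarrow> real"
  assumes k: "\<And>n. concentrated (r n) (r n) (\<rho> n) (\<theta> n)" and r: "r \<longlonglongrightarrow> 0"
    and b: "\<And>n. \<exists>B. \<forall>y. kprod (\<rho> n) (\<theta> n) y \<le> B"
    and f: "integrable lborel f" and S: "bounded S" "S \<in> sets borel"
  shows "(\<lambda>n. \<integral>z. indicator S z * \<bar>conv (kprod (\<rho> n) (\<theta> n)) f z - f z\<bar> \<partial>lborel) \<longlonglongrightarrow> 0"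
proof (rule LIMSEQ_I)
  fix e :: real assume e: "e > 0"
  let ?k = "\<lambda>n. kprod (\<rho> n) (\<theta> n)"
  have D: "density_fn (?k n)" for n using k[of n] kprod_density by (auto simp: concentrated_def)
  have [measurable]: "?k n \<in> borel_measurable borel" for n using D[of n] by (auto simp: density_fn_def)
  have k0: "?k n y \<ge> 0" for n y using D[of n] unfolding density_fn_def by blast
  obtain F M where F: "continuous_on UNIV F" "\<forall>z. \<bar>F z\<bar> \<le> M" "integrable lborel F" "(\<integral>z. \<bar>f z - F z\<bar> \<partial>lborel) < e/3"
    using integrable_approx_bounded_continuous[OF f, of "e/3"] e by auto
  have [measurable]: "F \<in> borel_measurable borel" "f \<in> borel_measurable borel" "S \<in> sets borel" using F f S by auto
  have mc [measurable]: "conv (?k n) g \<in> borel_measurable borel" if "g \<in> borel_measurable borel" for n g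
    by (rule conv_measurable) (use that in auto)
  have iS: "integrable lborel (indicator S :: _ \<Rightarrow> real)"
    using S emeasure_bounded_finite[OF S(1)] by (intro integrable_real_indicator) auto
  have "(\<lambda>n. \<integral>z. indicator S z * \<bar>conv (?k n) F z - F z\<bar> \<partial>lborel) \<longlonglongrightarrow> (\<integral>z. 0 \<partial>(lborel :: ('a \<times> real) measure))"
  proof (rule integral_dominated_convergence[where w="\<lambda>z. indicator S z * (2 * M)"])
    show "integrable lborel (\<lambda>z. indicator S z * (2 * M) :: real)" using iS by simp
    show "AE z in lborel. (\<lambda>n. indicator S z * \<bar>conv (?k n) F z - F z\<bar>) \<longlonglongrightarrow> 0"
    proof (rule AE_I2)
      fix z
      have "(\<lambda>n. indicator S z * \<bar>conv (?k n) F z - F z\<bar>) \<longlonglongrightarrow> indicator S z * \<bar>F z - F z\<bar>"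
        by (intro tendsto_intros conv_pointwise_tendsto[OF k r F(1), of M]) (use F in auto)
      then show "(\<lambda>n. indicator S z * \<bar>conv (?k n) F z - F z\<bar>) \<longlonglongrightarrow> 0" by simp
    qed
    show "AE z in lborel. norm (indicator S z * \<bar>conv (?k n) F z - F z\<bar>) \<le> indicator S z * (2 * M)" for n
    proof (rule AE_I2)
      fix z
      have "\<bar>conv (?k n) F z\<bar> \<le> M"
        by (rule conv_abs_le) (use D[of n] F in \<open>auto simp: density_fn_def\<close>)
      moreover have "\<bar>F z\<bar> \<le> M" using F(2) by blast
      ultimately have "\<bar>conv (?k n) F z - F z\<bar> \<le> 2 * M" by linarith
      then show "norm (indicator S z * \<bar>conv (?k n) F z - F z\<bar>) \<le> indicator S z * (2 * M)"
        by (simp add: indicator_def)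
    qed
  qed auto
  then have "(\<lambda>n. \<integral>z. indicator S z * \<bar>conv (?k n) F z - F z\<bar> \<partial>lborel) \<longlonglongrightarrow> 0" by simp
  then obtain N where N: "\<And>n. n \<ge> N \<Longrightarrow> \<bar>\<integral>z. indicator S z * \<bar>conv (?k n) F z - F z\<bar> \<partial>lborel\<bar> < e/3"
    using LIMSEQ_D[of _ 0 "e/3"] e by force
  show "\<exists>N. \<forall>n\<ge>N. norm ((\<integral>z. indicator S z * \<bar>conv (?k n) f z - f z\<bar> \<partial>lborel) - 0) < e"
  proof (intro exI[of _ N] allI impI)
    fix n assume n: "n \<ge> N"
    obtain B where B: "\<And>y. \<bar>?k n y\<bar> \<le> B" using b[of n] k0[of n] by auto
    have i: "integrable lborel (conv (?k n) f)" "integrable lborel (conv (?k n) F)"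
      "integrable lborel (conv (?k n) (\<lambda>z. f z - F z))"
      by (rule conv_L1_contraction(1)[OF D]; use f F in simp)+
    have lin: "conv (?k n) f z - conv (?k n) F z = conv (?k n) (\<lambda>z. f z - F z) z" for z
    proof -
      have "integrable lborel (\<lambda>y. ?k n (z - y) * g y)" if "integrable lborel g" for g
        by (rule bounded_integrand_conv[OF B]) (use that in auto)
      from Bochner_Integration.integral_diff[OF this[OF f] this[OF F(3)]] show ?thesis
        by (simp add: conv_def right_diff_distrib)
    qed
    have ii: "integrable lborel (\<lambda>z. indicator S z * \<bar>conv (?k n) F z - F z\<bar>)"
      using integrable_mult_indicator[of S lborel "\<lambda>z. \<bar>conv (?k n) F z - F z\<bar>"] i F by simp
    have "(\<integral>z. indicator S z * \<bar>conv (?k n) f z - f z\<bar> \<partial>lborel)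
      \<le> (\<integral>z. \<bar>conv (?k n) (\<lambda>z. f z - F z) z\<bar> + (indicator S z * \<bar>conv (?k n) F z - F z\<bar> + \<bar>f z - F z\<bar>) \<partial>lborel)"
    proof (rule integral_mono)
      show "integrable lborel (\<lambda>z. indicator S z * \<bar>conv (?k n) f z - f z\<bar>)"
        using integrable_mult_indicator[of S lborel "\<lambda>z. \<bar>conv (?k n) f z - f z\<bar>"] i f by simp
      show "integrable lborel (\<lambda>z. \<bar>conv (?k n) (\<lambda>z. f z - F z) z\<bar> + (indicator S z * \<bar>conv (?k n) F z - F z\<bar> + \<bar>f z - F z\<bar>))"
        using i ii f F by simp
      fix z
      show "indicator S z * \<bar>conv (?k n) f z - f z\<bar> \<le> \<bar>conv (?k n) (\<lambda>z. f z - F z) z\<bar> + (indicator S z * \<bar>conv (?k n) F z - F z\<bar> + \<bar>f z - F z\<bar>)"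
        unfolding lin[symmetric] by (auto simp: indicator_def)
    qed
    also have "\<dots> = (\<integral>z. \<bar>conv (?k n) (\<lambda>z. f z - F z) z\<bar> \<partial>lborel) + ((\<integral>z. indicator S z * \<bar>conv (?k n) F z - F z\<bar> \<partial>lborel) + (\<integral>z. \<bar>f z - F z\<bar> \<partial>lborel))"
      using i ii f F by (simp add: Bochner_Integration.integral_add)
    also have "\<dots> < e"
      using conv_L1_contraction(2)[OF D[of n], of "\<lambda>z. f z - F z"] f F N[OF n] by auto
    finally have "(\<integral>z. indicator S z * \<bar>conv (?k n) f z - f z\<bar> \<partial>lborel) < e" .
    moreover have "(\<integral>z. indicator S z * \<bar>conv (?k n) f z - f z\<bar> \<partial>lborel) \<ge> 0" by (rule Bochner_Integration.integral_nonneg) auto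
    ultimately show "norm ((\<integral>z. indicator S z * \<bar>conv (?k n) f z - f z\<bar> \<partial>lborel) - 0) < e" by simp
  qed
qed

text \<open>A weak form of Jensen's inequality: where \<open>f\<close> exceeds half of its average \<open>a\<close> one has
  \<open>f \<le> f\<^sup>p / (a / 2)\<^sup>p\<^sup>-\<^sup>1\<close>.\<close>

lemma conv_powr_le:
  fixes k f :: "'b::euclidean_space \<Rightarrow> real"
  assumes k: "density_fn k" and b: "\<And>y. k y \<le> B" and p: "p > 1"
    and f: "integrable lborel f" "\<And>y. f y \<ge> 0" "integrable lborel (\<lambda>y. f y powr p)"
  shows "(conv k f z) powr p \<le> 2 powr p * conv k (\<lambda>y. f y powr p) z"
proof -
  have ki: "integrable lborel k" "\<And>y. k y \<ge> 0" "(\<integral>y. k y \<partial>lborel) = 1" using k by (auto simp: density_fn_def)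
  have [measurable]: "k \<in> borel_measurable borel" "f \<in> borel_measurable borel" using ki f by auto
  have kB: "\<And>y. \<bar>k y\<bar> \<le> B" using b ki by auto
  define a where "a = conv k f z"
  have c0: "conv k (\<lambda>y. f y powr p) z \<ge> 0" unfolding conv_def by (rule Bochner_Integration.integral_nonneg) (use ki in auto)
  have a0: "a \<ge> 0" unfolding a_def conv_def by (rule Bochner_Integration.integral_nonneg) (use ki f in auto)
  show ?thesis
  proof (cases "a = 0")
    case True
    then show ?thesis using c0 p by (simp add: a_def[symmetric])
  next
    case False
    then have a: "a > 0" using a0 by simp
    have i1: "integrable lborel (\<lambda>y. k (z - y) * f y)" "integrable lborel (\<lambda>y. k (z - y) * f y powr p)"
      by (rule bounded_integrand_conv[OF kB]; use f in simp)+
    have i2: "integrable lborel (\<lambda>y. k (z - y))" using lborel_integrable_reflect[of k z] ki by simp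
    have "a \<le> (\<integral>y. (a/2) * k (z - y) + (a/2) powr (1 - p) * (k (z - y) * f y powr p) \<partial>lborel)"
      unfolding a_def conv_def
    proof (rule integral_mono, goal_cases)
      case (3 y)
      have "f y \<le> a/2 + (a/2) powr (1 - p) * f y powr p"
      proof (cases "f y \<le> a/2")
        case True
        moreover have "(a/2) powr (1 - p) * f y powr p \<ge> 0" by simp
        ultimately show ?thesis by linarith
      next
        case False
        then have "f y = f y powr (1 - p) * f y powr p" using a by (simp add: powr_add[symmetric])
        also have "\<dots> \<le> (a/2) powr (1 - p) * f y powr p"
          using False a p by (intro mult_right_mono powr_mono2') auto
        finally show ?thesis using a by linarith
      qed
      then have "k (z - y) * f y \<le> k (z - y) * (a/2 + (a/2) powr (1 - p) * f y powr p)"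
        by (intro mult_left_mono ki)
      then show ?case by (simp add: a_def conv_def algebra_simps)
    qed (use i1 i2 in auto)
    also have "\<dots> = a/2 + (a/2) powr (1 - p) * conv k (\<lambda>y. f y powr p) z"
      using i1 i2 lborel_integral_reflect[of k z] ki by (simp add: conv_def)
    finally have "a/2 \<le> (a/2) powr (1 - p) * conv k (\<lambda>y. f y powr p) z" by simp
    then have "(a/2) powr (p - 1) * (a/2) \<le> (a/2) powr (p - 1) * ((a/2) powr (1 - p) * conv k (\<lambda>y. f y powr p) z)"
      by (intro mult_left_mono) auto
    also have "\<dots> = conv k (\<lambda>y. f y powr p) z" using a by (simp add: mult.assoc[symmetric] powr_add[symmetric])
    also have "(a/2) powr (p - 1) * (a/2) = (a/2) powr p" using a by (simp add: powr_diff)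
    finally show ?thesis using a by (simp add: a_def[symmetric] powr_divide field_simps)
  qed
qed

section \<open>Kernels\<close>

lemma smooth_inner_self:
  assumes "bounded_linear (L :: 'b::euclidean_space \<Rightarrow> 'c::euclidean_space)"
  shows "smooth (\<lambda>z. (L z - c) \<bullet> (L z - c))"
proof -
  have "smooth (\<lambda>z. L z \<bullet> i)" for i
    by (rule smooth_linear) (intro bounded_linear_compose[OF bounded_linear_inner_left assms])
  then have "smooth (\<lambda>z. \<Sum>i\<in>Basis. (L z \<bullet> i - c \<bullet> i) * (L z \<bullet> i - c \<bullet> i))"
    by (intro smooth_sum smooth_mult smooth_diff smooth_const)
  then show ?thesis by (subst euclidean_inner) (simp add: inner_diff_left)
qed

lemma spatial_kernel:
  assumes r: "r > 0"
  obtains \<rho> :: "'a::euclidean_space \<Rightarrow> real" and B where "smooth \<rho>" "density_fn \<rho>"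
    "\<And>y. norm y > r \<Longrightarrow> \<rho> y = 0" "\<And>y. \<rho> y \<le> B"
proof -
  define f :: "'a \<Rightarrow> real" where "f y = bmp 0 (r\<^sup>2 - (y - 0) \<bullet> (y - 0))" for y
  have s: "smooth f" unfolding f_def[abs_def]
    by (intro smooth_compose[OF smooth_bmp] smooth_diff smooth_const smooth_inner_self bounded_linear_ident)
  have v: "f y = 0" if "norm y > r" for y
  proof -
    have "r\<^sup>2 \<le> (norm y)\<^sup>2" using that r by (intro power_mono) auto
    then show ?thesis by (simp add: f_def bmp_nonpos dot_square_norm)
  qed
  have i: "integrable lborel f"
    by (rule continuous_vanish_integrable[OF smooth_continuous[OF s], of r]) (use v in auto)
  have f0: "f y \<ge> 0" for y by (simp add: f_def bmp_nonneg)
  define m where "m = (\<integral>y. f y \<partial>lborel)"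
  have "m > 0"
  proof -
    define c where "c = exp (-1 / (r\<^sup>2 - (r/2)\<^sup>2))"
    have le: "c * indicator (ball 0 (r/2)) y \<le> f y" for y :: 'a
    proof (cases "y \<in> ball 0 (r/2)")
      case True
      then have y2: "(norm y)\<^sup>2 \<le> (r/2)\<^sup>2" by (intro power_mono) auto
      have p: "r\<^sup>2 - (r/2)\<^sup>2 > 0" using r by (simp add: power_divide)
      have "1 / (r\<^sup>2 - (norm y)\<^sup>2) \<le> 1 / (r\<^sup>2 - (r/2)\<^sup>2)" using y2 p by (intro divide_left_mono mult_pos_pos) auto
      then have "c \<le> exp (-1 / (r\<^sup>2 - (norm y)\<^sup>2))" by (simp add: c_def)
      then show ?thesis using True y2 p by (simp add: f_def bmp_def dot_square_norm)
    qed (simp add: f0)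
    have "(\<integral>y. c * indicator (ball 0 (r/2)) y \<partial>(lborel :: 'a measure)) \<le> m"
      unfolding m_def
      by (rule integral_mono) (use i le in \<open>auto intro!: integrable_mult_right integrable_real_indicator emeasure_lborel_ball_finite\<close>)
    moreover have "(\<integral>y. c * indicator (ball 0 (r/2)) y \<partial>(lborel :: 'a measure)) = c * measure lborel (ball 0 (r/2) :: 'a set)"
      by simp
    moreover have "c * measure lborel (ball 0 (r/2) :: 'a set) > 0"
      using content_ball_pos[of "r/2"] r by (simp add: c_def)
    ultimately show ?thesis by linarith
  qed
  show ?thesis
  proof (rule that[of "\<lambda>y. f y * (1/m)" "1/m"])
    show "smooth (\<lambda>y. f y * (1/m))" by (intro smooth_mult s smooth_const)
    show "density_fn (\<lambda>y. f y * (1/m))" using i f0 \<open>m > 0\<close> by (simp add: density_fn_def m_def)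
    show "f y * (1/m) \<le> 1/m" for y using bmp_0_le_1 \<open>m > 0\<close> by (simp add: f_def divide_right_mono)
  qed (use v in auto)
qed

lemma exp_tail_integral:
  assumes "\<epsilon> > 0"
  shows "integrable lborel (\<lambda>s. indicator {c..} s * exp (- s / \<epsilon>) :: real)"
    "(\<integral>s. indicator {c..} s * exp (- s / \<epsilon>) \<partial>lborel) = \<epsilon> * exp (- c / \<epsilon>)"
proof -
  have "((\<lambda>s::real. exp (- (1/\<epsilon>) * s)) has_integral exp (- (1/\<epsilon>) * c) / (1/\<epsilon>)) {c..}"
    by (rule has_integral_exp_minus_to_infinity) (use assms in simp)
  then have hi: "((\<lambda>s::real. exp (- s / \<epsilon>)) has_integral \<epsilon> * exp (- c / \<epsilon>)) {c..}"
    by (simp add: mult.commute)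
  then have "(\<lambda>s::real. exp (- s / \<epsilon>)) absolutely_integrable_on {c..}"
    by (intro nonnegative_absolutely_integrable_1) auto
  then have si: "set_integrable lborel {c..} (\<lambda>s::real. exp (- s / \<epsilon>))"
    unfolding set_integrable_def by (subst (asm) integrable_completion) auto
  then show "integrable lborel (\<lambda>s. indicator {c..} s * exp (- s / \<epsilon>) :: real)"
    by (simp add: set_integrable_def)
  have "(\<integral>s. indicator {c..} s * exp (- s / \<epsilon>) \<partial>lborel) = integral {c..} (\<lambda>s. exp (- s / \<epsilon>))"
    using set_borel_integral_eq_integral(2)[OF si] by (simp add: set_lebesgue_integral_def)
  then show "(\<integral>s. indicator {c..} s * exp (- s / \<epsilon>) \<partial>lborel) = \<epsilon> * exp (- c / \<epsilon>)"
    using hi by (simp add: integral_unique)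
qed

lemma time_kernel:
  assumes e: "\<epsilon> > 0" and h: "0 < h" "h \<le> \<epsilon>"
  obtains \<kappa> \<tau> :: "real \<Rightarrow> real" and B where "smooth \<kappa>" "density_fn \<kappa>" "density_fn \<tau>"
    "\<And>s. s \<le> 0 \<Longrightarrow> \<kappa> s = 0" "\<And>s. s \<le> 0 \<Longrightarrow> \<tau> s = 0"
    "\<And>s. (\<kappa> has_real_derivative (\<tau> s - \<kappa> s) / \<epsilon>) (at s)" "\<And>s. \<kappa> s \<le> B"
    "\<And>r. r > 0 \<Longrightarrow> (\<integral>s. \<kappa> s * indicator {r<..} s \<partial>lborel) \<le> 9 * exp (- r / \<epsilon>)"
    "\<And>r. r > 0 \<Longrightarrow> (\<integral>s. \<tau> s * indicator {r<..} s \<partial>lborel) \<le> 9 * \<epsilon> * h / r\<^sup>2"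
proof -
  define k where "k s = bmp 0 (s * (1/h)) * exp (s * (- 1 / \<epsilon>))" for s
  define t where "t s = (\<epsilon> / h) * bmp 2 (s * (1/h)) * exp (s * (- 1 / \<epsilon>))" for s
  define E where "E c s = indicator {c..} s * exp (- s / \<epsilon>)" for c s :: real
  have id: "smooth (\<lambda>s::real. s)" by (rule smooth_linear) (rule bounded_linear_ident)
  have sk: "smooth k" unfolding k_def[abs_def]
    by (intro smooth_mult smooth_compose[OF smooth_bmp] smooth_compose[OF smooth_exp] id smooth_const)
  have st: "smooth t" unfolding t_def[abs_def]
    by (intro smooth_mult smooth_compose[OF smooth_bmp] smooth_compose[OF smooth_exp] id smooth_const)
  have [measurable]: "k \<in> borel_measurable borel" "t \<in> borel_measurable borel"
    using smooth_continuous[OF sk, of UNIV] smooth_continuous[OF st, of UNIV] by (auto intro: borel_measurable_continuous_onI)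
  have k0: "k s \<ge> 0" "t s \<ge> 0" for s using e h by (auto simp: k_def t_def bmp_nonneg)
  have kz: "k s = 0" "t s = 0" if "s \<le> 0" for s
    using that h by (auto simp: k_def t_def bmp_nonpos divide_nonpos_pos)
  have kE: "k s \<le> E 0 s" for s
  proof (cases "s \<le> 0")
    case False
    then show ?thesis using bmp_0_le_1[of "s/h"] by (simp add: k_def E_def)
  qed (simp add: kz E_def)
  have tE: "t s \<le> (2 * \<epsilon> / h) * E 0 s" for s
  proof (cases "s \<le> 0")
    case False
    have "(\<epsilon> / h) * bmp 2 (s * (1/h)) \<le> (\<epsilon> / h) * 2" using bmp_le_fact[of 2] e h by (intro mult_left_mono) (auto simp: fact_2)
    then have "t s \<le> (\<epsilon> / h) * 2 * exp (s * (- 1 / \<epsilon>))" unfolding t_def by (intro mult_right_mono) auto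
    then show ?thesis using False by (simp add: E_def mult_ac)
  qed (use e h in \<open>simp add: kz E_def\<close>)
  have iE: "integrable lborel (E c)" "(\<integral>s. E c s \<partial>lborel) = \<epsilon> * exp (- c / \<epsilon>)" for c
    using exp_tail_integral[OF e, of c] by (simp_all add: E_def[abs_def])
  have ik: "integrable lborel k"
    by (rule Bochner_Integration.integrable_bound[OF iE(1)[of 0]]) (use kE k0 in \<open>auto intro!: AE_I2 intro: order_trans[OF kE]\<close>)
  have it: "integrable lborel t"
  proof (rule Bochner_Integration.integrable_bound[of lborel "\<lambda>s. (2 * \<epsilon> / h) * E 0 s"])
    show "integrable lborel (\<lambda>s. (2 * \<epsilon> / h) * E 0 s)" using iE by (intro integrable_mult_right) auto
    show "AE s in lborel. norm (t s) \<le> norm ((2 * \<epsilon> / h) * E 0 s)"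
    proof (rule AE_I2)
      fix s show "norm (t s) \<le> norm ((2 * \<epsilon> / h) * E 0 s)"
        using tE[of s] k0(2)[of s] unfolding real_norm_def by linarith
    qed
  qed simp
  have kd: "(k has_real_derivative (t s - k s) / \<epsilon>) (at s)" for s
  proof -
    have "((\<lambda>s. bmp 0 (s * (1/h))) has_real_derivative bmp 2 (s * (1/h)) * (1/h)) (at s)"
      by (rule DERIV_chain2[where f="bmp 0"]) (use bmp_DERIV[of 0 "s * (1/h)"] h in \<open>auto simp: numeral_2_eq_2 intro!: derivative_eq_intros\<close>)
    moreover have "((\<lambda>s. exp (s * (- 1 / \<epsilon>))) has_real_derivative exp (s * (- 1 / \<epsilon>)) * (- 1 / \<epsilon>)) (at s)"
      using e by (auto intro!: derivative_eq_intros)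
    ultimately have "(k has_real_derivative bmp 2 (s * (1/h)) * (1/h) * exp (s * (- 1 / \<epsilon>))
        + exp (s * (- 1 / \<epsilon>)) * (- 1 / \<epsilon>) * bmp 0 (s * (1/h))) (at s)"
      unfolding k_def[abs_def] by (rule DERIV_mult)
    moreover have "bmp 2 (s * (1/h)) * (1/h) * exp (s * (- 1 / \<epsilon>))
        + exp (s * (- 1 / \<epsilon>)) * (- 1 / \<epsilon>) * bmp 0 (s * (1/h)) = (t s - k s) / \<epsilon>"
      using e h unfolding k_def t_def by (simp add: field_simps)
    ultimately show ?thesis by simp
  qed
  have "(\<integral>s. (t s - k s) / \<epsilon> \<partial>lborel) = 0"
  proof (rule integral_pderiv_eq_0[of 1 k, where B="\<lambda>s. ((2 * \<epsilon> / h + 1) / \<epsilon> * exp (1/\<epsilon>)) * E (-1) s"])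
    show "pderiv_along 1 k (\<lambda>s. (t s - k s) / \<epsilon>)"
      unfolding pderiv_along_def
    proof
      fix z
      show "((\<lambda>s. k (z + s *\<^sub>R 1)) has_real_derivative (t z - k z) / \<epsilon>) (at 0)"
        using DERIV_shift[of k "(t z - k z) / \<epsilon>" 0 z] kd[of z] by (simp add: add.commute)
    qed
    fix s z :: real assume s: "\<bar>s\<bar> < 1"
    have "\<bar>(t (z + s) - k (z + s)) / \<epsilon>\<bar> \<le> (2 * \<epsilon> / h + 1) / \<epsilon> * E 0 (z + s)"
    proof -
      have "\<bar>t (z + s) - k (z + s)\<bar> \<le> (2 * \<epsilon> / h) * E 0 (z + s) + E 0 (z + s)"
        using k0[of "z + s"] kE[of "z + s"] tE[of "z + s"] by linarith
      then have "\<bar>t (z + s) - k (z + s)\<bar> / \<epsilon> \<le> ((2 * \<epsilon> / h) * E 0 (z + s) + E 0 (z + s)) / \<epsilon>"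
        using e by (intro divide_right_mono) auto
      then show ?thesis using e by (simp add: abs_divide field_simps)
    qed
    also have "\<dots> \<le> (2 * \<epsilon> / h + 1) / \<epsilon> * (exp (1/\<epsilon>) * E (-1) z)"
    proof (intro mult_left_mono)
      show "E 0 (z + s) \<le> exp (1/\<epsilon>) * E (-1) z"
      proof (cases "z + s \<ge> 0")
        case True
        then have "z \<ge> -1" using s by linarith
        have "- (z + s) / \<epsilon> \<le> 1/\<epsilon> + - z / \<epsilon>" using s e by (simp add: field_simps)
        then have "exp (- (z + s) / \<epsilon>) \<le> exp (1/\<epsilon>) * exp (- z / \<epsilon>)" by (simp only: exp_add[symmetric] exp_le_cancel_iff)
        then show ?thesis using True \<open>z \<ge> -1\<close> by (simp add: E_def)
      qed (simp add: E_def)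
    qed (use e h in auto)
    finally show "\<bar>(t (z + s *\<^sub>R 1) - k (z + s *\<^sub>R 1)) / \<epsilon>\<bar> \<le> ((2 * \<epsilon> / h + 1) / \<epsilon> * exp (1/\<epsilon>)) * E (-1) z" by (simp add: mult.assoc)
  qed (use ik iE in auto)
  then have tk: "(\<integral>s. t s \<partial>lborel) = (\<integral>s. k s \<partial>lborel)" using e ik it by simp
  define m where "m = (\<integral>s. k s \<partial>lborel)"
  have mge: "m \<ge> \<epsilon> / 9"
  proof -
    have "exp (-1) * E h s \<le> k s" for s
    proof (cases "s \<ge> h")
      case True
      then have "bmp 0 (s * (1/h)) \<ge> exp (-1)" using h by (simp add: bmp_def divide_simps)
      then show ?thesis using True by (simp add: k_def E_def)
    qed (simp add: E_def k0)
    then have "(\<integral>s. exp (-1) * E h s \<partial>lborel) \<le> m"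
      unfolding m_def by (intro integral_mono) (use ik iE in auto)
    then have "exp (-1) * (\<epsilon> * exp (- h / \<epsilon>)) \<le> m" by (simp add: iE)
    moreover have "exp (-1) * exp (- h / \<epsilon>) \<ge> (1/9::real)"
    proof -
      have "exp (-2::real) \<le> exp (-1 + - h / \<epsilon>)" using e h by (simp add: field_simps)
      moreover have "exp (2::real) \<le> 9"
        using mult_mono[OF exp_le exp_le] exp_add[of 1 "1::real"] by simp
      then have "(1/9::real) \<le> exp (-2)" by (simp add: exp_minus field_simps)
      ultimately show ?thesis unfolding exp_add[symmetric] by linarith
    qed
    then have "\<epsilon> * (1/9) \<le> \<epsilon> * (exp (-1) * exp (- h / \<epsilon>))" using e by (intro mult_left_mono) auto
    ultimately show ?thesis by (simp add: mult_ac)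
  qed
  then have m: "m > 0" using e by (meson divide_pos_pos less_le_trans zero_less_numeral)
  have mi: "\<epsilon> / m \<le> 9" using mge m by (simp add: field_simps)
  show ?thesis
  proof (rule that[of "\<lambda>s. k s * (1/m)" "\<lambda>s. t s * (1/m)" "1/m"])
    show "smooth (\<lambda>s. k s * (1/m))" by (intro smooth_mult sk smooth_const)
    show "density_fn (\<lambda>s. k s * (1/m))" using ik k0 m by (simp add: density_fn_def m_def)
    show "density_fn (\<lambda>s. t s * (1/m))" using it k0 m tk by (simp add: density_fn_def m_def)
    show "((\<lambda>s. k s * (1/m)) has_real_derivative (t s * (1/m) - k s * (1/m)) / \<epsilon>) (at s)" for s
      using DERIV_cmult_right[OF kd, of "1/m" s] e m by (simp add: field_simps)
    show "k s * (1/m) \<le> 1/m" for s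
    proof (cases "s \<le> 0")
      case False
      have "k s \<le> 1 * 1" unfolding k_def using False e by (intro mult_mono bmp_0_le_1) (auto simp: bmp_nonneg)
      then show ?thesis using m by (simp add: divide_right_mono)
    qed (use m in \<open>simp add: kz\<close>)
    fix r :: real assume r: "r > 0"
    have "(\<integral>s. k s * (1/m) * indicator {r<..} s \<partial>lborel) \<le> (\<integral>s. (1/m) * E r s \<partial>lborel)"
    proof (rule integral_mono)
      show "integrable lborel (\<lambda>s. k s * (1/m) * indicator {r<..} s)"
        using ik by (intro integrable_real_mult_indicator) auto
      fix s show "k s * (1/m) * indicator {r<..} s \<le> (1/m) * E r s"
        using kE[of s] m r by (auto simp: E_def indicator_def divide_right_mono split: if_splits)
    qed (use iE in auto)
    also have "\<dots> = \<epsilon> / m * exp (- r / \<epsilon>)" using iE(2)[of r] by simp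
    also have "\<dots> \<le> 9 * exp (- r / \<epsilon>)" using mi by (intro mult_right_mono) auto
    finally show "(\<integral>s. k s * (1/m) * indicator {r<..} s \<partial>lborel) \<le> 9 * exp (- r / \<epsilon>)" .
    have "(\<integral>s. t s * (1/m) * indicator {r<..} s \<partial>lborel) \<le> (\<integral>s. (\<epsilon> * h / r\<^sup>2 / m) * E r s \<partial>lborel)"
    proof (rule integral_mono)
      show "integrable lborel (\<lambda>s. t s * (1/m) * indicator {r<..} s)"
        using it by (intro integrable_real_mult_indicator) auto
      fix s show "t s * (1/m) * indicator {r<..} s \<le> (\<epsilon> * h / r\<^sup>2 / m) * E r s"
      proof (cases "s > r")
        case True
        have "bmp 2 (s * (1/h)) = (h/s)\<^sup>2 * exp (- h / s)" using True r h by (simp add: bmp_def)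
        also have "\<dots> \<le> (h/s)\<^sup>2" using True r h by (simp add: mult_left_le)
        also have "\<dots> \<le> (h/r)\<^sup>2" using True r h by (intro power_mono divide_left_mono) auto
        finally have "(\<epsilon> / h) * bmp 2 (s * (1/h)) \<le> (\<epsilon> / h) * (h/r)\<^sup>2" using e h by (intro mult_left_mono) auto
        also have "\<dots> = \<epsilon> * h / r\<^sup>2" using h by (simp add: power2_eq_square)
        finally have "t s \<le> (\<epsilon> * h / r\<^sup>2) * exp (s * (- 1 / \<epsilon>))" unfolding t_def by (intro mult_right_mono) auto
        then have "t s / m \<le> (\<epsilon> * h / r\<^sup>2) * exp (s * (- 1 / \<epsilon>)) / m" using m by (intro divide_right_mono) auto
        then show ?thesis using True by (simp add: E_def)
      qed (use e h m r in \<open>simp add: E_def\<close>)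
    qed (use iE in auto)
    also have "\<dots> = \<epsilon> * h / r\<^sup>2 * (\<epsilon> / m) * exp (- r / \<epsilon>)" using iE(2)[of r] by simp
    also have "\<dots> \<le> \<epsilon> * h / r\<^sup>2 * 9 * 1"
      using mi e h r m by (intro mult_mono) auto
    finally show "(\<integral>s. t s * (1/m) * indicator {r<..} s \<partial>lborel) \<le> 9 * \<epsilon> * h / r\<^sup>2" by (simp add: mult_ac)
  qed (use kz in auto)
qed

lemma kernel_exists:
  assumes r: "r > 0"
  obtains \<epsilon> where "\<epsilon> > 0"
    "\<And>r' e'. 0 < r' \<Longrightarrow> r' \<le> r \<Longrightarrow> 0 < e' \<Longrightarrow>
      \<exists>(\<rho> :: 'a::euclidean_space \<Rightarrow> real) \<kappa> \<tau> B. smooth \<rho> \<and> smooth \<kappa> \<and> concentrated r r \<rho> \<kappa> \<and> concentrated r' e' \<rho> \<tau>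
        \<and> (\<forall>s. (\<kappa> has_real_derivative (\<tau> s - \<kappa> s) / \<epsilon>) (at s)) \<and> (\<forall>y. kprod \<rho> \<kappa> y \<le> B)"
proof (rule that[of "r\<^sup>2 / 9"])
  show e: "r\<^sup>2 / 9 > 0" using r by simp
  fix r' e' :: real assume r': "0 < r'" "r' \<le> r" and e': "0 < e'"
  define \<epsilon> where "\<epsilon> = r\<^sup>2 / 9"
  have ep: "\<epsilon> > 0" using e by (simp add: \<epsilon>_def)
  define h where "h = min \<epsilon> (e' * r'\<^sup>2 / (9 * \<epsilon>))"
  have h: "0 < h" "h \<le> \<epsilon>" "h \<le> e' * r'\<^sup>2 / (9 * \<epsilon>)" using ep r' e' by (auto simp: h_def)
  obtain \<rho> :: "'a \<Rightarrow> real" and B where \<rho>: "smooth \<rho>" "density_fn \<rho>" "\<And>y. norm y > r' \<Longrightarrow> \<rho> y = 0" "\<And>y. \<rho> y \<le> B"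
    using spatial_kernel[OF r'(1)] by blast
  obtain \<kappa> \<tau> C where \<kappa>: "smooth \<kappa>" "density_fn \<kappa>" "density_fn \<tau>"
    "\<And>s. s \<le> 0 \<Longrightarrow> \<kappa> s = 0" "\<And>s. s \<le> 0 \<Longrightarrow> \<tau> s = 0"
    "\<And>s. (\<kappa> has_real_derivative (\<tau> s - \<kappa> s) / \<epsilon>) (at s)" "\<And>s. \<kappa> s \<le> C"
    "\<And>r. r > 0 \<Longrightarrow> (\<integral>s. \<kappa> s * indicator {r<..} s \<partial>lborel) \<le> 9 * exp (- r / \<epsilon>)"
    "\<And>r. r > 0 \<Longrightarrow> (\<integral>s. \<tau> s * indicator {r<..} s \<partial>lborel) \<le> 9 * \<epsilon> * h / r\<^sup>2"
    using time_kernel[OF ep h(1,2)] by blast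
  have "9 * exp (- r / \<epsilon>) \<le> r"
  proof -
    have "r / \<epsilon> \<le> exp (r / \<epsilon>)" using exp_ge_add_one_self[of "r / \<epsilon>"] by linarith
    then have "inverse (exp (r / \<epsilon>)) \<le> inverse (r / \<epsilon>)" using r ep by (intro le_imp_inverse_le) auto
    then have "9 * exp (- r / \<epsilon>) \<le> 9 * (\<epsilon> / r)" by (simp add: exp_minus)
    also have "\<dots> = r" using r by (simp add: \<epsilon>_def power2_eq_square)
    finally show ?thesis .
  qed
  then have c1: "concentrated r r \<rho> \<kappa>"
    unfolding concentrated_def using \<rho> \<kappa>(2,4) \<kappa>(8)[OF r] r' by auto
  have "9 * \<epsilon> * h / r'\<^sup>2 \<le> e'" using h(3) ep r' by (simp add: field_simps)
  then have c2: "concentrated r' e' \<rho> \<tau>"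
    unfolding concentrated_def using \<rho> \<kappa>(3,5) \<kappa>(9)[OF r'(1)] by auto
  have \<rho>0: "\<rho> y \<ge> 0" for y using \<rho>(2) by (simp add: density_fn_def)
  have \<kappa>0: "\<kappa> s \<ge> 0" for s using \<kappa>(2) by (simp add: density_fn_def)
  have "kprod \<rho> \<kappa> y \<le> B * C" for y
    unfolding kprod_def using \<rho>(4)[of "fst y"] \<kappa>(7)[of "snd y"] \<rho>0[of "fst y"] \<kappa>0[of "snd y"]
    by (intro mult_mono) auto
  with c1 c2 \<rho>(1) \<kappa>(1,6) show "\<exists>(\<rho> :: 'a \<Rightarrow> real) \<kappa> \<tau> B. smooth \<rho> \<and> smooth \<kappa> \<and> concentrated r r \<rho> \<kappa> \<and> concentrated r' e' \<rho> \<tau>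
        \<and> (\<forall>s. (\<kappa> has_real_derivative (\<tau> s - \<kappa> s) / (r\<^sup>2 / 9)) (at s)) \<and> (\<forall>y. kprod \<rho> \<kappa> y \<le> B)"
    unfolding \<epsilon>_def by blast
qed

lemma cyl_sets: "open \<Omega> \<Longrightarrow> open (cyl \<Omega> T)" "bounded \<Omega> \<Longrightarrow> bounded (cyl \<Omega> T)"
  unfolding cyl_def by (auto intro: open_Times bounded_Times)

lemma continuous_integrable_bounded_set:
  fixes f :: "'b::euclidean_space \<Rightarrow> real"
  assumes "continuous_on UNIV f" "bounded S" "S \<in> sets borel"
  shows "integrable lborel (\<lambda>z. indicator S z * f z)"
proof -
  obtain R where R: "S \<subseteq> cball 0 R" using assms(2) by (auto simp: bounded_iff subset_eq)
  have "integrable lborel (\<lambda>x. indicator (cball 0 R) x *\<^sub>R f x)"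
    by (rule borel_integrable_compact) (use continuous_on_subset[OF assms(1)] in auto)
  then have "integrable lborel (\<lambda>x. indicator S x *\<^sub>R (indicator (cball 0 R) x *\<^sub>R f x))"
    by (rule integrable_mult_indicator[rotated]) (use assms in auto)
  also have "(\<lambda>x. indicator S x *\<^sub>R (indicator (cball 0 R) x *\<^sub>R f x)) = (\<lambda>z. indicator S z * f z)"
    using R by (auto simp: indicator_def fun_eq_iff)
  finally show ?thesis .
qed

lemma time_derivative_integral_bound:
  fixes Q Q' :: "'a::euclidean_space \<times> real \<Rightarrow> real"
  assumes \<Omega>: "open \<Omega>" "bounded \<Omega>" and T: "T > 0"
    and Q: "pderiv_along (0, 1) Q Q'" "continuous_on UNIV Q'"
    and B: "\<And>z. \<bar>Q z\<bar> \<le> B"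
  shows "\<bar>\<integral>z. indicator (cyl \<Omega> T) z * Q' z \<partial>lborel\<bar> \<le> 2 * B * measure lborel \<Omega>"
proof -
  have [measurable]: "\<Omega> \<in> sets borel" using \<Omega> by auto
  have iQ: "integrable lborel (\<lambda>z. indicator (cyl \<Omega> T) z * Q' z)"
    by (rule continuous_integrable_bounded_set[OF Q(2)]) (use cyl_sets[of \<Omega> T] \<Omega> in \<open>auto intro: borel_open\<close>)
  have inner: "(\<integral>t. indicator (cyl \<Omega> T) (x, t) * Q' (x, t) \<partial>lborel) = indicator \<Omega> x * (Q (x, T) - Q (x, 0))" for x
  proof -
    have cx: "continuous_on UNIV (\<lambda>t. Q' (x, t))"
      by (rule continuous_on_compose2[OF Q(2)]) (auto intro!: continuous_intros)
    have [measurable]: "(\<lambda>t. Q' (x, t)) \<in> borel_measurable borel" by (rule borel_measurable_continuous_onI[OF cx])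
    have "(\<integral>t. indicator {0..T} t *\<^sub>R Q' (x, t) \<partial>lborel) = Q (x, T) - Q (x, 0)"
    proof (rule integral_FTC_Icc)
      fix t
      have "((\<lambda>s. Q ((x, 0) + s *\<^sub>R (0, 1))) has_real_derivative Q' ((x, 0) + t *\<^sub>R (0, 1))) (at t)"
        by (rule pderiv_along_line[OF Q(1)])
      then have "((\<lambda>s. Q (x, s)) has_real_derivative Q' (x, t)) (at t)" by simp
      then show "((\<lambda>s. Q (x, s)) has_vector_derivative Q' (x, t)) (at t within {0..T})"
        by (simp add: has_real_derivative_iff_has_vector_derivative has_vector_derivative_at_within)
    qed (use T continuous_on_subset[OF cx] in auto)
    moreover have "(\<integral>t. indicator {0<..<T} t * Q' (x, t) \<partial>lborel) = (\<integral>t. indicator {0..T} t *\<^sub>R Q' (x, t) \<partial>lborel)"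
    proof (rule integral_cong_AE)
      show "AE t in lborel. indicator {0<..<T} t * Q' (x, t) = indicator {0..T} t *\<^sub>R Q' (x, t)"
        using AE_lborel_singleton[of 0] AE_lborel_singleton[of T]
        by eventually_elim (auto simp: indicator_def)
    qed auto
    moreover have "(\<integral>t. indicator (cyl \<Omega> T) (x, t) * Q' (x, t) \<partial>lborel) = indicator \<Omega> x * (\<integral>t. indicator {0<..<T} t * Q' (x, t) \<partial>lborel)"
      by (simp add: cyl_def indicator_times mult.assoc)
    ultimately show ?thesis by simp
  qed
  have "integrable (lborel \<Otimes>\<^sub>M lborel) (\<lambda>z. indicator (cyl \<Omega> T) z * Q' z)" using iQ by (simp add: lborel_prod)
  from lborel_pair.integral_fst'[OF this] lborel_pair.integrable_fst'[OF this]
  have eq: "(\<integral>z. indicator (cyl \<Omega> T) z * Q' z \<partial>lborel) = (\<integral>x. indicator \<Omega> x * (Q (x, T) - Q (x, 0)) \<partial>lborel)"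
    and i: "integrable lborel (\<lambda>x. indicator \<Omega> x * (Q (x, T) - Q (x, 0)))"
    by (simp_all only: inner lborel_prod)
  have i\<Omega>: "integrable lborel (\<lambda>x. indicator \<Omega> x * (2 * B) :: real)"
    using \<Omega> emeasure_bounded_finite[OF \<Omega>(2)] by (intro integrable_mult_left integrable_real_indicator) auto
  have "\<bar>\<integral>x. indicator \<Omega> x * (Q (x, T) - Q (x, 0)) \<partial>lborel\<bar> \<le> (\<integral>x. indicator \<Omega> x * (2 * B) \<partial>lborel)"
  proof (rule integral_abs_bound_integral[OF i i\<Omega>])
    fix x
    have "\<bar>Q (x, T) - Q (x, 0)\<bar> \<le> 2 * B" using B[of "(x, T)"] B[of "(x, 0)"] by linarith
    then show "\<bar>indicator \<Omega> x * (Q (x, T) - Q (x, 0))\<bar> \<le> indicator \<Omega> x * (2 * B)" by (simp add: indicator_def)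
  qed
  then show ?thesis using eq by (simp add: mult.commute)
qed

section \<open>Functions vanishing on the parabolic boundary\<close>

lemma closure_cyl: "T > 0 \<Longrightarrow> closure (cyl \<Omega> T) = closure \<Omega> \<times> {0..T}"
  by (simp add: cyl_def closure_Times)

lemma compact_closure_subset:
  assumes "compact C" "closure S \<subseteq> (C :: 'b::euclidean_space set)"
  shows "compact (closure S)"
proof -
  have "C \<inter> closure S = closure S" using assms(2) by blast
  then show ?thesis using compact_Int_closed[OF assms(1) closed_closure, of S] by (simp only:)
qed

lemma crossing_par_boundary:
  fixes z z' :: "'a::euclidean_space \<times> real"
  assumes "open \<Omega>" "T > 0" "z \<in> cyl \<Omega> T" "z' \<notin> cyl \<Omega> T" "snd z' < T"
  obtains y where "y \<in> par_boundary \<Omega> T" "dist z y \<le> dist z z'"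
proof -
  have "closed_segment z z' \<inter> frontier (cyl \<Omega> T) \<noteq> {}"
    by (rule connected_Int_frontier) (use assms in auto)
  then obtain y where y: "y \<in> closed_segment z z'" "y \<in> frontier (cyl \<Omega> T)" by blast
  obtain u where u: "0 \<le> u" "u \<le> 1" "y = (1 - u) *\<^sub>R z + u *\<^sub>R z'" using y(1) by (auto simp: in_segment)
  have zT: "snd z < T" using assms(3) by (auto simp: cyl_def)
  have "snd y < T"
  proof -
    have "snd y = (1 - u) * snd z + u * snd z'" using u by simp
    also have "\<dots> < T" using convex_bound_lt[OF zT assms(5), of "1 - u" u] u by simp
    finally show ?thesis .
  qed
  moreover have "y \<in> closure \<Omega> \<times> {0..T}" "y \<notin> cyl \<Omega> T"
    using y(2) closure_cyl[OF assms(2), of \<Omega>] cyl_sets(1)[OF assms(1), of T]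
    by (auto simp: frontier_def interior_open)
  ultimately have "y \<in> par_boundary \<Omega> T"
    using assms(1) by (cases y) (auto simp: par_boundary_def cyl_def frontier_def interior_open)
  moreover have "dist z y \<le> dist z z'"
    using y(1) by (metis dist_in_closed_segment dist_commute)
  ultimately show ?thesis using that by blast
qed

lemma smooth_fst:
  fixes f :: "'a::euclidean_space \<Rightarrow> real"
  assumes "smooth f"
  shows "smooth (\<lambda>z :: 'a \<times> real. f (fst z))"
proof (rule smooth_coinduct[where P="\<lambda>h. \<exists>f. smooth f \<and> h = (\<lambda>z. f (fst z))"])
  fix h :: "'a \<times> real \<Rightarrow> real" assume "\<exists>f. smooth f \<and> h = (\<lambda>z. f (fst z))"
  then obtain f where f: "smooth f" "h = (\<lambda>z. f (fst z))" by blast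
  show "continuous_on UNIV h"
    unfolding f(2) by (rule continuous_on_compose2[OF smooth_continuous[OF f(1), of UNIV]]) (auto intro: continuous_on_fst continuous_on_id)
  fix d :: "'a \<times> real" assume "d \<in> Basis"
  then consider i where "i \<in> Basis" "d = (i, 0)" | "d = (0, 1)" by (auto simp: Basis_prod_def)
  then show "\<exists>h'. (\<exists>f. smooth f \<and> h' = (\<lambda>z. f (fst z))) \<and> pderiv_along d h h'"
  proof cases
    case 1
    then have "pderiv_along d h (\<lambda>z. pdir i f (fst z))"
      using smooth_pderiv_along[OF f(1) 1(1)] by (simp add: pderiv_along_def f(2))
    then show ?thesis using smooth_pdir[OF f(1) 1(1)] by blast
  next
    case 2
    then have "pderiv_along d h (\<lambda>z. 0)" by (simp add: pderiv_along_def f(2))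
    then show ?thesis using smooth_const[of 0] by (intro exI[of _ "\<lambda>z. 0"] conjI exI[of _ "\<lambda>z. 0"]) auto
  qed
qed (use assms in blast)

lemma smooth_snd:
  assumes "smooth f" shows "smooth (\<lambda>z :: 'a::euclidean_space \<times> real. f (snd z))"
  by (rule smooth_compose[OF assms smooth_linear[OF bounded_linear_snd]])

lemma smooth_kprod: "smooth \<rho> \<Longrightarrow> smooth \<kappa> \<Longrightarrow> smooth (kprod \<rho> \<kappa>)"
  unfolding kprod_def[abs_def] by (intro smooth_mult smooth_fst smooth_snd)

lemma concentrated_mono:
  assumes "concentrated r e \<rho> \<theta>" "r \<le> r'" "e \<le> e'"
  shows "concentrated r' e' \<rho> \<theta>"
proof -
  have \<theta>: "integrable lborel \<theta>" "\<And>s. \<theta> s \<ge> 0" using assms by (auto simp: concentrated_def density_fn_def)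
  have "(\<integral>s. \<theta> s * indicator {r'<..} s \<partial>lborel) \<le> (\<integral>s. \<theta> s * indicator {r<..} s \<partial>lborel)"
  proof (rule integral_mono)
    show "integrable lborel (\<lambda>s. \<theta> s * indicator {r'<..} s)" "integrable lborel (\<lambda>s. \<theta> s * indicator {r<..} s)"
      using \<theta> by (auto intro!: integrable_real_mult_indicator)
    show "\<theta> s * indicator {r'<..} s \<le> \<theta> s * indicator {r<..} s" for s
      using \<theta> assms by (simp add: indicator_def)
  qed
  then show ?thesis using assms by (auto simp: concentrated_def)
qed

lemma time_cutoff_tendsto:
  assumes "0 < s" "s < (T::real)"
  shows "(\<lambda>n. bmp 0 (real (Suc n) * s - 1) * bmp 0 (real (Suc n) * (T - s) - 1)) \<longlonglongrightarrow> 1"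
proof -
  have *: "(\<lambda>n. bmp 0 (real (Suc n) * a - 1)) \<longlonglongrightarrow> 1" if a: "a > 0" for a
  proof -
    have t: "filterlim (\<lambda>n. real (Suc n) * a - 1) at_top sequentially"
    proof -
      have "filterlim (\<lambda>n. (-1) + real (Suc n) * a) at_top sequentially"
        by (intro filterlim_tendsto_add_at_top[OF tendsto_const] filterlim_at_top_mult_tendsto_pos[OF tendsto_const a]
            filterlim_compose[OF filterlim_real_sequentially filterlim_Suc])
      then show ?thesis by (simp add: algebra_simps)
    qed
    have "(\<lambda>n. exp (-1 / (real (Suc n) * a - 1))) \<longlonglongrightarrow> exp 0"
      by (intro tendsto_exp tendsto_divide_0[OF tendsto_const] filterlim_at_top_imp_at_infinity t)
    moreover have "\<forall>\<^sub>F n in sequentially. exp (-1 / (real (Suc n) * a - 1)) = bmp 0 (real (Suc n) * a - 1)"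
    proof -
      have "\<forall>\<^sub>F n in sequentially. 0 < real (Suc n) * a - 1" using t unfolding filterlim_at_top_dense by blast
      then show ?thesis by eventually_elim (simp add: bmp_def)
    qed
    ultimately show ?thesis using Lim_transform_eventually by fastforce
  qed
  show ?thesis using tendsto_mult[OF *[OF assms(1)] *[of "T - s"]] assms by simp
qed

text \<open>\<open>w\<close> is a continuous function on the closed cylinder that vanishes on the parabolic
  boundary, and \<open>g\<close> is a Borel representative, extended by zero, of its weak spatial gradient.\<close>

locale weak_cyl =
  fixes \<Omega> :: "'a::euclidean_space set" and T :: real
    and w :: "'a \<times> real \<Rightarrow> real" and g :: "'a \<times> real \<Rightarrow> 'a"
  assumes open_\<Omega>: "open \<Omega>" and bounded_\<Omega>: "bounded \<Omega>" and T_pos: "T > 0"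
    and w_cont: "continuous_on (closure (cyl \<Omega> T)) w"
    and w_bdry: "\<And>z. z \<in> par_boundary \<Omega> T \<Longrightarrow> w z = 0"
    and g_int: "\<And>i. i \<in> Basis \<Longrightarrow> integrable lborel (\<lambda>z. g z \<bullet> i)"
    and g_zero: "\<And>z. z \<notin> cyl \<Omega> T \<Longrightarrow> g z = 0"
    and weak: "\<And>\<eta> i. test_fun (cyl \<Omega> T) \<eta> \<Longrightarrow> i \<in> Basis \<Longrightarrow>
        (\<integral>z. (indicator (cyl \<Omega> T) z * w z) * pdir (i, 0) \<eta> z \<partial>lborel) = - (\<integral>z. (g z \<bullet> i) * \<eta> z \<partial>lborel)"
begin

definition wz :: "'a \<times> real \<Rightarrow> real" where "wz z = indicator (cyl \<Omega> T) z * w z"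

definition M :: real where "M = (SOME M. \<forall>z. \<bar>wz z\<bar> \<le> M)"

lemma open_cyl: "open (cyl \<Omega> T)" and bounded_cyl: "bounded (cyl \<Omega> T)"
  using cyl_sets open_\<Omega> bounded_\<Omega> by auto

lemma cyl_borel [measurable]: "cyl \<Omega> T \<in> sets borel"
  using open_cyl by (rule borel_open)

lemma wz_outside: "z \<notin> cyl \<Omega> T \<Longrightarrow> wz z = 0"
  by (simp add: wz_def)

lemma compact_closure_cyl: "compact (closure (cyl \<Omega> T))"
  using bounded_cyl by (simp add: compact_closure)

lemma wz_bound: "\<bar>wz z\<bar> \<le> M"
proof -
  have "compact (w ` closure (cyl \<Omega> T))" by (rule compact_continuous_image[OF w_cont compact_closure_cyl])
  then obtain B where B: "\<forall>x\<in>w ` closure (cyl \<Omega> T). norm x \<le> B" using compact_imp_bounded bounded_iff by blast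
  have "\<forall>z. \<bar>wz z\<bar> \<le> max B 0"
  proof
    fix z show "\<bar>wz z\<bar> \<le> max B 0" using B closure_subset[of "cyl \<Omega> T"]
      by (cases "z \<in> cyl \<Omega> T") (auto simp: wz_def le_max_iff_disj)
  qed
  then have "\<forall>z. \<bar>wz z\<bar> \<le> M" unfolding M_def by (rule someI)
  then show ?thesis by blast
qed

lemma M_nonneg: "M \<ge> 0"
  using wz_bound[of undefined] by linarith

lemma cyl_ball: obtains R where "cyl \<Omega> T \<subseteq> cball 0 R"
  using bounded_cyl by (auto simp: bounded_iff subset_eq)

lemma wz_measurable [measurable]: "wz \<in> borel_measurable borel"
proof -
  have "continuous_on (cyl \<Omega> T) w" using w_cont closure_subset continuous_on_subset by blast
  then have "(\<lambda>z. if z \<in> cyl \<Omega> T then w z else 0) \<in> borel_measurable borel"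
    by (intro borel_measurable_continuous_on_if) auto
  also have "(\<lambda>z. if z \<in> cyl \<Omega> T then w z else 0) = wz" by (auto simp: wz_def fun_eq_iff)
  finally show ?thesis .
qed

lemma indicator_cyl_integrable: "integrable lborel (indicator (cyl \<Omega> T) :: _ \<Rightarrow> real)"
  using emeasure_bounded_finite[OF bounded_cyl] by (intro integrable_real_indicator) auto

lemma wz_integrable: "integrable lborel wz"
proof (rule Bochner_Integration.integrable_bound[of lborel "\<lambda>z. M * indicator (cyl \<Omega> T) z"])
  show "AE z in lborel. norm (wz z) \<le> norm (M * indicator (cyl \<Omega> T) z)"
  proof (rule AE_I2)
    fix z show "norm (wz z) \<le> norm (M * indicator (cyl \<Omega> T) z)"
      using wz_bound[of z] M_nonneg by (auto simp: indicator_def wz_def)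
  qed
qed (use indicator_cyl_integrable in auto)

lemma modulus:
  assumes e: "e > 0"
  obtains r where "r > 0" "\<And>z z'. snd z < T \<Longrightarrow> snd z' < T \<Longrightarrow> norm (fst z - fst z') \<le> r \<Longrightarrow>
    \<bar>snd z - snd z'\<bar> \<le> r \<Longrightarrow> \<bar>wz z - wz z'\<bar> \<le> e"
proof -
  have "uniformly_continuous_on (closure (cyl \<Omega> T)) w"
    by (rule compact_uniformly_continuous[OF w_cont compact_closure_cyl])
  then obtain d where d: "d > 0" "\<And>z z'. z \<in> closure (cyl \<Omega> T) \<Longrightarrow> z' \<in> closure (cyl \<Omega> T) \<Longrightarrow> dist z' z < d \<Longrightarrow> dist (w z') (w z) < e"
    unfolding uniformly_continuous_on_def using e by meson
  have cl: "cyl \<Omega> T \<subseteq> closure (cyl \<Omega> T)" "par_boundary \<Omega> T \<subseteq> closure (cyl \<Omega> T)"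
    using closure_subset closure_cyl[OF T_pos, of \<Omega>] T_pos by (auto simp: par_boundary_def frontier_def)
  have one: "\<bar>wz z\<bar> \<le> e" if z: "z \<in> cyl \<Omega> T" "z' \<notin> cyl \<Omega> T" "snd z' < T" "dist z z' < d" for z z'
  proof -
    obtain y where y: "y \<in> par_boundary \<Omega> T" "dist z y \<le> dist z z'"
      using crossing_par_boundary[OF open_\<Omega> T_pos z(1,2,3)] by blast
    then have "dist (w z) (w y) < e" using d(2)[of y z] z cl by auto
    then show ?thesis using w_bdry[OF y(1)] z by (simp add: wz_def)
  qed
  show ?thesis
  proof (rule that[of "d/3"])
    fix z z' :: "'a \<times> real"
    assume z: "snd z < T" "snd z' < T" "norm (fst z - fst z') \<le> d/3" "\<bar>snd z - snd z'\<bar> \<le> d/3"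
    have "dist z z' \<le> norm (fst z - fst z') + norm (snd z - snd z')"
      unfolding dist_norm by (metis fst_diff snd_diff norm_Pair_le prod.collapse)
    then have dz: "dist z z' < d" using z d(1) by simp
    consider "z \<in> cyl \<Omega> T" "z' \<in> cyl \<Omega> T" | "z \<in> cyl \<Omega> T" "z' \<notin> cyl \<Omega> T"
      | "z \<notin> cyl \<Omega> T" "z' \<in> cyl \<Omega> T" | "z \<notin> cyl \<Omega> T" "z' \<notin> cyl \<Omega> T" by blast
    then show "\<bar>wz z - wz z'\<bar> \<le> e"
    proof cases
      case 1
      then have "dist (w z) (w z') < e" using d(2)[of z' z] dz cl by blast
      then show ?thesis using 1 by (simp add: wz_def dist_real_def)
    next
      case 2
      then show ?thesis using one[OF 2 z(2) dz] by (simp add: wz_def)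
    next
      case 3
      then show ?thesis using one[OF 3(2,1) z(1)] dz by (simp add: wz_def dist_commute)
    next
      case 4
      then show ?thesis using e by (simp add: wz_def)
    qed
  qed (use d in auto)
qed

text \<open>Since only spatial derivatives occur, test functions need not vanish near the two ends of
  the time interval.\<close>

lemma weak_spatial_support:
  assumes \<eta>: "smooth \<eta>" and K: "compact K" "K \<subseteq> \<Omega>" "\<And>z. fst z \<notin> K \<Longrightarrow> \<eta> z = 0" and i: "i \<in> Basis"
  shows "(\<integral>z. wz z * pdir (i, 0) \<eta> z \<partial>lborel) = - (\<integral>z. (g z \<bullet> i) * \<eta> z \<partial>lborel)"
proof -
  define \<theta> where "\<theta> n s = bmp 0 (s * real (Suc n) - 1) * bmp 0 ((T - s) * real (Suc n) - 1)" for n and s :: real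
  have id: "smooth (\<lambda>s::real. s)" by (rule smooth_linear) (rule bounded_linear_ident)
  have s\<theta>: "smooth (\<theta> n)" for n unfolding \<theta>_def[abs_def]
    by (intro smooth_mult smooth_compose[OF smooth_bmp] smooth_diff smooth_const id)
  have \<theta>01: "0 \<le> \<theta> n s" "\<theta> n s \<le> 1" for n s
    unfolding \<theta>_def by (auto simp: bmp_nonneg bmp_0_le_1 mult_le_one)
  have [measurable]: "(\<lambda>z :: 'a \<times> real. \<theta> n (snd z)) \<in> borel_measurable borel" for n
    by (rule borel_measurable_continuous_onI[OF smooth_continuous[OF smooth_snd[OF s\<theta>]]])
  have \<theta>1: "(\<lambda>n. \<theta> n (snd z)) \<longlonglongrightarrow> 1" if "z \<in> cyl \<Omega> T" for z
    using time_cutoff_tendsto[of "snd z" T] that by (auto simp: \<theta>_def cyl_def mult.commute)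
  have iB: "(i, 0) \<in> (Basis :: ('a \<times> real) set)" using i by (simp add: Basis_prod_def)
  have c: "continuous_on UNIV \<eta>" "continuous_on UNIV (pdir (i, 0) \<eta>)"
    using smooth_continuous[OF \<eta>] smooth_continuous[OF smooth_pdir[OF \<eta> iB]] by auto
  have [measurable]: "\<eta> \<in> borel_measurable borel" "pdir (i, 0) \<eta> \<in> borel_measurable borel"
    by (rule borel_measurable_continuous_onI, rule c)+
  have [measurable]: "(\<lambda>z. g z \<bullet> i) \<in> borel_measurable borel" using g_int[OF i] by auto
  have test: "test_fun (cyl \<Omega> T) (\<lambda>z. \<eta> z * \<theta> n (snd z))" for n
  proof -
    define C where "C = K \<times> {1 / real (Suc n)..T - 1 / real (Suc n)}"
    have C: "compact C" unfolding C_def using K by (intro compact_Times) auto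
    have "{z. \<eta> z * \<theta> n (snd z) \<noteq> 0} \<subseteq> C"
    proof
      fix z assume z: "z \<in> {z. \<eta> z * \<theta> n (snd z) \<noteq> 0}"
      then have "fst z \<in> K" using K(3)[of z] by auto
      moreover have "snd z * real (Suc n) - 1 > 0" "(T - snd z) * real (Suc n) - 1 > 0"
        using z bmp_nonpos[of "snd z * real (Suc n) - 1" 0] bmp_nonpos[of "(T - snd z) * real (Suc n) - 1" 0]
        by (auto simp: \<theta>_def not_le[symmetric] simp del: of_nat_Suc)
      then have "1 / real (Suc n) \<le> snd z" "1 / real (Suc n) \<le> T - snd z"
        by (auto simp: divide_le_eq simp del: of_nat_Suc)
      ultimately show "z \<in> C" unfolding C_def by (cases z) auto
    qed
    then have sub: "closure {z. \<eta> z * \<theta> n (snd z) \<noteq> 0} \<subseteq> C"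
      using C closure_minimal compact_imp_closed by blast
    have "C \<subseteq> cyl \<Omega> T"
    proof
      fix z assume "z \<in> C"
      then have "fst z \<in> \<Omega>" "1 / real (Suc n) \<le> snd z" "snd z \<le> T - 1 / real (Suc n)"
        using K(2) unfolding C_def by (auto simp: mem_Times_iff)
      moreover have "1 / real (Suc n) > 0" by simp
      ultimately have "fst z \<in> \<Omega>" "0 < snd z" "snd z < T" by linarith+
      then show "z \<in> cyl \<Omega> T" by (simp add: cyl_def mem_Times_iff)
    qed
    moreover have "compact (closure {z. \<eta> z * \<theta> n (snd z) \<noteq> 0})"
      by (rule compact_closure_subset[OF C sub])
    moreover have "smooth (\<lambda>z. \<eta> z * \<theta> n (snd z))" by (intro smooth_mult \<eta> smooth_snd s\<theta>)
    ultimately show ?thesis unfolding test_fun_def using sub by blast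
  qed
  have pd: "pdir (i, 0) (\<lambda>z. \<eta> z * \<theta> n (snd z)) z = pdir (i, 0) \<eta> z * \<theta> n (snd z)" for n z
  proof -
    have "pderiv_along (i, 0) (\<lambda>z :: 'a \<times> real. \<theta> n (snd z)) (\<lambda>z. 0)" by (simp add: pderiv_along_def)
    from pderiv_along_mult[OF smooth_pderiv_along[OF \<eta> iB] this]
    show ?thesis by (simp add: pderiv_along_pdir)
  qed
  obtain R where R: "cyl \<Omega> T \<subseteq> cball 0 R" using cyl_ball .
  obtain B where B: "B \<ge> 0" "\<And>z. z \<in> cball 0 R \<Longrightarrow> \<bar>pdir (i, 0) \<eta> z\<bar> \<le> B"
    using continuous_bounded_on_cball[OF c(2)] by blast
  obtain B' where B': "B' \<ge> 0" "\<And>z. z \<in> cball 0 R \<Longrightarrow> \<bar>\<eta> z\<bar> \<le> B'"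
    using continuous_bounded_on_cball[OF c(1)] by blast
  have gen: "(\<lambda>n. \<integral>z. f z * (h z * \<theta> n (snd z)) \<partial>lborel) \<longlonglongrightarrow> (\<integral>z. f z * h z \<partial>lborel)"
    if f: "integrable lborel f" and z: "\<And>z. z \<notin> cyl \<Omega> T \<Longrightarrow> f z = 0"
      and [measurable]: "h \<in> borel_measurable borel" and b: "\<And>z. z \<in> cball 0 R \<Longrightarrow> \<bar>h z\<bar> \<le> C" "C \<ge> 0"
    for f h :: "'a \<times> real \<Rightarrow> real" and C
  proof (rule integral_dominated_convergence[where w="\<lambda>z. \<bar>f z\<bar> * C"])
    have [measurable]: "f \<in> borel_measurable borel" using f by auto
    show "(\<lambda>z. f z * h z) \<in> borel_measurable lborel" "\<And>n. (\<lambda>z. f z * (h z * \<theta> n (snd z))) \<in> borel_measurable lborel"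
      by simp_all
    show "integrable lborel (\<lambda>z. \<bar>f z\<bar> * C)" using f by simp
    show "AE x in lborel. (\<lambda>n. f x * (h x * \<theta> n (snd x))) \<longlonglongrightarrow> f x * h x"
    proof (rule AE_I2)
      fix x
      show "(\<lambda>n. f x * (h x * \<theta> n (snd x))) \<longlonglongrightarrow> f x * h x"
      proof (cases "x \<in> cyl \<Omega> T")
        case True
        have "(\<lambda>n. f x * (h x * \<theta> n (snd x))) \<longlonglongrightarrow> f x * (h x * 1)" by (intro tendsto_intros \<theta>1 True)
        then show ?thesis by simp
      qed (simp add: z)
    qed
    show "AE x in lborel. norm (f x * (h x * \<theta> n (snd x))) \<le> \<bar>f x\<bar> * C" for n
    proof (rule AE_I2)
      fix x
      show "norm (f x * (h x * \<theta> n (snd x))) \<le> \<bar>f x\<bar> * C"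
      proof (cases "x \<in> cyl \<Omega> T")
        case True
        then have "\<bar>h x\<bar> * \<theta> n (snd x) \<le> C * 1" using R b(1)[of x] b(2) \<theta>01 by (intro mult_mono) auto
        then show ?thesis using \<theta>01(1)[of n "snd x"] by (simp add: abs_mult mult_left_mono)
      qed (simp add: z)
    qed
  qed
  have "(\<lambda>n. \<integral>z. wz z * (pdir (i, 0) \<eta> z * \<theta> n (snd z)) \<partial>lborel) \<longlonglongrightarrow> (\<integral>z. wz z * pdir (i, 0) \<eta> z \<partial>lborel)"
    by (rule gen[OF wz_integrable wz_outside _ B(2,1)]) auto
  moreover have "(\<lambda>n. - (\<integral>z. (g z \<bullet> i) * (\<eta> z * \<theta> n (snd z)) \<partial>lborel)) \<longlonglongrightarrow> - (\<integral>z. (g z \<bullet> i) * \<eta> z \<partial>lborel)"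
    by (rule tendsto_minus, rule gen[OF g_int[OF i] _ _ B'(2,1)]) (auto simp: g_zero)
  moreover have "(\<integral>z. wz z * (pdir (i, 0) \<eta> z * \<theta> n (snd z)) \<partial>lborel) = - (\<integral>z. (g z \<bullet> i) * (\<eta> z * \<theta> n (snd z)) \<partial>lborel)" for n
    using weak[OF test i, of n] by (simp add: pd wz_def)
  ultimately show ?thesis using LIMSEQ_unique by simp
qed

lemma conv_gradient:
  assumes k: "smooth \<rho>" "smooth \<kappa>" "\<And>y. norm y > r \<Longrightarrow> \<rho> y = 0" and i: "i \<in> Basis"
    and z: "cball (fst z) r \<subseteq> \<Omega>"
  shows "pdir (i, 0) (conv (kprod \<rho> \<kappa>) wz) z = conv (kprod \<rho> \<kappa>) (\<lambda>y. g y \<bullet> i) z"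
proof -
  let ?k = "kprod \<rho> \<kappa>"
  have sk: "smooth ?k" by (rule smooth_kprod[OF k(1,2)])
  have iB: "(i, 0) \<in> (Basis :: ('a \<times> real) set)" using i by (simp add: Basis_prod_def)
  obtain R where R: "cyl \<Omega> T \<subseteq> cball 0 R" using cyl_ball .
  have "pdir (i, 0) (conv ?k wz) = conv (pdir (i, 0) ?k) wz"
    by (rule pderiv_along_pdir[OF conv_pderiv_along[OF sk wz_integrable _ iB, of R]]) (use R wz_outside in blast)
  moreover have "pdir (i, 0) (\<lambda>y. ?k (z - y)) y = - pdir (i, 0) ?k (z - y)" for y
    using pderiv_along_pdir[OF pderiv_along_reflect[OF smooth_pderiv_along[OF sk iB], of z]] by simp
  moreover have "(\<integral>y. wz y * pdir (i, 0) (\<lambda>y. ?k (z - y)) y \<partial>lborel) = - (\<integral>y. (g y \<bullet> i) * ?k (z - y) \<partial>lborel)"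
  proof (rule weak_spatial_support[OF smooth_reflect[OF sk] compact_cball z _ i])
    fix y :: "'a \<times> real" assume "fst y \<notin> cball (fst z) r"
    then show "?k (z - y) = 0" using k(3)[of "fst z - fst y"] by (simp add: kprod_def dist_norm)
  qed
  ultimately show ?thesis by (simp add: conv_def mult.commute)
qed

lemma conv_time_derivative:
  assumes k: "smooth \<rho>" "smooth \<kappa>" "density_fn \<rho>" "density_fn \<kappa>" "density_fn \<tau>"
    and d: "\<And>s. (\<kappa> has_real_derivative (\<tau> s - \<kappa> s) / \<epsilon>) (at s)"
  shows "pdir (0, 1) (conv (kprod \<rho> \<kappa>) wz) z = (conv (kprod \<rho> \<tau>) wz z - conv (kprod \<rho> \<kappa>) wz z) / \<epsilon>"
proof -
  let ?k = "kprod \<rho> \<kappa>"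
  have sk: "smooth ?k" by (rule smooth_kprod[OF k(1,2)])
  have iB: "(0, 1) \<in> (Basis :: ('a \<times> real) set)" by (simp add: Basis_prod_def)
  obtain R where R: "cyl \<Omega> T \<subseteq> cball 0 R" using cyl_ball .
  have "pdir (0, 1) (conv ?k wz) = conv (pdir (0, 1) ?k) wz"
    by (rule pderiv_along_pdir[OF conv_pderiv_along[OF sk wz_integrable _ iB, of R]]) (use R wz_outside in blast)
  moreover have "pdir (0, 1) ?k = (\<lambda>y. (kprod \<rho> \<tau> y - kprod \<rho> \<kappa> y) / \<epsilon>)"
  proof (rule pderiv_along_pdir, unfold pderiv_along_def, rule)
    fix y :: "'a \<times> real"
    have "((\<lambda>s. \<rho> (fst y) * \<kappa> (snd y + s)) has_real_derivative \<rho> (fst y) * ((\<tau> (snd y) - \<kappa> (snd y)) / \<epsilon>)) (at 0)"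
      using DERIV_shift[of \<kappa> "(\<tau> (snd y) - \<kappa> (snd y)) / \<epsilon>" 0 "snd y"] d[of "snd y"]
      by (intro DERIV_cmult) (simp add: add.commute)
    then show "((\<lambda>s. ?k (y + s *\<^sub>R (0, 1))) has_real_derivative (kprod \<rho> \<tau> y - ?k y) / \<epsilon>) (at 0)"
      by (simp add: kprod_def algebra_simps diff_divide_distrib)
  qed
  moreover have "conv (\<lambda>y. (kprod \<rho> \<tau> y - kprod \<rho> \<kappa> y) / \<epsilon>) wz z = (conv (kprod \<rho> \<tau>) wz z - conv ?k wz z) / \<epsilon>"
  proof -
    have i: "integrable lborel (\<lambda>y. h (z - y) * wz y)" if "density_fn h" for h
    proof -
      have [measurable]: "h \<in> borel_measurable borel" using that by (auto simp: density_fn_def)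
      have "integrable lborel (\<lambda>y. h y * wz (z - y))"
        by (rule conv_bound_integrable[OF _ wz_measurable wz_bound]) (use that in \<open>auto simp: density_fn_def\<close>)
      then show ?thesis using lborel_integrable_reflect[of "\<lambda>y. h y * wz (z - y)" z] by simp
    qed
    have "(\<lambda>y. (kprod \<rho> \<tau> (z - y) - ?k (z - y)) / \<epsilon> * wz y) = (\<lambda>y. (kprod \<rho> \<tau> (z - y) * wz y - ?k (z - y) * wz y) / \<epsilon>)"
      by (simp add: fun_eq_iff algebra_simps diff_divide_distrib)
    then show ?thesis
      using Bochner_Integration.integral_diff[OF i[OF kprod_density[OF k(3,5)]] i[OF kprod_density[OF k(3,4)]]]
      by (simp add: conv_def)
  qed
  ultimately show ?thesis by simp
qed

lemma approximants:
  assumes \<delta>: "\<delta> > 0"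
  obtains \<rho> \<kappa> B f \<epsilon> where "smooth \<rho>" "smooth \<kappa>" "concentrated \<delta> \<delta> \<rho> \<kappa>" "\<And>y. kprod \<rho> \<kappa> y \<le> B"
    "\<And>z. snd z < T \<Longrightarrow> \<bar>conv (kprod \<rho> \<kappa>) wz z - wz z\<bar> \<le> \<delta> / 2"
    "\<And>z i. snd z < T \<Longrightarrow> i \<in> Basis \<Longrightarrow> thr' \<delta> (conv (kprod \<rho> \<kappa>) wz z) * pdir (i, 0) (conv (kprod \<rho> \<kappa>) wz) z
       = thr' \<delta> (conv (kprod \<rho> \<kappa>) wz z) * conv (kprod \<rho> \<kappa>) (\<lambda>y. g y \<bullet> i) z"
    "\<epsilon> > 0" "\<And>z. pdir (0, 1) (conv (kprod \<rho> \<kappa>) wz) z = (f z - conv (kprod \<rho> \<kappa>) wz z) / \<epsilon>"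
    "\<And>z. \<bar>conv (kprod \<rho> \<kappa>) wz z\<bar> \<le> M" "\<And>z. \<bar>f z\<bar> \<le> M" "\<And>z. snd z < T \<Longrightarrow> \<bar>f z - wz z\<bar> \<le> \<epsilon> * \<delta>"
proof -
  obtain r1 where r1: "r1 > 0" "\<And>z z'. snd z < T \<Longrightarrow> snd z' < T \<Longrightarrow> norm (fst z - fst z') \<le> r1 \<Longrightarrow>
    \<bar>snd z - snd z'\<bar> \<le> r1 \<Longrightarrow> \<bar>wz z - wz z'\<bar> \<le> \<delta>/4" using modulus[of "\<delta>/4"] \<delta> by auto
  define r where "r = min (min r1 \<delta>) (\<delta> / (8 * (M + 1)))"
  have M1: "M + 1 > 0" using M_nonneg by simp
  have r: "r > 0" "r \<le> r1" "r \<le> \<delta>" "r \<le> \<delta> / (8 * (M + 1))" using r1 \<delta> M1 by (auto simp: r_def)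
  have Mr: "2 * M * r \<le> \<delta>/4"
  proof -
    have "2 * M * r \<le> 2 * (M + 1) * r" using r by simp
    also have "\<dots> \<le> \<delta>/4" using r(4) M1 by (simp add: field_simps)
    finally show ?thesis .
  qed
  obtain \<epsilon> where \<epsilon>: "\<epsilon> > 0"
    "\<And>r' e'. 0 < r' \<Longrightarrow> r' \<le> r \<Longrightarrow> 0 < e' \<Longrightarrow>
      \<exists>(\<rho> :: 'a \<Rightarrow> real) \<kappa> \<tau> B. smooth \<rho> \<and> smooth \<kappa> \<and> concentrated r r \<rho> \<kappa> \<and> concentrated r' e' \<rho> \<tau>
        \<and> (\<forall>s. (\<kappa> has_real_derivative (\<tau> s - \<kappa> s) / \<epsilon>) (at s)) \<and> (\<forall>y. kprod \<rho> \<kappa> y \<le> B)"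
    using kernel_exists[OF r(1)] by metis
  obtain r2 where r2: "r2 > 0" "\<And>z z'. snd z < T \<Longrightarrow> snd z' < T \<Longrightarrow> norm (fst z - fst z') \<le> r2 \<Longrightarrow>
    \<bar>snd z - snd z'\<bar> \<le> r2 \<Longrightarrow> \<bar>wz z - wz z'\<bar> \<le> \<epsilon> * \<delta> / 2" using modulus[of "\<epsilon> * \<delta> / 2"] \<delta> \<epsilon>(1) by auto
  define r' where "r' = min r r2"
  define e' where "e' = \<epsilon> * \<delta> / (4 * (M + 1))"
  have r': "r' > 0" "r' \<le> r" "r' \<le> r2" using r r2 by (auto simp: r'_def)
  have e': "e' > 0" using \<epsilon> \<delta> M1 by (simp add: e'_def)
  have Me: "2 * M * e' \<le> \<epsilon> * \<delta> / 2"
  proof -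
    have "2 * M * e' \<le> 2 * (M + 1) * e'" using e' by simp
    also have "\<dots> = \<epsilon> * \<delta> / 2" using M1 by (simp add: e'_def field_simps)
    finally show ?thesis .
  qed
  obtain \<rho> :: "'a \<Rightarrow> real" and \<kappa> \<tau> B where k: "smooth \<rho>" "smooth \<kappa>" "concentrated r r \<rho> \<kappa>" "concentrated r' e' \<rho> \<tau>"
    "\<And>s. (\<kappa> has_real_derivative (\<tau> s - \<kappa> s) / \<epsilon>) (at s)" "\<And>y. kprod \<rho> \<kappa> y \<le> B"
    using \<epsilon>(2)[OF r'(1,2) e'] by blast
  have dens: "density_fn \<rho>" "density_fn \<kappa>" "density_fn \<tau>" using k by (auto simp: concentrated_def)
  have close: "\<bar>conv (kprod \<rho> \<kappa>) wz z - wz z\<bar> \<le> \<delta> / 2" if z: "snd z < T" for z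
  proof -
    have "\<bar>conv (kprod \<rho> \<kappa>) wz z - wz z\<bar> \<le> \<delta>/4 + 2 * M * r"
    proof (rule conv_approx[OF k(3) wz_measurable wz_bound])
      fix z' :: "'a \<times> real" assume "norm (fst z - fst z') \<le> r" "snd z' \<le> snd z" "snd z - snd z' \<le> r"
      then show "\<bar>wz z' - wz z\<bar> \<le> \<delta>/4" using r1(2)[of z' z] z r(2) by (simp add: norm_minus_commute)
    qed (use \<delta> in auto)
    then show ?thesis using Mr by linarith
  qed
  have bd: "\<bar>conv (kprod \<rho> h) wz z\<bar> \<le> M" if "density_fn h" for h z
    by (rule conv_abs_le) (use kprod_density[OF dens(1) that] wz_bound wz_measurable in \<open>auto simp: density_fn_def simp del: split_paired_All\<close>)
  show ?thesis
  proof (rule that[of \<rho> \<kappa> B \<epsilon> "conv (kprod \<rho> \<tau>) wz"])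
    show "concentrated \<delta> \<delta> \<rho> \<kappa>" by (rule concentrated_mono[OF k(3) r(3) r(3)])
    show "pdir (0, 1) (conv (kprod \<rho> \<kappa>) wz) z = (conv (kprod \<rho> \<tau>) wz z - conv (kprod \<rho> \<kappa>) wz z) / \<epsilon>" for z
      by (rule conv_time_derivative[OF k(1,2) dens k(5)])
    show "\<bar>conv (kprod \<rho> \<tau>) wz z - wz z\<bar> \<le> \<epsilon> * \<delta>" if z: "snd z < T" for z
    proof -
      have "\<bar>conv (kprod \<rho> \<tau>) wz z - wz z\<bar> \<le> \<epsilon> * \<delta> / 2 + 2 * M * e'"
      proof (rule conv_approx[OF k(4) wz_measurable wz_bound])
        fix z' :: "'a \<times> real" assume "norm (fst z - fst z') \<le> r'" "snd z' \<le> snd z" "snd z - snd z' \<le> r'"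
        then show "\<bar>wz z' - wz z\<bar> \<le> \<epsilon> * \<delta> / 2" using r2(2)[of z' z] z r'(3) by (simp add: norm_minus_commute)
      qed (use \<delta> \<epsilon> in auto)
      then show ?thesis using Me by linarith
    qed
    fix z :: "'a \<times> real" and i :: 'a assume z: "snd z < T" and i: "i \<in> Basis"
    show "thr' \<delta> (conv (kprod \<rho> \<kappa>) wz z) * pdir (i, 0) (conv (kprod \<rho> \<kappa>) wz) z
       = thr' \<delta> (conv (kprod \<rho> \<kappa>) wz z) * conv (kprod \<rho> \<kappa>) (\<lambda>y. g y \<bullet> i) z"
    proof (cases "\<bar>conv (kprod \<rho> \<kappa>) wz z\<bar> \<le> \<delta>")
      case True
      then show ?thesis by (simp add: thr'_eq_0[OF \<delta>])
    next
      case False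
      then have big: "\<bar>wz z\<bar> > \<delta>/2" using close[OF z] by linarith
      have "cball (fst z) r \<subseteq> \<Omega>"
      proof
        fix y assume y: "y \<in> cball (fst z) r"
        show "y \<in> \<Omega>"
        proof (rule ccontr)
          assume "y \<notin> \<Omega>"
          then have "wz (y, snd z) = 0" by (simp add: wz_def cyl_def)
          moreover have "\<bar>wz z - wz (y, snd z)\<bar> \<le> \<delta>/4"
            using r1(2)[of z "(y, snd z)"] z y r r1(1) by (simp add: dist_norm)
          ultimately show False using big \<delta> by simp
        qed
      qed
      then show ?thesis using conv_gradient[OF k(1,2) _ i, of r z] k(3) by (simp add: concentrated_def)
    qed
  qed (use k close bd dens \<epsilon> in auto)
qed

lemma zero_gradient_imp_zero:
  assumes g0: "\<And>i. i \<in> Basis \<Longrightarrow> AE z in lborel. g z \<bullet> i = 0"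
  shows "wz z = 0"
proof (cases "snd z < T")
  case False
  then show ?thesis by (intro wz_outside) (auto simp: cyl_def)
next
  case zT: True
  have le: "\<bar>wz z\<bar> \<le> 3/2 * \<delta>" if \<delta>: "\<delta> > 0" for \<delta>
  proof -
    from approximants[OF \<delta>] obtain \<rho> \<kappa> where k: "smooth \<rho>" "smooth \<kappa>"
      and close: "\<And>z. snd z < T \<Longrightarrow> \<bar>conv (kprod \<rho> \<kappa>) wz z - wz z\<bar> \<le> \<delta> / 2"
      and grad: "\<And>z i. snd z < T \<Longrightarrow> i \<in> Basis \<Longrightarrow> thr' \<delta> (conv (kprod \<rho> \<kappa>) wz z) * pdir (i, 0) (conv (kprod \<rho> \<kappa>) wz) z
       = thr' \<delta> (conv (kprod \<rho> \<kappa>) wz z) * conv (kprod \<rho> \<kappa>) (\<lambda>y. g y \<bullet> i) z"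
      by metis
    define W where "W = conv (kprod \<rho> \<kappa>) wz"
    obtain R where R: "cyl \<Omega> T \<subseteq> cball 0 R" using cyl_ball .
    have sW: "smooth W" unfolding W_def
      by (rule smooth_conv[OF smooth_kprod[OF k] wz_integrable, of R]) (use R wz_outside in blast)
    obtain i :: 'a where i: "i \<in> Basis" using nonempty_Basis by blast
    have iB: "(i, 0) \<in> (Basis :: ('a \<times> real) set)" using i by (simp add: Basis_prod_def)
    have c0: "conv (kprod \<rho> \<kappa>) (\<lambda>y. g y \<bullet> i) z = 0" for z
    proof -
      have "conv (kprod \<rho> \<kappa>) (\<lambda>y. g y \<bullet> i) z = (\<integral>y. 0 \<partial>(lborel :: ('a \<times> real) measure))"
        unfolding conv_def
      proof (rule integral_cong_AE)
        have [measurable]: "(\<lambda>y. g y \<bullet> i) \<in> borel_measurable borel" using g_int[OF i] by auto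
        have [measurable]: "kprod \<rho> \<kappa> \<in> borel_measurable borel"
          by (rule borel_measurable_continuous_onI[OF smooth_continuous[OF smooth_kprod[OF k]]])
        show "(\<lambda>y. kprod \<rho> \<kappa> (z - y) * (g y \<bullet> i)) \<in> borel_measurable lborel" by simp
        show "AE y in lborel. kprod \<rho> \<kappa> (z - y) * (g y \<bullet> i) = 0" using g0[OF i] by eventually_elim simp
      qed simp
      then show ?thesis by simp
    qed
    define F where "F t = thr \<delta> (W (z + t *\<^sub>R (i, 0)))" for t
    have "(F has_real_derivative 0) (at t)" for t
    proof -
      have "(F has_real_derivative thr' \<delta> (W (z + t *\<^sub>R (i, 0))) * pdir (i, 0) W (z + t *\<^sub>R (i, 0))) (at t)"
        unfolding F_def
        by (rule pderiv_along_line[OF pderiv_along_compose[OF thr_DERIV[OF \<delta>] smooth_pderiv_along[OF sW iB]]])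
      also have "thr' \<delta> (W (z + t *\<^sub>R (i, 0))) * pdir (i, 0) W (z + t *\<^sub>R (i, 0)) = 0"
        using grad[of "z + t *\<^sub>R (i, 0)" i] zT i by (simp add: W_def c0)
      finally show ?thesis .
    qed
    then have const: "F 0 = F (\<bar>R\<bar> + norm z + 1)" by (metis DERIV_const_ratio_const2 DERIV_isconst_all)
    have "z + (\<bar>R\<bar> + norm z + 1) *\<^sub>R (i, 0) \<notin> cyl \<Omega> T"
    proof
      assume "z + (\<bar>R\<bar> + norm z + 1) *\<^sub>R (i, 0) \<in> cyl \<Omega> T"
      then have "norm (z + (\<bar>R\<bar> + norm z + 1) *\<^sub>R (i, 0::real)) \<le> R" using R by auto
      moreover have "norm ((\<bar>R\<bar> + norm z + 1) *\<^sub>R (i, 0::real)) \<le> norm (z + (\<bar>R\<bar> + norm z + 1) *\<^sub>R (i, 0::real)) + norm z"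
        using norm_triangle_ineq4[of "z + (\<bar>R\<bar> + norm z + 1) *\<^sub>R (i, 0::real)" z] by simp
      moreover have "norm ((\<bar>R\<bar> + norm z + 1) *\<^sub>R (i, 0::real)) = \<bar>R\<bar> + norm z + 1" using i by (simp add: norm_Pair)
      ultimately show False by linarith
    qed
    then have "wz (z + (\<bar>R\<bar> + norm z + 1) *\<^sub>R (i, 0)) = 0" by (simp add: wz_def)
    then have "\<bar>W (z + (\<bar>R\<bar> + norm z + 1) *\<^sub>R (i, 0))\<bar> \<le> \<delta>"
      using close[of "z + (\<bar>R\<bar> + norm z + 1) *\<^sub>R (i, 0)"] zT \<delta> by (simp add: W_def)
    then have "F (\<bar>R\<bar> + norm z + 1) = 0" unfolding F_def by (rule thr_eq_0[OF \<delta>])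
    then have "F 0 = 0" using const by simp
    moreover have "z + 0 *\<^sub>R (i, 0) = z" by (simp only: scaleR_zero_left add_0_right)
    ultimately have "thr \<delta> (W z) = 0" unfolding F_def by (simp only:)
    then have "\<bar>W z\<bar> \<le> \<delta>"
      using sq_le_1_iff[OF \<delta>, of "W z"] bmp_pos[of "(W z)\<^sup>2 / \<delta>\<^sup>2 - 1" 0] \<delta> by (auto simp: thr_def not_le[symmetric])
    then show ?thesis using close[OF zT] unfolding W_def by linarith
  qed
  have "\<bar>wz z\<bar> \<le> 0 + e" if "e > 0" for e using le[of "2/3 * e"] that by simp
  then show ?thesis using field_le_epsilon[of "\<bar>wz z\<bar>" 0] by simp
qed

end

section \<open>Competitors in the variational inequality\<close>

lemma cyl_par_boundary_disjoint:
  assumes "open \<Omega>" "z \<in> cyl \<Omega> T" shows "z \<notin> par_boundary \<Omega> T"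
  using assms by (auto simp: cyl_def par_boundary_def frontier_def interior_open)

lemma par_boundary_subset_closure: "T > 0 \<Longrightarrow> par_boundary \<Omega> T \<subseteq> closure (cyl \<Omega> T)"
  using closure_cyl[of T \<Omega>] by (auto simp: par_boundary_def frontier_def)

lemma bounded_antiderivative:
  fixes h :: "real \<Rightarrow> real"
  assumes "continuous_on UNIV h" "\<And>s. \<bar>h s\<bar> \<le> c" "m \<ge> 0"
  obtains H where "\<And>s. \<bar>s\<bar> \<le> m \<Longrightarrow> (H has_real_derivative h s) (at s)"
    "\<And>s. \<bar>s\<bar> \<le> m \<Longrightarrow> \<bar>H s\<bar> \<le> c * m"
proof -
  obtain G where G: "\<And>s. s \<in> {-m-1..m+1} \<Longrightarrow> (G has_vector_derivative h s) (at s within {-m-1..m+1})"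
    using antiderivative_continuous[of "-m-1" "m+1" h] continuous_on_subset[OF assms(1)] by auto
  have c0: "c \<ge> 0" using assms(2)[of 0] by linarith
  have d: "((\<lambda>s. G s - G 0) has_real_derivative h s) (at s)" if "\<bar>s\<bar> \<le> m" for s
  proof -
    have si: "s \<in> {-m-1<..<m+1}" using that by auto
    then have "s \<in> interior {-m-1..m+1}" by (simp only: interior_atLeastAtMost_real)
    from at_within_interior[OF this] have "(G has_vector_derivative h s) (at s)" using G[of s] si by auto
    then have "(G has_real_derivative h s) (at s)" by (simp add: has_real_derivative_iff_has_vector_derivative)
    from DERIV_diff[OF this DERIV_const[of "G 0"]] show ?thesis by simp
  qed
  show ?thesis
  proof (rule that[of "\<lambda>s. G s - G 0"])
    fix s :: real assume s: "\<bar>s\<bar> \<le> m"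
    show "((\<lambda>s. G s - G 0) has_real_derivative h s) (at s)" by (rule d[OF s])
    have "norm ((G s - G 0) - (G 0 - G 0)) \<le> c * norm (s - 0)"
    proof (rule field_differentiable_bound[of "{-m..m}" "\<lambda>s. G s - G 0" h])
      fix x assume "x \<in> {-m..m}"
      then have "\<bar>x\<bar> \<le> m" by auto
      from d[OF this] show "((\<lambda>s. G s - G 0) has_real_derivative h x) (at x within {-m..m})"
        by (rule has_field_derivative_at_within)
      show "norm (h x) \<le> c" using assms(2) by simp
    qed (use s assms(3) in auto)
    also have "\<dots> \<le> c * m" using s c0 by (intro mult_left_mono) auto
    finally show "\<bar>G s - G 0\<bar> \<le> c * m" by simp
  qed
qed

definition competitor :: "'a::euclidean_space set \<Rightarrow> real \<Rightarrow> ('a \<times> real \<Rightarrow> real) \<Rightarrow> ('a \<times> real \<Rightarrow> real) \<Rightarrow> bool" where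
  "competitor \<Omega> T \<psi> \<phi> \<longleftrightarrow> smooth \<phi> \<and> (\<forall>z\<in>par_boundary \<Omega> T. \<phi> z = \<psi> z) \<and> (\<forall>z\<in>cyl \<Omega> T. \<phi> z \<ge> \<psi> z)"

context weak_cyl
begin

lemma time_term_integrable:
  assumes "smooth \<phi>"
  shows "integrable lborel (\<lambda>z. indicator (cyl \<Omega> T) z * ((\<phi> z - w z) * dt \<phi> z))"
proof -
  have c: "continuous_on UNIV \<phi>" "continuous_on UNIV (dt \<phi>)"
    using assms by (simp_all add: smooth_continuous smooth_pdir dt_def Basis_prod_def)
  obtain R where R: "cyl \<Omega> T \<subseteq> cball 0 R" using cyl_ball .
  have "integrable lborel (\<lambda>z. indicator (cyl \<Omega> T) z * (\<phi> z * dt \<phi> z) - wz z * dt \<phi> z)"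
  proof (rule Bochner_Integration.integrable_diff)
    show "integrable lborel (\<lambda>z. indicator (cyl \<Omega> T) z * (\<phi> z * dt \<phi> z))"
      by (rule continuous_integrable_bounded_set[OF continuous_on_mult[OF c(1,2)] bounded_cyl cyl_borel])
    show "integrable lborel (\<lambda>z. wz z * dt \<phi> z)"
      by (rule integrable_mult_continuous[OF wz_integrable _ c(2), of R]) (use R wz_outside in blast)
  qed
  also have "(\<lambda>z. indicator (cyl \<Omega> T) z * (\<phi> z * dt \<phi> z) - wz z * dt \<phi> z) = (\<lambda>z. indicator (cyl \<Omega> T) z * ((\<phi> z - w z) * dt \<phi> z))"
    by (auto simp: fun_eq_iff wz_def algebra_simps)
  finally show "integrable lborel (\<lambda>z. indicator (cyl \<Omega> T) z * ((\<phi> z - w z) * dt \<phi> z))" .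
qed

definition approximant where
  "approximant \<psi> \<eta> C \<delta> \<phi> \<rho> \<kappa> \<longleftrightarrow> competitor \<Omega> T \<psi> \<phi> \<and> concentrated \<delta> \<delta> \<rho> \<kappa> \<and> (\<exists>B. \<forall>y. kprod \<rho> \<kappa> y \<le> B)
     \<and> (\<forall>z\<in>cyl \<Omega> T. \<bar>conv (kprod \<rho> \<kappa>) wz z - w z\<bar> \<le> \<delta> / 2)
     \<and> (\<forall>z\<in>cyl \<Omega> T. \<forall>i\<in>Basis. pdir (i, 0) \<phi> z =
           thr' \<delta> (conv (kprod \<rho> \<kappa>) wz z) * conv (kprod \<rho> \<kappa>) (\<lambda>y. g y \<bullet> i) z + 3 * \<delta> * pdir (i, 0) \<eta> z)
     \<and> (\<integral>z. indicator (cyl \<Omega> T) z * ((\<phi> z - w z) * dt \<phi> z) \<partial>lborel) \<le> C * \<delta>"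

lemma approximant_exists:
  assumes \<psi>: "C0_on (cyl \<Omega> T) \<psi>" "\<And>z. z \<in> cyl \<Omega> T \<Longrightarrow> \<psi> z \<le> w z"
    and \<eta>: "test_fun (cyl \<Omega> T) \<eta>" "\<And>z. \<eta> z \<ge> 0" "\<And>z. \<psi> z \<noteq> 0 \<Longrightarrow> \<eta> z \<ge> 1"
  shows "\<exists>C. \<forall>\<delta>. 0 < \<delta> \<longrightarrow> \<delta> \<le> 1 \<longrightarrow> (\<exists>\<phi> \<rho> \<kappa>. approximant \<psi> \<eta> C \<delta> \<phi> \<rho> \<kappa>)"
proof -
  have s\<eta>: "smooth \<eta>" using \<eta>(1) by (simp add: test_fun_def)
  have tB: "(0, 1) \<in> (Basis :: ('a \<times> real) set)" by (simp add: Basis_prod_def)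
  have \<eta>out: "\<eta> z = 0" if "z \<notin> cyl \<Omega> T" for z
    using \<eta>(1) that closure_subset[of "{z. \<eta> z \<noteq> 0}"] unfolding test_fun_def by blast
  have \<psi>out: "\<psi> z = 0" if "z \<notin> cyl \<Omega> T" for z
    using \<psi>(1) that closure_subset[of "{z. \<psi> z \<noteq> 0}"] unfolding C0_on_def by blast
  obtain R where R: "cyl \<Omega> T \<subseteq> cball 0 R" using cyl_ball .
  obtain N1 where N1: "N1 \<ge> 0" "\<And>z. z \<in> cball 0 R \<Longrightarrow> \<bar>\<eta> z\<bar> \<le> N1"
    using continuous_bounded_on_cball[OF smooth_continuous[OF s\<eta>]] by blast
  obtain N2 where N2: "N2 \<ge> 0" "\<And>z. z \<in> cball 0 R \<Longrightarrow> \<bar>pdir (0, 1) \<eta> z\<bar> \<le> N2"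
    using continuous_bounded_on_cball[OF smooth_continuous[OF smooth_pdir[OF s\<eta> tB]]] by blast
  define N where "N = max N1 N2"
  have N0: "N \<ge> 0" using N1 by (simp add: N_def)
  have N\<eta>: "\<bar>\<eta> z\<bar> \<le> N" for z
    using N1(2)[of z] R \<eta>out[of z] N0 by (cases "z \<in> cyl \<Omega> T") (auto simp: N_def le_max_iff_disj)
  have Nt: "\<bar>pdir (0, 1) \<eta> z\<bar> \<le> N" if "z \<in> cyl \<Omega> T" for z
    using N2(2)[of z] R that by (auto simp: N_def le_max_iff_disj)
  define C1 where "C1 = 3 * N * M + 8 * M + 3 * N * (2 * M + 3 * N)"
  define C where "C = 2 * (8 * M + 3 * N * M) * measure lborel \<Omega> + C1 * measure lborel (cyl \<Omega> T)"
  show ?thesis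
  proof (intro exI[of _ C] allI impI)
    fix \<delta> :: real assume \<delta>: "0 < \<delta>" "\<delta> \<le> 1"
    obtain \<rho> \<kappa> B f \<epsilon> where k: "smooth \<rho>" "smooth \<kappa>" "concentrated \<delta> \<delta> \<rho> \<kappa>" "\<And>y. kprod \<rho> \<kappa> y \<le> B"
      and close: "\<And>z. snd z < T \<Longrightarrow> \<bar>conv (kprod \<rho> \<kappa>) wz z - wz z\<bar> \<le> \<delta> / 2"
      and grad: "\<And>z i. snd z < T \<Longrightarrow> i \<in> Basis \<Longrightarrow> thr' \<delta> (conv (kprod \<rho> \<kappa>) wz z) * pdir (i, 0) (conv (kprod \<rho> \<kappa>) wz) z
       = thr' \<delta> (conv (kprod \<rho> \<kappa>) wz z) * conv (kprod \<rho> \<kappa>) (\<lambda>y. g y \<bullet> i) z"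
      and \<epsilon>: "\<epsilon> > 0" and Wt: "\<And>z. pdir (0, 1) (conv (kprod \<rho> \<kappa>) wz) z = (f z - conv (kprod \<rho> \<kappa>) wz z) / \<epsilon>"
      and WM: "\<And>z. \<bar>conv (kprod \<rho> \<kappa>) wz z\<bar> \<le> M" and fM: "\<And>z. \<bar>f z\<bar> \<le> M"
      and fw: "\<And>z. snd z < T \<Longrightarrow> \<bar>f z - wz z\<bar> \<le> \<epsilon> * \<delta>"
      by (rule approximants[OF \<delta>(1)]) (rule that; assumption)
    define W where "W = conv (kprod \<rho> \<kappa>) wz"
    note close = close[folded W_def] and grad = grad[folded W_def] and Wt = Wt[folded W_def] and WM = WM[folded W_def]
    have sW: "smooth W" unfolding W_def
      by (rule smooth_conv[OF smooth_kprod[OF k(1,2)] wz_integrable, of R]) (use R wz_outside in blast)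
    have cW: "\<bar>W z - w z\<bar> \<le> \<delta>/2" if z: "z \<in> closure (cyl \<Omega> T)" for z
    proof -
      have "norm (W z - w z) \<le> \<delta>/2"
      proof (rule continuous_on_closure_norm_le[OF _ _ z])
        show "continuous_on (closure (cyl \<Omega> T)) (\<lambda>z. W z - w z)"
          by (intro continuous_on_diff smooth_continuous sW w_cont)
        show "\<forall>y\<in>cyl \<Omega> T. norm (W y - w y) \<le> \<delta>/2"
        proof
          fix y assume y: "y \<in> cyl \<Omega> T"
          then have "snd y < T" "wz y = w y" by (auto simp: cyl_def wz_def)
          then show "norm (W y - w y) \<le> \<delta>/2" using close[of y] by simp
        qed
      qed
      then show ?thesis by simp
    qed
    define \<phi> where "\<phi> z = thr \<delta> (W z) + 3 * \<delta> * \<eta> z" for z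
    have s\<phi>: "smooth \<phi>" unfolding \<phi>_def[abs_def]
      by (intro smooth_add smooth_mult smooth_const smooth_compose[OF smooth_thr] sW s\<eta>)
    have d\<phi>: "pdir d \<phi> z = thr' \<delta> (W z) * pdir d W z + 3 * \<delta> * pdir d \<eta> z" if "d \<in> Basis" for d z
    proof -
      have "pderiv_along d \<phi> (\<lambda>z. thr' \<delta> (W z) * pdir d W z + (0 * \<eta> z + 3 * \<delta> * pdir d \<eta> z))"
        unfolding \<phi>_def[abs_def]
        by (intro pderiv_along_add pderiv_along_compose pderiv_along_mult pderiv_along_const thr_DERIV \<delta> smooth_pderiv_along sW s\<eta> that)
      then show ?thesis by (simp add: pderiv_along_pdir)
    qed
    have bdry: "\<phi> z = \<psi> z" if z: "z \<in> par_boundary \<Omega> T" for z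
    proof -
      have zc: "z \<notin> cyl \<Omega> T" using cyl_par_boundary_disjoint[OF open_\<Omega>] z by blast
      have "z \<in> closure (cyl \<Omega> T)" using par_boundary_subset_closure[OF T_pos] z by blast
      from cW[OF this] have "\<bar>W z\<bar> \<le> \<delta>" using w_bdry[OF z] \<delta> by simp
      then show ?thesis using \<eta>out[OF zc] \<psi>out[OF zc] thr_eq_0[OF \<delta>(1)] by (simp add: \<phi>_def)
    qed
    have obst: "\<phi> z \<ge> \<psi> z" if z: "z \<in> cyl \<Omega> T" for z
    proof -
      have c: "\<bar>W z - w z\<bar> \<le> \<delta>/2" using cW closure_subset z by blast
      show ?thesis
      proof (cases "\<psi> z = 0")
        case True
        then have "W z \<ge> - \<delta>" using c \<psi>(2)[OF z] \<delta> by linarith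
        then show ?thesis using thr_nonneg[OF \<delta>(1)] \<eta>(2)[of z] \<delta> True by (simp add: \<phi>_def)
      next
        case False
        then have "3 * \<delta> * \<eta> z \<ge> 3 * \<delta>" using \<eta>(3)[of z] \<delta> by simp
        then show ?thesis using thr_close[OF \<delta>(1), of "W z"] c \<psi>(2)[OF z] \<delta> unfolding \<phi>_def by linarith
      qed
    qed
    define h where "h s = thr' \<delta> s * (thr \<delta> s - s)" for s
    have "continuous_on UNIV h" unfolding h_def[abs_def]
      by (intro continuous_on_mult continuous_on_diff thr'_continuous smooth_continuous[OF smooth_thr] continuous_on_id)
    moreover have "\<bar>h s\<bar> \<le> 8 * \<delta>" for s
    proof -
      have "\<bar>h s\<bar> \<le> 4 * (2 * \<delta>)" unfolding h_def abs_mult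
        by (intro mult_mono) (use thr'_nonneg[of \<delta> s] thr'_le_4[of \<delta> s] thr_close[OF \<delta>(1), of s] in auto)
      then show ?thesis by simp
    qed
    ultimately obtain H where H: "\<And>s. \<bar>s\<bar> \<le> M \<Longrightarrow> (H has_real_derivative h s) (at s)"
      "\<And>s. \<bar>s\<bar> \<le> M \<Longrightarrow> \<bar>H s\<bar> \<le> 8 * \<delta> * M"
      using bounded_antiderivative[of h "8 * \<delta>" M] M_nonneg by metis
    let ?t = "(0, 1) :: 'a \<times> real"
    define Q where "Q z = H (W z) + (3 * \<delta>) * (\<eta> z * thr \<delta> (W z))" for z
    define Q' where "Q' z = h (W z) * pdir ?t W z
      + (3 * \<delta>) * (pdir ?t \<eta> z * thr \<delta> (W z) + \<eta> z * (thr' \<delta> (W z) * pdir ?t W z))" for z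
    have QQ: "pderiv_along ?t Q Q'"
    proof -
      have 1: "pderiv_along ?t (\<lambda>z. H (W z)) (\<lambda>z. h (W z) * pdir ?t W z)"
        unfolding pderiv_along_def
      proof
        fix z
        have "(H has_real_derivative h (W z)) (at (W (z + 0 *\<^sub>R ?t)))"
          using H(1)[OF WM[of z]] by (simp only: scaleR_zero_left add_0_right)
        from DERIV_chain2[OF this pderiv_alongD[OF smooth_pderiv_along[OF sW tB]]]
        show "((\<lambda>s. H (W (z + s *\<^sub>R ?t))) has_real_derivative h (W z) * pdir ?t W z) (at 0)" .
      qed
      have 2: "pderiv_along ?t (\<lambda>z. (3 * \<delta>) * (\<eta> z * thr \<delta> (W z)))
         (\<lambda>z. 0 * (\<eta> z * thr \<delta> (W z)) + (3 * \<delta>) * (pdir ?t \<eta> z * thr \<delta> (W z) + \<eta> z * (thr' \<delta> (W z) * pdir ?t W z)))"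
        by (intro pderiv_along_compose pderiv_along_mult pderiv_along_const thr_DERIV \<delta> smooth_pderiv_along sW s\<eta> tB)
      from pderiv_along_add[OF 1 2] show ?thesis
        unfolding Q_def[abs_def] Q'_def[abs_def] by (simp only: mult_zero_left add_0_left)
    qed
    have cQ': "continuous_on UNIV Q'" unfolding Q'_def[abs_def]
      by (intro continuous_on_add continuous_on_mult continuous_on_const smooth_continuous sW s\<eta> smooth_pdir tB
          continuous_on_compose2[OF thr'_continuous[of UNIV \<delta>] smooth_continuous[OF sW]]
          continuous_on_compose2[OF \<open>continuous_on UNIV h\<close> smooth_continuous[OF sW]]
          continuous_on_compose2[OF smooth_continuous[OF smooth_thr, of UNIV \<delta>] smooth_continuous[OF sW]] subset_UNIV)
    have bQ: "\<bar>Q z\<bar> \<le> (8 * M + 3 * N * M) * \<delta>" for z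
    proof -
      have "\<bar>\<eta> z * thr \<delta> (W z)\<bar> \<le> N * M" unfolding abs_mult
        using N\<eta>[of z] thr_abs_le[of \<delta> "W z"] WM[of z] N0 by (intro mult_mono) auto
      then have "3 * \<delta> * \<bar>\<eta> z * thr \<delta> (W z)\<bar> \<le> 3 * \<delta> * (N * M)" using \<delta> by (intro mult_left_mono) auto
      then have "\<bar>(3 * \<delta>) * (\<eta> z * thr \<delta> (W z))\<bar> \<le> 3 * \<delta> * (N * M)" using \<delta> by (simp add: abs_mult)
      then show ?thesis unfolding Q_def using H(2)[OF WM[of z]] by (simp add: algebra_simps)
    qed
    have Q'int: "(\<integral>z. indicator (cyl \<Omega> T) z * Q' z \<partial>lborel) \<le> 2 * ((8 * M + 3 * N * M) * \<delta>) * measure lborel \<Omega>"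
      using time_derivative_integral_bound[OF open_\<Omega> bounded_\<Omega> T_pos QQ cQ' bQ] by linarith
    have pw: "(\<phi> z - w z) * dt \<phi> z \<le> Q' z + C1 * \<delta>" if z: "z \<in> cyl \<Omega> T" for z
    proof -
      define G where "G = thr \<delta> (W z)"
      define G' where "G' = thr' \<delta> (W z)"
      define Wt' where "Wt' = pdir ?t W z"
      define \<eta>t where "\<eta>t = pdir ?t \<eta> z"
      have zT: "snd z < T" and wzz: "wz z = w z" using z by (auto simp: cyl_def wz_def)
      have wM: "\<bar>w z\<bar> \<le> M" using wz_bound[of z] wzz by simp
      have GM: "\<bar>G\<bar> \<le> M" using thr_abs_le[of \<delta> "W z"] WM[of z] by (simp add: G_def)
      have G'0: "G' \<ge> 0" "G' \<le> 4" by (auto simp: G'_def thr'_nonneg thr'_le_4)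
      have \<eta>tN: "\<bar>\<eta>t\<bar> \<le> N" using Nt[OF z] by (simp add: \<eta>t_def)
      have dt: "dt \<phi> z = G' * Wt' + 3 * \<delta> * \<eta>t" using d\<phi>[OF tB, of z] by (simp add: dt_def G'_def Wt'_def \<eta>t_def)
      have Wte: "Wt' = (f z - W z) / \<epsilon>" using Wt by (simp add: Wt'_def)
      have id: "(\<phi> z - w z) * dt \<phi> z = Q' z + (- (3 * \<delta>) * (\<eta>t * G)) + G' * Wt' * (W z - f z)
          + G' * (Wt' * (f z - w z)) + 3 * \<delta> * (\<eta>t * (\<phi> z - w z))"
        unfolding dt unfolding Q'_def h_def \<phi>_def G_def[symmetric] G'_def[symmetric] Wt'_def[symmetric] \<eta>t_def[symmetric]
        by (simp add: algebra_simps)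
      have b1: "- (3 * \<delta>) * (\<eta>t * G) \<le> 3 * \<delta> * (N * M)"
      proof -
        have "\<bar>\<eta>t * G\<bar> \<le> N * M" unfolding abs_mult using \<eta>tN GM N0 by (intro mult_mono) auto
        then have "3 * \<delta> * (- (\<eta>t * G)) \<le> 3 * \<delta> * (N * M)" using \<delta> by (intro mult_left_mono) auto
        then show ?thesis by simp
      qed
      have b2: "G' * Wt' * (W z - f z) \<le> 0"
      proof -
        have "G' * Wt' * (W z - f z) = - (G' * ((f z - W z)\<^sup>2 / \<epsilon>))" using \<epsilon> by (simp add: Wte power2_eq_square field_simps)
        then show ?thesis using G'0 \<epsilon> by simp
      qed
      have b3: "G' * (Wt' * (f z - w z)) \<le> 8 * M * \<delta>"
      proof -
        have a: "\<bar>f z - W z\<bar> \<le> 2 * M" using fM[of z] WM[of z] by linarith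
        have b: "\<bar>f z - w z\<bar> \<le> \<epsilon> * \<delta>" using fw[OF zT] wzz by simp
        have "\<bar>f z - W z\<bar> * \<bar>f z - w z\<bar> \<le> 2 * M * (\<epsilon> * \<delta>)" using a b M_nonneg by (intro mult_mono) auto
        then have "\<bar>Wt' * (f z - w z)\<bar> \<le> 2 * M * \<delta>" using \<epsilon>
          by (simp only: Wte abs_mult abs_divide abs_of_pos times_divide_eq_left pos_divide_le_eq) (simp add: mult_ac)
        moreover have "\<bar>G' * (Wt' * (f z - w z))\<bar> \<le> 4 * \<bar>Wt' * (f z - w z)\<bar>"
          unfolding abs_mult[of G'] using G'0 by (intro mult_right_mono) auto
        ultimately show ?thesis by linarith
      qed
      have b4: "3 * \<delta> * (\<eta>t * (\<phi> z - w z)) \<le> 3 * \<delta> * (N * (2 * M + 3 * N))"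
      proof -
        have "3 * \<delta> * \<eta> z \<le> 3 * N" using \<delta> N\<eta>[of z] \<eta>(2)[of z] mult_mono[of \<delta> 1 "\<eta> z" N] by simp
        then have "\<bar>\<phi> z - w z\<bar> \<le> 2 * M + 3 * N"
          using GM wM \<delta> mult_nonneg_nonneg[of "3 * \<delta>" "\<eta> z"] \<eta>(2)[of z] unfolding \<phi>_def G_def[symmetric] by linarith
        then have "\<bar>\<eta>t * (\<phi> z - w z)\<bar> \<le> N * (2 * M + 3 * N)" unfolding abs_mult using \<eta>tN N0 by (intro mult_mono) auto
        then show ?thesis using \<delta> by (intro mult_left_mono) auto
      qed
      show ?thesis unfolding id using b1 b2 b3 b4 by (simp add: C1_def algebra_simps)
    qed
    have int1: "integrable lborel (\<lambda>z. indicator (cyl \<Omega> T) z * Q' z)"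
      by (rule continuous_integrable_bounded_set[OF cQ' bounded_cyl cyl_borel])
    have int2: "integrable lborel (\<lambda>z. C1 * \<delta> * indicator (cyl \<Omega> T) z)"
      using indicator_cyl_integrable by (intro integrable_mult_right)
    note int3 = time_term_integrable[OF s\<phi>]
    have "(\<integral>z. indicator (cyl \<Omega> T) z * ((\<phi> z - w z) * dt \<phi> z) \<partial>lborel)
        \<le> (\<integral>z. indicator (cyl \<Omega> T) z * Q' z + C1 * \<delta> * indicator (cyl \<Omega> T) z \<partial>lborel)"
    proof (rule integral_mono[OF int3 Bochner_Integration.integrable_add[OF int1 int2]])
      fix z show "indicator (cyl \<Omega> T) z * ((\<phi> z - w z) * dt \<phi> z) \<le> indicator (cyl \<Omega> T) z * Q' z + C1 * \<delta> * indicator (cyl \<Omega> T) z"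
        using pw[of z] by (cases "z \<in> cyl \<Omega> T") auto
    qed
    also have "\<dots> = (\<integral>z. indicator (cyl \<Omega> T) z * Q' z \<partial>lborel) + C1 * \<delta> * measure lborel (cyl \<Omega> T)"
      using int1 int2 by simp
    also have "\<dots> \<le> C * \<delta>" using Q'int by (simp add: C_def algebra_simps)
    finally have time: "(\<integral>z. indicator (cyl \<Omega> T) z * ((\<phi> z - w z) * dt \<phi> z) \<partial>lborel) \<le> C * \<delta>" .
    have gradient: "pdir (i, 0) \<phi> z = thr' \<delta> (W z) * conv (kprod \<rho> \<kappa>) (\<lambda>y. g y \<bullet> i) z + 3 * \<delta> * pdir (i, 0) \<eta> z"
      if "z \<in> cyl \<Omega> T" "i \<in> Basis" for z i
    proof -
      have "snd z < T" using that by (auto simp: cyl_def)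
      moreover have "(i, 0) \<in> (Basis :: ('a \<times> real) set)" using that by (simp add: Basis_prod_def)
      ultimately show ?thesis using d\<phi>[of "(i, 0)" z] grad[of z i] that by simp
    qed
    show "\<exists>\<phi> \<rho> \<kappa>. approximant \<psi> \<eta> C \<delta> \<phi> \<rho> \<kappa>"
      unfolding approximant_def competitor_def
    proof (intro exI[of _ \<phi>] exI[of _ \<rho>] exI[of _ \<kappa>] exI[of _ B] conjI ballI allI)
      fix z assume z: "z \<in> cyl \<Omega> T"
      have "z \<in> closure (cyl \<Omega> T)" using z closure_subset by blast
      from cW[OF this] show "\<bar>conv (kprod \<rho> \<kappa>) wz z - w z\<bar> \<le> \<delta> / 2" unfolding W_def .
      fix i :: 'a assume "i \<in> Basis"
      from gradient[OF z this] show "pdir (i, 0) \<phi> z =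
           thr' \<delta> (conv (kprod \<rho> \<kappa>) wz z) * conv (kprod \<rho> \<kappa>) (\<lambda>y. g y \<bullet> i) z + 3 * \<delta> * pdir (i, 0) \<eta> z"
        unfolding W_def .
    qed (rule s\<phi> bdry obst k time; assumption?)+
  qed
qed

end

lemma test_function_above:
  fixes U :: "'b::euclidean_space set"
  assumes "open U" "compact K" "K \<subseteq> U"
  shows "\<exists>\<eta>. test_fun U \<eta> \<and> (\<forall>z. \<eta> z \<ge> 0) \<and> (\<forall>z\<in>K. \<eta> z \<ge> 1)"
proof -
  have "\<forall>x\<in>U. \<exists>e>0. cball x e \<subseteq> U" using assms(1) open_contains_cball by blast
  then obtain e where e: "\<And>x. x \<in> U \<Longrightarrow> e x > 0 \<and> cball x (e x) \<subseteq> U" by metis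
  have "\<exists>X. X \<subseteq> K \<and> finite X \<and> K \<subseteq> (\<Union>x\<in>X. ball x (e x))"
  proof (rule compactE_image[OF assms(2), of K "\<lambda>x. ball x (e x)"])
    show "K \<subseteq> (\<Union>x\<in>K. ball x (e x))" using e assms(3) by force
  qed auto
  then obtain X where X: "X \<subseteq> K" "finite X" "K \<subseteq> (\<Union>x\<in>X. ball x (e x))" by blast
  define f where "f z = (\<Sum>x\<in>X. bmp 0 ((e x)\<^sup>2 - (z - x) \<bullet> (z - x)))" for z
  have s: "smooth f" unfolding f_def[abs_def]
    by (intro smooth_sum smooth_compose[OF smooth_bmp] smooth_diff smooth_const smooth_inner_self bounded_linear_ident)
  have f0: "f z \<ge> 0" for z unfolding f_def by (intro sum_nonneg bmp_nonneg)
  have fp: "f z > 0" if zK: "z \<in> K" for z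
  proof -
    obtain x where x: "x \<in> X" "z \<in> ball x (e x)" using X zK by blast
    have ex: "e x > 0" using e x X assms by blast
    have "norm (z - x) < e x" using x by (simp add: dist_norm norm_minus_commute)
    then have "(norm (z - x))\<^sup>2 < (e x)\<^sup>2" by (intro power_strict_mono) auto
    then have "bmp 0 ((e x)\<^sup>2 - (z - x) \<bullet> (z - x)) > 0" by (intro bmp_pos) (simp add: dot_square_norm)
    then show ?thesis unfolding f_def using X x by (intro sum_pos2[of X x]) (auto simp: bmp_nonneg)
  qed
  obtain c where c: "c > 0" "\<And>z. z \<in> K \<Longrightarrow> f z \<ge> c"
  proof (cases "K = {}")
    case False
    obtain z where "z \<in> K" "\<forall>y\<in>K. f z \<le> f y"
      using continuous_attains_inf[OF assms(2) False smooth_continuous[OF s]] by blast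
    then show ?thesis using that[of "f z"] fp by blast
  qed (use that[of 1] in auto)
  define C where "C = (\<Union>x\<in>X. cball x (e x))"
  have C: "compact C" "C \<subseteq> U" using X e assms unfolding C_def by (auto intro!: compact_UN)
  have sub: "{z. f z * (1/c) \<noteq> 0} \<subseteq> C"
  proof
    fix z assume "z \<in> {z. f z * (1/c) \<noteq> 0}"
    then have "f z \<noteq> 0" by auto
    then obtain x where x: "x \<in> X" "bmp 0 ((e x)\<^sup>2 - (z - x) \<bullet> (z - x)) \<noteq> 0"
      unfolding f_def by (meson sum.not_neutral_contains_not_neutral)
    have "(norm (z - x))\<^sup>2 < (e x)\<^sup>2" using x(2) bmp_nonpos[of "(e x)\<^sup>2 - (z - x) \<bullet> (z - x)" 0]
      by (auto simp: dot_square_norm not_le[symmetric])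
    moreover have "e x > 0" using e x X assms by blast
    ultimately have "norm (z - x) \<le> e x" by (meson less_imp_le power2_less_imp_less)
    then show "z \<in> C" unfolding C_def using x(1) by (auto simp: dist_norm norm_minus_commute)
  qed
  have cl: "closure {z. f z * (1/c) \<noteq> 0} \<subseteq> C" using sub C(1) closure_minimal compact_imp_closed by blast
  show ?thesis
  proof (intro exI[of _ "\<lambda>z. f z * (1/c)"] conjI allI ballI)
    have "compact (closure {z. f z * (1/c) \<noteq> 0})"
      by (rule compact_closure_subset[OF C(1) cl])
    then show "test_fun U (\<lambda>z. f z * (1/c))"
      unfolding test_fun_def using cl C(2) by (intro conjI smooth_mult s smooth_const) auto
    show "f z * (1/c) \<ge> 0" for z using f0[of z] c by simp
    show "f z * (1/c) \<ge> 1" if "z \<in> K" for z using c that by simp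
  qed
qed

section \<open>Borel representatives of weak gradients\<close>

lemma lebesgue_on_eq_lborel:
  fixes f F :: "'b::euclidean_space \<Rightarrow> real"
  assumes S: "S \<in> sets borel" and f: "f \<in> borel_measurable (lebesgue_on S)"
    and F: "F \<in> borel_measurable borel" "\<And>z. z \<notin> S \<Longrightarrow> F z = 0"
    and eq: "AE z in lborel. z \<in> S \<longrightarrow> f z = F z"
  shows "(\<integral>z. f z \<partial>lebesgue_on S) = (\<integral>z. F z \<partial>lborel)"
    and "integrable (lebesgue_on S) f \<longleftrightarrow> integrable lborel F"
proof -
  have SL: "S \<inter> space lebesgue \<in> sets lebesgue" using S by auto
  have ae: "AE z in lebesgue. indicator S z *\<^sub>R f z = F z"
    using AE_completion[OF eq] by eventually_elim (use F(2) in \<open>auto simp: indicator_def\<close>)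
  have m1: "(\<lambda>z. indicator S z *\<^sub>R f z) \<in> borel_measurable lebesgue"
    using f borel_measurable_restrict_space_iff[OF SL, of f] by blast
  have m2: "F \<in> borel_measurable lebesgue" using F(1) by (simp add: measurable_completion)
  show "(\<integral>z. f z \<partial>lebesgue_on S) = (\<integral>z. F z \<partial>lborel)"
    using integral_restrict_space[OF SL, of f] integral_cong_AE[OF m1 m2 ae] integral_completion[of F lborel] F(1) by simp
  show "integrable (lebesgue_on S) f \<longleftrightarrow> integrable lborel F"
    using integrable_restrict_space[OF SL, of f] integrable_cong_AE[OF m1 m2 ae] integrable_completion[of F lborel] F(1) by simp
qed

lemma borel_representative:
  fixes g :: "'b::euclidean_space \<Rightarrow> 'c::euclidean_space"
  assumes S: "S \<in> sets borel" and g: "g \<in> borel_measurable (lebesgue_on S)"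
  obtains g' where "g' \<in> borel_measurable borel" "\<And>z. z \<notin> S \<Longrightarrow> g' z = 0" "AE z in lborel. z \<in> S \<longrightarrow> g z = g' z"
proof -
  have SL: "S \<inter> space lebesgue \<in> sets lebesgue" using S by auto
  have "\<exists>f. f \<in> borel_measurable lborel \<and> (AE z in lborel. indicator S z *\<^sub>R (g z \<bullet> i) = f z)" for i
  proof -
    have "(\<lambda>z. g z \<bullet> i) \<in> borel_measurable (lebesgue_on S)" using g by simp
    then have "(\<lambda>z. indicator S z *\<^sub>R (g z \<bullet> i)) \<in> borel_measurable lebesgue"
      using borel_measurable_restrict_space_iff[OF SL, of "\<lambda>z. g z \<bullet> i"] by blast
    then show ?thesis using completion_ex_borel_measurable_real by blast
  qed
  then obtain f where f: "\<And>i. f i \<in> borel_measurable lborel" "\<And>i. AE z in lborel. indicator S z *\<^sub>R (g z \<bullet> i) = f i z" by metis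
  have [measurable]: "f i \<in> borel_measurable borel" for i using f by simp
  have [measurable]: "S \<in> sets borel" by fact
  show ?thesis
  proof (rule that[of "\<lambda>z. indicator S z *\<^sub>R (\<Sum>i\<in>Basis. f i z *\<^sub>R i)"])
    show "(\<lambda>z. indicator S z *\<^sub>R (\<Sum>i\<in>Basis. f i z *\<^sub>R i)) \<in> borel_measurable borel" by measurable
    have "AE z in lborel. \<forall>i\<in>Basis. indicator S z *\<^sub>R (g z \<bullet> i) = f i z"
      by (rule AE_finite_allI) (use f in auto)
    then show "AE z in lborel. z \<in> S \<longrightarrow> g z = indicator S z *\<^sub>R (\<Sum>i\<in>Basis. f i z *\<^sub>R i)"
    proof eventually_elim
      case (elim z)
      show ?case
      proof
        assume z: "z \<in> S"
        then have "(\<Sum>i\<in>Basis. f i z *\<^sub>R i) = (\<Sum>i\<in>Basis. (g z \<bullet> i) *\<^sub>R i)"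
          using elim by (intro sum.cong) auto
        then show "g z = indicator S z *\<^sub>R (\<Sum>i\<in>Basis. f i z *\<^sub>R i)" using z by (simp add: euclidean_representation)
      qed
    qed
  qed auto
qed

lemma le_one_plus_powr:
  assumes "(x::real) \<ge> 0" "1 \<le> q" "q \<le> p" shows "x powr q \<le> 1 + x powr p"
proof (cases "x \<le> 1")
  case True
  then have "x powr q \<le> 1" using assms powr_mono2[of q x 1] by simp
  then show ?thesis using powr_ge_zero[of x p] by linarith
next
  case False
  then have "x powr q \<le> x powr p" using assms by (intro powr_mono) auto
  then show ?thesis by linarith
qed

lemma integrable_lower_powr:
  fixes f :: "'b::euclidean_space \<Rightarrow> 'c::euclidean_space"
  assumes f: "f \<in> borel_measurable borel" "\<And>z. z \<notin> S \<Longrightarrow> f z = 0" "integrable lborel (\<lambda>z. norm (f z) powr p)"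
    and S: "bounded S" "S \<in> sets borel" and q: "1 \<le> q" "q \<le> p"
  shows "integrable lborel (\<lambda>z. norm (f z) powr q)"
proof (rule Bochner_Integration.integrable_bound[of lborel "\<lambda>z. indicator S z + norm (f z) powr p"])
  have "integrable lborel (indicator S :: 'b \<Rightarrow> real)"
    using emeasure_bounded_finite[OF S(1)] S by (intro integrable_real_indicator) auto
  then show "integrable lborel (\<lambda>z. indicator S z + norm (f z) powr p)" using f by simp
  show "(\<lambda>z. norm (f z) powr q) \<in> borel_measurable lborel" using f by simp
  show "AE z in lborel. norm (norm (f z) powr q) \<le> norm (indicator S z + norm (f z) powr p)"
  proof (rule AE_I2)
    fix z show "norm (norm (f z) powr q) \<le> norm (indicator S z + norm (f z) powr p)"
      using le_one_plus_powr[of "norm (f z)" q p] q f(2)[of z] by (cases "z \<in> S") auto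
  qed
qed

lemma test_fun_pdir_outside:
  assumes "test_fun U \<eta>" "d \<in> Basis" "z \<notin> U"
  shows "pdir d \<eta> z = 0"
proof -
  have "smooth \<eta>" "closure {z. \<eta> z \<noteq> 0} \<subseteq> U" using assms by (auto simp: test_fun_def)
  then show ?thesis
    using pderiv_vanish[OF smooth_pderiv_along[OF _ assms(2)], of \<eta> "- closure {z. \<eta> z \<noteq> 0}" z] assms(3) closure_subset[of "{z. \<eta> z \<noteq> 0}"]
    by blast
qed

lemma weak_cyl_combine:
  assumes "weak_cyl \<Omega> T u gu" "weak_cyl \<Omega> T v gv"
  shows "weak_cyl \<Omega> T (\<lambda>z. a * u z + b * v z) (\<lambda>z. a *\<^sub>R gu z + b *\<^sub>R gv z)"
proof -
  interpret U: weak_cyl \<Omega> T u gu by fact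
  interpret V: weak_cyl \<Omega> T v gv by fact
  obtain R where R: "cyl \<Omega> T \<subseteq> cball 0 R" using U.cyl_ball .
  show ?thesis
  proof
    fix \<eta> and i :: 'a assume \<eta>: "test_fun (cyl \<Omega> T) \<eta>" and i: "i \<in> Basis"
    have iB: "(i, 0) \<in> (Basis :: ('a \<times> real) set)" using i by (simp add: Basis_prod_def)
    have s: "smooth \<eta>" using \<eta> by (simp add: test_fun_def)
    have c: "continuous_on UNIV \<eta>" "continuous_on UNIV (pdir (i, 0) \<eta>)"
      using s iB by (simp_all add: smooth_continuous smooth_pdir)
    have uw: "integrable lborel (\<lambda>z. U.wz z * pdir (i, 0) \<eta> z)" "integrable lborel (\<lambda>z. V.wz z * pdir (i, 0) \<eta> z)"
      by (rule integrable_mult_continuous[OF U.wz_integrable _ c(2), of R], use R U.wz_outside in blast,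
          rule integrable_mult_continuous[OF V.wz_integrable _ c(2), of R], use R V.wz_outside in blast)
    have gw: "integrable lborel (\<lambda>z. (gu z \<bullet> i) * \<eta> z)" "integrable lborel (\<lambda>z. (gv z \<bullet> i) * \<eta> z)"
      by (rule integrable_mult_continuous[OF U.g_int[OF i] _ c(1), of R], use R U.g_zero in force,
          rule integrable_mult_continuous[OF V.g_int[OF i] _ c(1), of R], use R V.g_zero in force)
    have "(\<integral>z. (indicator (cyl \<Omega> T) z * (a * u z + b * v z)) * pdir (i, 0) \<eta> z \<partial>lborel)
      = (\<integral>z. a * (U.wz z * pdir (i, 0) \<eta> z) + b * (V.wz z * pdir (i, 0) \<eta> z) \<partial>lborel)"
      by (intro Bochner_Integration.integral_cong refl) (simp add: U.wz_def V.wz_def algebra_simps)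
    also have "\<dots> = a * (\<integral>z. U.wz z * pdir (i, 0) \<eta> z \<partial>lborel) + b * (\<integral>z. V.wz z * pdir (i, 0) \<eta> z \<partial>lborel)"
      using uw by simp
    also have "\<dots> = - (a * (\<integral>z. (gu z \<bullet> i) * \<eta> z \<partial>lborel) + b * (\<integral>z. (gv z \<bullet> i) * \<eta> z \<partial>lborel))"
      using U.weak[OF \<eta> i] V.weak[OF \<eta> i] by (simp add: U.wz_def V.wz_def)
    also have "\<dots> = - (\<integral>z. a * ((gu z \<bullet> i) * \<eta> z) + b * ((gv z \<bullet> i) * \<eta> z) \<partial>lborel)"
      using gw by simp
    also have "(\<integral>z. a * ((gu z \<bullet> i) * \<eta> z) + b * ((gv z \<bullet> i) * \<eta> z) \<partial>lborel) = (\<integral>z. ((a *\<^sub>R gu z + b *\<^sub>R gv z) \<bullet> i) * \<eta> z \<partial>lborel)"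
      by (intro Bochner_Integration.integral_cong refl) (simp add: inner_add_left algebra_simps)
    finally show "(\<integral>z. (indicator (cyl \<Omega> T) z * (a * u z + b * v z)) * pdir (i, 0) \<eta> z \<partial>lborel)
      = - (\<integral>z. ((a *\<^sub>R gu z + b *\<^sub>R gv z) \<bullet> i) * \<eta> z \<partial>lborel)" .
  next
    show "continuous_on (closure (cyl \<Omega> T)) (\<lambda>z. a * u z + b * v z)"
      by (intro continuous_intros U.w_cont V.w_cont)
    show "integrable lborel (\<lambda>z. (a *\<^sub>R gu z + b *\<^sub>R gv z) \<bullet> i)" if "i \<in> Basis" for i
      using U.g_int[OF that] V.g_int[OF that] by (simp add: inner_add_left)
  qed (simp_all add: U.open_\<Omega> U.bounded_\<Omega> U.T_pos U.w_bdry V.w_bdry U.g_zero V.g_zero)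
qed

lemma sgrad_inner: "i \<in> Basis \<Longrightarrow> sgrad f z \<bullet> i = pdir (i, 0) f z"
  by (simp add: sgrad_def)

lemma sgrad_continuous:
  assumes "smooth f" shows "continuous_on S (sgrad f)"
  unfolding sgrad_def[abs_def]
  by (intro continuous_on_sum continuous_on_scaleR continuous_on_const smooth_continuous smooth_pdir assms)
    (simp add: Basis_prod_def)

lemma Lp_on_continuous:
  fixes f :: "'b::euclidean_space \<Rightarrow> 'c::euclidean_space"
  assumes f: "continuous_on UNIV f" and S: "bounded S" "S \<in> sets borel" and r: "r > 0"
  shows "Lp_on r S f"
proof -
  have SL: "S \<in> sets lebesgue" using S by auto
  have m: "f \<in> borel_measurable (lebesgue_on S)"
    by (rule continuous_imp_measurable_on_sets_lebesgue[OF continuous_on_subset[OF f] SL]) simp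
  have "compact (f ` closure S)"
    by (rule compact_continuous_image[OF continuous_on_subset[OF f]]) (use S in \<open>simp_all add: compact_closure\<close>)
  then have "bounded (f ` S)"
    by (rule bounded_subset[OF compact_imp_bounded]) (intro image_mono closure_subset)
  then obtain B where B: "\<And>z. z \<in> S \<Longrightarrow> norm (f z) \<le> B" unfolding bounded_iff by auto
  interpret finite_measure "lebesgue_on S"
    by (rule finite_measure_lebesgue_on[OF bounded_set_imp_lmeasurable[OF S(1) SL]])
  have "integrable (lebesgue_on S) (\<lambda>z. norm (f z) powr r)"
  proof (rule integrable_const_bound[of _ "B powr r"])
    show "AE z in lebesgue_on S. norm (norm (f z) powr r) \<le> B powr r"
      using B r by (intro AE_I2) (auto simp: space_restrict_space intro!: powr_mono2)
  qed (use m in simp)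
  then show ?thesis using m unfolding Lp_on_def by blast
qed

lemma smooth_weak_sgrad:
  fixes \<phi> :: "'a::euclidean_space \<times> real \<Rightarrow> real"
  assumes \<phi>: "smooth \<phi>" and U: "open U" "bounded U"
  shows "weak_sgrad U \<phi> (sgrad \<phi>)"
  unfolding weak_sgrad_def
proof (intro allI impI, elim conjE)
  fix \<eta> :: "'a \<times> real \<Rightarrow> real" and i :: 'a assume \<eta>: "test_fun U \<eta>" and i: "i \<in> Basis"
  have iB: "(i, 0) \<in> (Basis :: ('a \<times> real) set)" using i by (simp add: Basis_prod_def)
  have s: "smooth \<eta>" using \<eta> by (simp add: test_fun_def)
  have UB: "U \<in> sets borel" using U by auto
  obtain R where R: "U \<subseteq> cball 0 R" using U(2) by (auto simp: bounded_iff subset_eq)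
  have out: "\<eta> z = 0" if "z \<notin> U" for z
    using \<eta> that closure_subset[of "{z. \<eta> z \<noteq> 0}"] unfolding test_fun_def by blast
  have c: "continuous_on UNIV (\<lambda>z. \<phi> z * pdir (i, 0) \<eta> z)" "continuous_on UNIV (\<lambda>z. pdir (i, 0) \<phi> z * \<eta> z)"
    by (intro continuous_on_mult smooth_continuous \<phi> s smooth_pdir iB)+
  have m: "f \<in> borel_measurable (lebesgue_on U)" if "continuous_on UNIV f" for f :: "'a \<times> real \<Rightarrow> real"
    by (rule continuous_imp_measurable_on_sets_lebesgue[OF continuous_on_subset[OF that]]) (use UB in auto)
  have "(\<integral>z. \<phi> z * pdir (i, 0) \<eta> z \<partial>lebesgue_on U) = (\<integral>z. \<phi> z * pdir (i, 0) \<eta> z \<partial>lborel)"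
    by (rule lebesgue_on_eq_lborel(1)[OF UB m[OF c(1)] borel_measurable_continuous_onI[OF c(1)]])
      (use test_fun_pdir_outside[OF \<eta> iB] in auto)
  also have "\<dots> = - (\<integral>z. pdir (i, 0) \<phi> z * \<eta> z \<partial>lborel)"
    by (rule integration_by_parts_smooth[OF \<phi> s iB, of R]) (use R out in blast)
  also have "(\<integral>z. pdir (i, 0) \<phi> z * \<eta> z \<partial>lborel) = (\<integral>z. pdir (i, 0) \<phi> z * \<eta> z \<partial>lebesgue_on U)"
    by (rule lebesgue_on_eq_lborel(1)[OF UB m[OF c(2)] borel_measurable_continuous_onI[OF c(2)], symmetric])
      (use out in auto)
  finally show "(\<integral>z. \<phi> z * pdir (i, 0) \<eta> z \<partial>lebesgue_on U) = - (\<integral>z. (sgrad \<phi> z \<bullet> i) * \<eta> z \<partial>lebesgue_on U)"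
    using i by (simp add: sgrad_inner)
qed

lemma smooth_F_class:
  assumes "smooth \<phi>" "open \<Omega>" "bounded \<Omega>" "p > 0"
    "\<And>z. z \<in> par_boundary \<Omega> T \<Longrightarrow> \<phi> z = \<psi> z" "\<And>z. z \<in> cyl \<Omega> T \<Longrightarrow> \<phi> z \<ge> \<psi> z"
  shows "F_class p \<Omega> T \<psi> \<phi>"
proof -
  have c: "open (cyl \<Omega> T)" "bounded (cyl \<Omega> T)" "cyl \<Omega> T \<in> sets borel"
    using cyl_sets[of \<Omega> T] assms(2,3) by (auto intro: borel_open)
  have "par_sobolev p \<Omega> T \<phi> (sgrad \<phi>)"
    unfolding par_sobolev_def
    by (intro conjI Lp_on_continuous smooth_continuous sgrad_continuous smooth_weak_sgrad assms c)
  then show ?thesis unfolding F_class_def using assms smooth_continuous by blast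
qed

definition pflux :: "real \<Rightarrow> 'a::euclidean_space \<Rightarrow> 'a" where
  "pflux p a = norm a powr (p - 2) *\<^sub>R a"

definition solution_gradient ::
  "real \<Rightarrow> 'a::euclidean_space set \<Rightarrow> real \<Rightarrow> ('a \<times> real \<Rightarrow> real) \<Rightarrow> ('a \<times> real \<Rightarrow> real) \<Rightarrow> ('a \<times> real \<Rightarrow> 'a) \<Rightarrow> bool" where
  "solution_gradient p \<Omega> T \<psi> u g \<longleftrightarrow> weak_cyl \<Omega> T u g \<and> g \<in> borel_measurable borel
     \<and> integrable lborel (\<lambda>z. norm (g z) powr p)
     \<and> (\<forall>\<phi>. competitor \<Omega> T \<psi> \<phi> \<longrightarrow>
       0 \<le> (\<integral>z. indicator (cyl \<Omega> T) z * (pflux p (g z) \<bullet> (sgrad \<phi> z - g z) + (\<phi> z - u z) * dt \<phi> z) \<partial>lborel))"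

lemma solution_gradient_exists:
  fixes \<Omega> :: "'a::euclidean_space set"
  assumes p: "p > 2" and T: "T > 0" and \<Omega>: "open \<Omega>" "bounded \<Omega>" and \<psi>: "C0_on (cyl \<Omega> T) \<psi>"
    and u: "variational_solution p \<Omega> T \<psi> u"
  shows "\<exists>g. solution_gradient p \<Omega> T \<psi> u g"
proof -
  let ?S = "cyl \<Omega> T"
  have c: "open ?S" "bounded ?S" and SB [measurable]: "?S \<in> sets borel"
    using cyl_sets[of \<Omega> T] \<Omega> by (auto intro: borel_open)
  have tB: "(0, 1) \<in> (Basis :: ('a \<times> real) set)" by (simp add: Basis_prod_def)
  obtain g where g: "par_sobolev p \<Omega> T u g" and var: "\<And>\<phi>. smooth_on ?S \<phi> \<Longrightarrow> F_class p \<Omega> T \<psi> \<phi> \<Longrightarrow> Lp_on (p / (p - 1)) ?S (dt \<phi>)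
           \<Longrightarrow> (\<integral>z. norm (g z) powr (p - 2) * (g z \<bullet> (sgrad \<phi> z - g z))
                    + (\<phi> z - u z) * dt \<phi> z \<partial>lebesgue_on ?S)
               \<ge> 1/2 * (\<integral>x. \<bar>\<phi> (x, T) - u (x, T)\<bar>\<^sup>2 \<partial>lebesgue_on \<Omega>)"
    using u unfolding variational_solution_def by blast
  have uc: "continuous_on (closure ?S) u" "\<And>z. z \<in> par_boundary \<Omega> T \<Longrightarrow> u z = \<psi> z"
    using u unfolding variational_solution_def F_class_def by auto
  have uS: "continuous_on ?S u" using uc(1) closure_subset continuous_on_subset by blast
  have gm: "g \<in> borel_measurable (lebesgue_on ?S)" and gi: "integrable (lebesgue_on ?S) (\<lambda>z. norm (g z) powr p)"
    and wg: "weak_sgrad ?S u g" using g by (auto simp: par_sobolev_def Lp_on_def)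
  obtain g' where g': "g' \<in> borel_measurable borel" "\<And>z. z \<notin> ?S \<Longrightarrow> g' z = 0" "AE z in lborel. z \<in> ?S \<longrightarrow> g z = g' z"
    using borel_representative[OF SB gm] by metis
  note [measurable] = g'(1)
  have gp: "integrable lborel (\<lambda>z. norm (g' z) powr p)"
  proof -
    have "integrable (lebesgue_on ?S) (\<lambda>z. norm (g z) powr p) \<longleftrightarrow> integrable lborel (\<lambda>z. norm (g' z) powr p)"
    proof (rule lebesgue_on_eq_lborel(2)[OF SB])
      show "AE z in lborel. z \<in> ?S \<longrightarrow> norm (g z) powr p = norm (g' z) powr p" using g'(3) by eventually_elim auto
    qed (use gm g' p in auto)
    then show ?thesis using gi by simp
  qed
  have \<psi>0: "\<psi> z = 0" if "z \<in> par_boundary \<Omega> T" for z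
  proof -
    have "z \<notin> ?S" using cyl_par_boundary_disjoint[OF \<Omega>(1)] that by blast
    then show ?thesis using \<psi> closure_subset[of "{z. \<psi> z \<noteq> 0}"] unfolding C0_on_def by blast
  qed
  define uz where "uz z = indicator ?S z * u z" for z
  have um [measurable]: "uz \<in> borel_measurable borel"
  proof -
    have "(\<lambda>z. if z \<in> ?S then u z else 0) \<in> borel_measurable borel"
      by (intro borel_measurable_continuous_on_if uS) auto
    also have "(\<lambda>z. if z \<in> ?S then u z else 0) = uz" by (auto simp: uz_def fun_eq_iff)
    finally show ?thesis .
  qed
  have SL: "?S \<in> sets lebesgue" using SB by auto
  have uL: "u \<in> borel_measurable (lebesgue_on ?S)" by (rule continuous_imp_measurable_on_sets_lebesgue[OF uS SL])
  have cL: "f \<in> borel_measurable (lebesgue_on ?S)" if "continuous_on UNIV f" for f :: "'a \<times> real \<Rightarrow> 'c::euclidean_space"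
    by (rule continuous_imp_measurable_on_sets_lebesgue[OF continuous_on_subset[OF that] SL]) simp
  have wc: "weak_cyl \<Omega> T u g'"
  proof
    show "u z = 0" if "z \<in> par_boundary \<Omega> T" for z using uc(2) \<psi>0 that by simp
    show "integrable lborel (\<lambda>z. g' z \<bullet> i)" if i: "i \<in> Basis" for i
    proof (rule Bochner_Integration.integrable_bound)
      show "integrable lborel (\<lambda>z. norm (g' z) powr 1)"
        by (rule integrable_lower_powr[OF g'(1,2) gp c(2) SB]) (use p in auto)
      show "AE z in lborel. norm (g' z \<bullet> i) \<le> norm (norm (g' z) powr 1)"
        using Basis_le_norm[OF i] by (intro AE_I2) simp
    qed simp
    fix \<eta> and i :: 'a assume \<eta>: "test_fun ?S \<eta>" and i: "i \<in> Basis"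
    have iB: "(i, 0) \<in> (Basis :: ('a \<times> real) set)" using i by (simp add: Basis_prod_def)
    have s: "smooth \<eta>" using \<eta> by (simp add: test_fun_def)
    have c\<eta>: "continuous_on UNIV \<eta>" "continuous_on UNIV (pdir (i, 0) \<eta>)"
      using s iB by (simp_all add: smooth_continuous smooth_pdir)
    note [measurable] = borel_measurable_continuous_onI[OF c\<eta>(1)] borel_measurable_continuous_onI[OF c\<eta>(2)]
    have "(\<integral>z. uz z * pdir (i, 0) \<eta> z \<partial>lborel) = (\<integral>z. u z * pdir (i, 0) \<eta> z \<partial>lebesgue_on ?S)"
    proof (rule lebesgue_on_eq_lborel(1)[OF SB, symmetric])
      show "(\<lambda>z. u z * pdir (i, 0) \<eta> z) \<in> borel_measurable (lebesgue_on ?S)" using uL cL[OF c\<eta>(2)] by simp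
      show "(\<lambda>z. uz z * pdir (i, 0) \<eta> z) \<in> borel_measurable borel" by simp
    qed (auto simp: uz_def)
    also have "\<dots> = - (\<integral>z. (g z \<bullet> i) * \<eta> z \<partial>lebesgue_on ?S)" using wg \<eta> i unfolding weak_sgrad_def by blast
    also have "(\<integral>z. (g z \<bullet> i) * \<eta> z \<partial>lebesgue_on ?S) = (\<integral>z. (g' z \<bullet> i) * \<eta> z \<partial>lborel)"
    proof (rule lebesgue_on_eq_lborel(1)[OF SB])
      show "AE z in lborel. z \<in> ?S \<longrightarrow> (g z \<bullet> i) * \<eta> z = (g' z \<bullet> i) * \<eta> z" using g'(3) by eventually_elim auto
      show "(\<lambda>z. (g z \<bullet> i) * \<eta> z) \<in> borel_measurable (lebesgue_on ?S)" using gm cL[OF c\<eta>(1)] by simp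
    qed (use g' in auto)
    finally show "(\<integral>z. (indicator ?S z * u z) * pdir (i, 0) \<eta> z \<partial>lborel) = - (\<integral>z. (g' z \<bullet> i) * \<eta> z \<partial>lborel)"
      by (simp add: uz_def)
  qed (use \<Omega> T uc g' in auto)
  show ?thesis
    unfolding solution_gradient_def
  proof (intro exI[of _ g'] conjI allI impI wc g'(1) gp)
    fix \<phi> assume "competitor \<Omega> T \<psi> \<phi>"
    then have \<phi>: "smooth \<phi>" "\<And>z. z \<in> par_boundary \<Omega> T \<Longrightarrow> \<phi> z = \<psi> z" "\<And>z. z \<in> ?S \<Longrightarrow> \<phi> z \<ge> \<psi> z"
      unfolding competitor_def by blast+
    have c\<phi>: "continuous_on UNIV \<phi>" "continuous_on UNIV (dt \<phi>)" "continuous_on UNIV (sgrad \<phi>)"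
      using \<phi>(1) tB by (simp_all add: smooth_continuous smooth_pdir dt_def sgrad_continuous)
    note [measurable] = borel_measurable_continuous_onI[OF c\<phi>(1)] borel_measurable_continuous_onI[OF c\<phi>(2)]
      borel_measurable_continuous_onI[OF c\<phi>(3)]
    have "smooth_on ?S \<phi>" using \<phi>(1) unfolding smooth_on_def using continuous_on_subset by blast
    moreover have "F_class p \<Omega> T \<psi> \<phi>" by (rule smooth_F_class[OF \<phi>(1) \<Omega> _ \<phi>(2,3)]) (use p in auto)
    moreover have "Lp_on (p / (p - 1)) ?S (dt \<phi>)" by (rule Lp_on_continuous[OF c\<phi>(2) c(2) SB]) (use p in auto)
    ultimately have "1/2 * (\<integral>x. \<bar>\<phi> (x, T) - u (x, T)\<bar>\<^sup>2 \<partial>lebesgue_on \<Omega>) \<le> (\<integral>z. norm (g z) powr (p - 2) * (g z \<bullet> (sgrad \<phi> z - g z))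
                    + (\<phi> z - u z) * dt \<phi> z \<partial>lebesgue_on ?S)" by (rule var)
    moreover have "(\<integral>x. \<bar>\<phi> (x, T) - u (x, T)\<bar>\<^sup>2 \<partial>lebesgue_on \<Omega>) \<ge> 0" by (rule Bochner_Integration.integral_nonneg) auto
    ultimately have "0 \<le> (\<integral>z. norm (g z) powr (p - 2) * (g z \<bullet> (sgrad \<phi> z - g z))
                    + (\<phi> z - u z) * dt \<phi> z \<partial>lebesgue_on ?S)" by linarith
    also have "\<dots> = (\<integral>z. indicator ?S z * (norm (g' z) powr (p - 2) * (g' z \<bullet> (sgrad \<phi> z - g' z)) + (\<phi> z - uz z) * dt \<phi> z) \<partial>lborel)"
    proof (rule lebesgue_on_eq_lborel(1)[OF SB])
      show "AE z in lborel. z \<in> ?S \<longrightarrow> norm (g z) powr (p - 2) * (g z \<bullet> (sgrad \<phi> z - g z)) + (\<phi> z - u z) * dt \<phi> z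
        = indicator ?S z * (norm (g' z) powr (p - 2) * (g' z \<bullet> (sgrad \<phi> z - g' z)) + (\<phi> z - uz z) * dt \<phi> z)"
        using g'(3) by eventually_elim (auto simp: uz_def)
      show "(\<lambda>z. norm (g z) powr (p - 2) * (g z \<bullet> (sgrad \<phi> z - g z)) + (\<phi> z - u z) * dt \<phi> z) \<in> borel_measurable (lebesgue_on ?S)"
        using gm uL cL[OF c\<phi>(1)] cL[OF c\<phi>(2)] cL[OF c\<phi>(3)] by measurable
    qed auto
    also have "\<dots> = (\<integral>z. indicator ?S z * (norm (g' z) powr (p - 2) * (g' z \<bullet> (sgrad \<phi> z - g' z)) + (\<phi> z - u z) * dt \<phi> z) \<partial>lborel)"
      by (intro Bochner_Integration.integral_cong refl) (auto simp: uz_def indicator_def)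
    finally show "0 \<le> (\<integral>z. indicator ?S z * (pflux p (g' z) \<bullet> (sgrad \<phi> z - g' z) + (\<phi> z - u z) * dt \<phi> z) \<partial>lborel)"
      by (simp add: pflux_def)
  qed
qed

section \<open>Passage to the limit\<close>

lemma powr_pred_mult: "(x::real) \<ge> 0 \<Longrightarrow> x powr (p - 1) * x = x powr p"
  using powr_mult_base[of x "p - 1"] by (simp add: mult.commute)

lemma pflux_norm: "norm (pflux p a) = norm a powr (p - 1)"
  using powr_pred_mult[of "norm a" "p - 1"] by (simp add: pflux_def)

lemma pflux_self: "pflux p a \<bullet> a = norm a powr p"
proof -
  have "pflux p a \<bullet> a = (norm a powr (p - 2) * norm a) * norm a" by (simp add: pflux_def dot_square_norm power2_eq_square)
  also have "norm a powr (p - 2) * norm a = norm a powr (p - 1)" using powr_pred_mult[of "norm a" "p - 1"] by simp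
  finally show ?thesis using powr_pred_mult[of "norm a" p] by simp
qed

lemma pflux_monotone_identity:
  "(pflux p a - pflux p b) \<bullet> (a - b) = (norm a powr (p - 2) + norm b powr (p - 2)) / 2 * (norm (a - b))\<^sup>2
     + (norm a powr (p - 2) - norm b powr (p - 2)) * ((norm a)\<^sup>2 - (norm b)\<^sup>2) / 2"
  unfolding pflux_def power2_norm_eq_inner
  by (simp add: inner_diff_left inner_diff_right inner_commute[of b a] algebra_simps) (simp add: field_simps)

lemma pflux_monotone:
  assumes "p > 2"
  shows "(pflux p a - pflux p b) \<bullet> (a - b) \<ge> 0"
    and "(pflux p a - pflux p b) \<bullet> (a - b) = 0 \<Longrightarrow> a = b"
proof -
  have 1: "(norm a powr (p - 2) + norm b powr (p - 2)) / 2 * (norm (a - b))\<^sup>2 \<ge> 0" by simp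
  have 2: "(norm a powr (p - 2) - norm b powr (p - 2)) * ((norm a)\<^sup>2 - (norm b)\<^sup>2) / 2 \<ge> 0"
  proof (cases "norm a \<le> norm b")
    case True
    then have "norm a powr (p - 2) \<le> norm b powr (p - 2)" "(norm a)\<^sup>2 \<le> (norm b)\<^sup>2"
      using assms by (auto intro: powr_mono2 power_mono)
    then show ?thesis by (simp add: mult_nonpos_nonpos)
  next
    case False
    then have "norm b powr (p - 2) \<le> norm a powr (p - 2)" "(norm b)\<^sup>2 \<le> (norm a)\<^sup>2"
      using assms by (auto intro: powr_mono2 power_mono)
    then show ?thesis by simp
  qed
  show "(pflux p a - pflux p b) \<bullet> (a - b) \<ge> 0" unfolding pflux_monotone_identity using 1 2 by linarith
  assume "(pflux p a - pflux p b) \<bullet> (a - b) = 0"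
  then have "(norm a powr (p - 2) + norm b powr (p - 2)) / 2 * (norm (a - b))\<^sup>2 = 0"
    unfolding pflux_monotone_identity using 1 2 by linarith
  then have "norm a powr (p - 2) + norm b powr (p - 2) = 0 \<or> a = b" by auto
  moreover have "a = b" if "norm a powr (p - 2) + norm b powr (p - 2) = 0"
  proof -
    have "norm a powr (p - 2) = 0" "norm b powr (p - 2) = 0"
      using that powr_ge_zero[of "norm a" "p - 2"] powr_ge_zero[of "norm b" "p - 2"] by linarith+
    then show ?thesis by simp
  qed
  ultimately show "a = b" by blast
qed

lemma powr_pred_mult_le:
  assumes "(a::real) \<ge> 0" "b \<ge> 0" "p > 1"
  shows "a powr (p - 1) * b \<le> a powr p + b powr p"
proof (cases "a \<le> b")
  case True
  then have "a powr (p - 1) * b \<le> b powr (p - 1) * b" using assms by (intro mult_right_mono powr_mono2) auto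
  then show ?thesis using powr_pred_mult[OF assms(2), of p] powr_ge_zero[of a p] by linarith
next
  case False
  then have "a powr (p - 1) * b \<le> a powr (p - 1) * a" using assms by (intro mult_left_mono) auto
  then show ?thesis using powr_pred_mult[OF assms(1), of p] powr_ge_zero[of b p] by linarith
qed

lemma powr_add_le:
  assumes "(a::real) \<ge> 0" "b \<ge> 0" "p > 0"
  shows "(a + b) powr p \<le> (2 * a) powr p + (2 * b) powr p"
proof (cases "a \<le> b")
  case True
  then have "(a + b) powr p \<le> (2 * b) powr p" using assms by (intro powr_mono2) auto
  then show ?thesis using powr_ge_zero[of "2 * a" p] by linarith
next
  case False
  then have "(a + b) powr p \<le> (2 * a) powr p" using assms by (intro powr_mono2) auto
  then show ?thesis using powr_ge_zero[of "2 * b" p] by linarith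
qed

lemma pflux_inner_bound:
  assumes "p > 1"
  shows "\<bar>pflux p a \<bullet> (x - a)\<bar> \<le> 2 * norm a powr p + norm x powr p"
proof -
  have "\<bar>pflux p a \<bullet> x\<bar> \<le> norm a powr (p - 1) * norm x"
    using Cauchy_Schwarz_ineq2[of "pflux p a" x] by (simp add: pflux_norm)
  also have "\<dots> \<le> norm a powr p + norm x powr p" by (rule powr_pred_mult_le) (use assms in auto)
  finally show ?thesis unfolding inner_diff_right pflux_self using powr_ge_zero[of "norm a" p] by linarith
qed

lemma pflux_measurable [measurable (raw)]:
  "g \<in> borel_measurable M \<Longrightarrow> (\<lambda>z. pflux p (g z)) \<in> borel_measurable M"
  unfolding pflux_def by measurable

lemma generalized_dominated_convergence:
  fixes f :: "nat \<Rightarrow> 'b \<Rightarrow> real"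
  assumes meas: "\<And>n. f n \<in> borel_measurable M" "F \<in> borel_measurable M"
    and b: "\<And>n. integrable M (b n)" "integrable M c"
    and conv: "AE z in M. (\<lambda>n. f n z) \<longlonglongrightarrow> F z"
    and dom: "\<And>n z. \<bar>f n z\<bar> \<le> b n z" "\<And>z. \<bar>F z\<bar> \<le> c z"
    and L1: "(\<lambda>n. \<integral>z. \<bar>b n z - c z\<bar> \<partial>M) \<longlonglongrightarrow> 0"
  shows "(\<lambda>n. \<integral>z. f n z \<partial>M) \<longlonglongrightarrow> (\<integral>z. F z \<partial>M)"
proof -
  define h where "h n z = max (- c z) (min (c z) (f n z))" for n z
  have [measurable]: "\<And>n. f n \<in> borel_measurable M" "F \<in> borel_measurable M" "c \<in> borel_measurable M" using meas b by auto
  have c0: "c z \<ge> 0" for z using dom(2)[of z] by linarith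
  have hm: "h n \<in> borel_measurable M" for n unfolding h_def by measurable
  have hb: "\<bar>h n z\<bar> \<le> c z" for n z using c0[of z] by (auto simp: h_def)
  have fi: "integrable M (f n)" for n
    by (rule Bochner_Integration.integrable_bound[OF b(1)[of n] meas(1)]) (use order_trans[OF dom(1) abs_ge_self] in simp)
  have hi: "integrable M (h n)" for n
    by (rule Bochner_Integration.integrable_bound[OF b(2) hm]) (use order_trans[OF hb abs_ge_self] in simp)
  have "(\<lambda>n. \<integral>z. h n z \<partial>M) \<longlonglongrightarrow> (\<integral>z. F z \<partial>M)"
  proof (rule integral_dominated_convergence[where w=c])
    show "AE z in M. (\<lambda>n. h n z) \<longlonglongrightarrow> F z"
      using conv
    proof eventually_elim
      case (elim z)
      have "(\<lambda>n. h n z) \<longlonglongrightarrow> max (- c z) (min (c z) (F z))" unfolding h_def by (intro tendsto_intros elim)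
      then show ?case using dom(2)[of z] by (simp add: abs_le_iff min_def max_def split: if_splits)
    qed
  qed (use hm hb b in auto)
  moreover have "(\<lambda>n. (\<integral>z. f n z \<partial>M) - (\<integral>z. h n z \<partial>M)) \<longlonglongrightarrow> 0"
  proof (rule Lim_null_comparison[OF _ L1], rule eventuallyI)
    fix n
    have "(\<integral>z. f n z \<partial>M) - (\<integral>z. h n z \<partial>M) = (\<integral>z. f n z - h n z \<partial>M)" using fi hi by simp
    moreover have "\<bar>\<integral>z. f n z - h n z \<partial>M\<bar> \<le> (\<integral>z. \<bar>f n z - h n z\<bar> \<partial>M)" by (rule integral_abs_bound)
    moreover have "(\<integral>z. \<bar>f n z - h n z\<bar> \<partial>M) \<le> (\<integral>z. \<bar>b n z - c z\<bar> \<partial>M)"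
    proof (rule integral_mono)
      fix z show "\<bar>f n z - h n z\<bar> \<le> \<bar>b n z - c z\<bar>" using dom(1)[of n z] c0[of z] by (auto simp: h_def max_def min_def)
    qed (use fi hi b in auto)
    ultimately show "norm ((\<integral>z. f n z \<partial>M) - (\<integral>z. h n z \<partial>M)) \<le> (\<integral>z. \<bar>b n z - c z\<bar> \<partial>M)"
      unfolding real_norm_def by linarith
  qed
  ultimately show ?thesis using tendsto_add[of "\<lambda>n. (\<integral>z. f n z \<partial>M) - (\<integral>z. h n z \<partial>M)" 0] by force
qed

lemma flux_term_integrable:
  assumes wc: "weak_cyl \<Omega> T u g" and p: "p > 1"
    and g: "g \<in> borel_measurable borel" "integrable lborel (\<lambda>z. norm (g z) powr p)" and \<phi>: "smooth \<phi>"
  shows "integrable lborel (\<lambda>z. indicator (cyl \<Omega> T) z * (pflux p (g z) \<bullet> (sgrad \<phi> z - g z)))"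
proof -
  interpret weak_cyl \<Omega> T u g by fact
  have c: "continuous_on UNIV (sgrad \<phi>)" using \<phi> by (rule sgrad_continuous)
  note [measurable] = g(1) borel_measurable_continuous_onI[OF c]
  obtain R where R: "cyl \<Omega> T \<subseteq> cball 0 R" using cyl_ball .
  obtain B where B: "B \<ge> 0" "\<And>z. z \<in> cball 0 R \<Longrightarrow> \<bar>norm (sgrad \<phi> z)\<bar> \<le> B"
    using continuous_bounded_on_cball[OF continuous_on_norm[OF c]] by blast
  show "integrable lborel (\<lambda>z. indicator (cyl \<Omega> T) z * (pflux p (g z) \<bullet> (sgrad \<phi> z - g z)))"
  proof (rule Bochner_Integration.integrable_bound)
    show "integrable lborel (\<lambda>z. 2 * norm (g z) powr p + B powr p * indicator (cyl \<Omega> T) z)"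
      using g(2) indicator_cyl_integrable by simp
    show "AE z in lborel. norm (indicator (cyl \<Omega> T) z * (pflux p (g z) \<bullet> (sgrad \<phi> z - g z))) \<le> norm (2 * norm (g z) powr p + B powr p * indicator (cyl \<Omega> T) z)"
    proof (rule AE_I2)
      fix z
      show "norm (indicator (cyl \<Omega> T) z * (pflux p (g z) \<bullet> (sgrad \<phi> z - g z))) \<le> norm (2 * norm (g z) powr p + B powr p * indicator (cyl \<Omega> T) z)"
      proof (cases "z \<in> cyl \<Omega> T")
        case True
        then have "norm (sgrad \<phi> z) powr p \<le> B powr p" using B(2)[of z] R p by (intro powr_mono2) auto
        then show ?thesis using True pflux_inner_bound[OF p, of "g z" "sgrad \<phi> z"] by simp
      qed simp
    qed
  qed simp
qed

lemma conv_vector_bound: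
  fixes g :: "'b::euclidean_space \<Rightarrow> 'a::euclidean_space"
  assumes k: "density_fn k" "\<And>y. k y \<le> B" and g: "g \<in> borel_measurable borel"
    "integrable lborel (\<lambda>z. norm (g z))" "integrable lborel (\<lambda>z. norm (g z) powr p)" and p: "p > 1"
  shows "norm (\<Sum>i\<in>Basis. conv k (\<lambda>y. g y \<bullet> i) z *\<^sub>R i) powr p \<le> (2 * DIM('a)) powr p * conv k (\<lambda>y. norm (g y) powr p) z"
proof -
  have ki: "integrable lborel k" "\<And>y. k y \<ge> 0" using k by (auto simp: density_fn_def)
  have [measurable]: "k \<in> borel_measurable borel" "g \<in> borel_measurable borel" using ki g by auto
  have kB: "\<And>y. \<bar>k y\<bar> \<le> B" using k(2) ki by auto
  have comp: "\<bar>conv k (\<lambda>y. g y \<bullet> i) z\<bar> \<le> conv k (\<lambda>y. norm (g y)) z" if i: "i \<in> Basis" for i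
    unfolding conv_def
  proof (rule integral_abs_bound_integral)
    have "integrable lborel (\<lambda>y. g y \<bullet> i)"
      by (rule Bochner_Integration.integrable_bound[OF g(2)]) (use Basis_le_norm[OF i] in auto)
    then show "integrable lborel (\<lambda>y. k (z - y) * (g y \<bullet> i))" by (intro bounded_integrand_conv[OF kB]) auto
    show "integrable lborel (\<lambda>y. k (z - y) * norm (g y))" by (intro bounded_integrand_conv[OF kB] g) auto
    show "\<bar>k (z - y) * (g y \<bullet> i)\<bar> \<le> k (z - y) * norm (g y)" for y
      using mult_left_mono[OF Basis_le_norm[OF i, of "g y"] ki(2)[of "z - y"]] ki(2)[of "z - y"] by (simp add: abs_mult)
  qed
  have "norm (\<Sum>i\<in>Basis. conv k (\<lambda>y. g y \<bullet> i) z *\<^sub>R i) \<le> (\<Sum>i\<in>Basis. norm (conv k (\<lambda>y. g y \<bullet> i) z *\<^sub>R (i::'a)))"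
    by (rule norm_sum)
  also have "\<dots> \<le> (\<Sum>i\<in>(Basis::'a set). conv k (\<lambda>y. norm (g y)) z)"
    by (rule sum_mono) (use comp in simp)
  finally have le: "norm (\<Sum>i\<in>Basis. conv k (\<lambda>y. g y \<bullet> i) z *\<^sub>R i) \<le> DIM('a) * conv k (\<lambda>y. norm (g y)) z" by simp
  have c0: "conv k (\<lambda>y. norm (g y)) z \<ge> 0" unfolding conv_def by (rule Bochner_Integration.integral_nonneg) (use ki in auto)
  have "norm (\<Sum>i\<in>Basis. conv k (\<lambda>y. g y \<bullet> i) z *\<^sub>R i) powr p \<le> (DIM('a) * conv k (\<lambda>y. norm (g y)) z) powr p"
    using le p by (intro powr_mono2) auto
  also have "\<dots> = DIM('a) powr p * conv k (\<lambda>y. norm (g y)) z powr p" using c0 by (simp add: powr_mult)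
  also have "\<dots> \<le> DIM('a) powr p * (2 powr p * conv k (\<lambda>y. norm (g y) powr p) z)"
    by (intro mult_left_mono conv_powr_le[OF k p]) (use g in auto)
  also have "\<dots> = (2 * DIM('a)) powr p * conv k (\<lambda>y. norm (g y) powr p) z" by (simp add: powr_mult)
  finally show ?thesis .
qed

lemma gradients_agree:
  fixes \<Omega> :: "'a::euclidean_space set"
  assumes p: "p > 2" and \<psi>: "C0_on (cyl \<Omega> T) \<psi>" "\<And>z. z \<in> cyl \<Omega> T \<Longrightarrow> \<psi> z \<le> u z" "\<And>z. z \<in> cyl \<Omega> T \<Longrightarrow> \<psi> z \<le> v z"
    and solu: "solution_gradient p \<Omega> T \<psi> u gu" and solv: "solution_gradient p \<Omega> T \<psi> v gv"
  shows "AE z in lborel. gu z = gv z"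
proof -
  let ?S = "cyl \<Omega> T"
  have wu: "weak_cyl \<Omega> T u gu" and gu: "gu \<in> borel_measurable borel" "integrable lborel (\<lambda>z. norm (gu z) powr p)"
    and wv: "weak_cyl \<Omega> T v gv" and gv: "gv \<in> borel_measurable borel" "integrable lborel (\<lambda>z. norm (gv z) powr p)"
    using solu solv unfolding solution_gradient_def by blast+
  have Iu: "0 \<le> (\<integral>z. indicator ?S z * (pflux p (gu z) \<bullet> (sgrad \<phi> z - gu z) + (\<phi> z - u z) * dt \<phi> z) \<partial>lborel)"
    and Iv: "0 \<le> (\<integral>z. indicator ?S z * (pflux p (gv z) \<bullet> (sgrad \<phi> z - gv z) + (\<phi> z - v z) * dt \<phi> z) \<partial>lborel)"
    if "competitor \<Omega> T \<psi> \<phi>" for \<phi>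
    using solu solv that unfolding solution_gradient_def by blast+
  define w where "w z = 1/2 * u z + 1/2 * v z" for z
  define g where "g z = (1/2) *\<^sub>R gu z + (1/2) *\<^sub>R gv z" for z
  interpret U: weak_cyl \<Omega> T u gu by fact
  interpret V: weak_cyl \<Omega> T v gv by fact
  interpret weak_cyl \<Omega> T w g
    unfolding w_def g_def by (rule weak_cyl_combine[OF wu wv])
  note [measurable] = gu(1) gv(1)
  have g_meas [measurable]: "g \<in> borel_measurable borel" unfolding g_def by measurable
  define P where "P z = norm (g z) powr p" for z
  have Pm [measurable]: "P \<in> borel_measurable borel" unfolding P_def by measurable
  have Pi: "integrable lborel P"
  proof (rule Bochner_Integration.integrable_bound)
    show "integrable lborel (\<lambda>z. norm (gu z) powr p + norm (gv z) powr p)" using gu gv by simp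
    show "AE z in lborel. norm (P z) \<le> norm (norm (gu z) powr p + norm (gv z) powr p)"
    proof (rule AE_I2)
      fix z
      have "norm (g z) \<le> 1/2 * norm (gu z) + 1/2 * norm (gv z)"
        unfolding g_def using norm_triangle_ineq[of "(1/2) *\<^sub>R gu z" "(1/2) *\<^sub>R gv z"] by simp
      then have "P z \<le> (1/2 * norm (gu z) + 1/2 * norm (gv z)) powr p" unfolding P_def using p by (intro powr_mono2) auto
      also have "\<dots> \<le> norm (gu z) powr p + norm (gv z) powr p"
        using powr_add_le[of "1/2 * norm (gu z)" "1/2 * norm (gv z)" p] p by simp
      finally show "norm (P z) \<le> norm (norm (gu z) powr p + norm (gv z) powr p)" by (simp add: P_def)
    qed
  qed simp
  have gn: "integrable lborel (\<lambda>z. norm (g z))"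
    using integrable_lower_powr[OF g_meas g_zero Pi[unfolded P_def] bounded_cyl cyl_borel, of 1] p by simp
  have supp: "compact (closure {z. \<psi> z \<noteq> 0})" "closure {z. \<psi> z \<noteq> 0} \<subseteq> ?S" using \<psi>(1) unfolding C0_on_def by blast+
  obtain \<eta> where "test_fun ?S \<eta> \<and> (\<forall>z. \<eta> z \<ge> 0) \<and> (\<forall>z\<in>closure {z. \<psi> z \<noteq> 0}. \<eta> z \<ge> 1)"
    using test_function_above[OF open_cyl supp] by (rule exE)
  then have \<eta>: "test_fun ?S \<eta>" "\<And>z. \<eta> z \<ge> 0" and \<eta>1: "\<And>z. \<psi> z \<noteq> 0 \<Longrightarrow> \<eta> z \<ge> 1"
    using closure_subset[of "{z. \<psi> z \<noteq> 0}"] by auto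
  have \<psi>w: "\<And>z. z \<in> ?S \<Longrightarrow> \<psi> z \<le> w z" unfolding w_def using \<psi>(2,3) by force
  have s\<eta>: "smooth \<eta>" using \<eta>(1) by (simp add: test_fun_def)
  obtain C where C: "\<forall>\<delta>. 0 < \<delta> \<longrightarrow> \<delta> \<le> 1 \<longrightarrow> (\<exists>\<phi> \<rho> \<kappa>. approximant \<psi> \<eta> C \<delta> \<phi> \<rho> \<kappa>)"
    using approximant_exists[OF \<psi>(1) \<psi>w \<eta>(1,2) \<eta>1] by (rule exE)
  define \<delta> where "\<delta> n = 1 / real (Suc n)" for n
  have \<delta>: "\<And>n. 0 < \<delta> n" "\<And>n. \<delta> n \<le> 1" by (auto simp: \<delta>_def)
  have \<delta>0: "\<delta> \<longlonglongrightarrow> 0" unfolding \<delta>_def using LIMSEQ_inverse_real_of_nat by (simp add: inverse_eq_divide)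
  have "\<forall>n. \<exists>\<phi> \<rho> \<kappa>. approximant \<psi> \<eta> C (\<delta> n) \<phi> \<rho> \<kappa>" using C \<delta> by blast
  then obtain \<phi> \<rho> \<kappa> where ap: "\<And>n. approximant \<psi> \<eta> C (\<delta> n) (\<phi> n) (\<rho> n) (\<kappa> n)" by metis
  define k where "k n = kprod (\<rho> n) (\<kappa> n)" for n
  have s\<phi>: "smooth (\<phi> n)" and comp\<phi>: "competitor \<Omega> T \<psi> (\<phi> n)"
    and con: "concentrated (\<delta> n) (\<delta> n) (\<rho> n) (\<kappa> n)" and kB: "\<exists>B. \<forall>y. k n y \<le> B"
    and close: "\<And>z. z \<in> ?S \<Longrightarrow> \<bar>conv (k n) wz z - w z\<bar> \<le> \<delta> n / 2"
    and grad: "\<And>z i. z \<in> ?S \<Longrightarrow> i \<in> Basis \<Longrightarrow> pdir (i, 0) (\<phi> n) z =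
           thr' (\<delta> n) (conv (k n) wz z) * conv (k n) (\<lambda>y. g y \<bullet> i) z + 3 * \<delta> n * pdir (i, 0) \<eta> z"
    and time: "(\<integral>z. indicator ?S z * ((\<phi> n z - w z) * dt (\<phi> n) z) \<partial>lborel) \<le> C * \<delta> n" for n
    using ap[of n] unfolding approximant_def competitor_def k_def by blast+
  have kd: "density_fn (k n)" for n unfolding k_def using con[of n] kprod_density by (auto simp: concentrated_def)
  have [measurable]: "k n \<in> borel_measurable borel" for n using kd[of n] by (auto simp: density_fn_def)
  define G where "G n z = (\<Sum>i\<in>Basis. conv (k n) (\<lambda>y. g y \<bullet> i) z *\<^sub>R i)" for n z
  have sg: "sgrad (\<phi> n) z = thr' (\<delta> n) (conv (k n) wz z) *\<^sub>R G n z + (3 * \<delta> n) *\<^sub>R sgrad \<eta> z" if z: "z \<in> ?S" for n z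
  proof (rule euclidean_eqI)
    fix i :: 'a assume i: "i \<in> Basis"
    show "sgrad (\<phi> n) z \<bullet> i = (thr' (\<delta> n) (conv (k n) wz z) *\<^sub>R G n z + (3 * \<delta> n) *\<^sub>R sgrad \<eta> z) \<bullet> i"
      using grad[OF z i, of n] i by (simp add: sgrad_inner inner_add_left G_def)
  qed
  obtain R where R: "?S \<subseteq> cball 0 R" using cyl_ball .
  obtain E where E: "E \<ge> 0" "\<And>z. z \<in> cball 0 R \<Longrightarrow> \<bar>norm (sgrad \<eta> z)\<bar> \<le> E"
    using continuous_bounded_on_cball[OF continuous_on_norm[OF sgrad_continuous[OF s\<eta>]]] by blast
  define c where "c = (8::real) powr p * (2 * DIM('a)) powr p"
  have c1: "c \<ge> 1"
  proof -
    have "real DIM('a) \<ge> 1" using DIM_positive[where 'a='a] by simp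
    then have d2: "1 \<le> real (2 * DIM('a))" by linarith
    have "1 powr p \<le> real (2 * DIM('a)) powr p" by (rule powr_mono2[OF _ _ d2]) (use p in auto)
    moreover have "(1::real) powr p \<le> 8 powr p" using p by (intro powr_mono2) auto
    ultimately have "1 * 1 \<le> c" unfolding c_def by (intro mult_mono) auto
    then show ?thesis by simp
  qed
  have sgp: "norm (sgrad (\<phi> n) z) powr p \<le> c * conv (k n) P z + (6 * E) powr p" if z: "z \<in> ?S" for n z
  proof -
    have "norm (sgrad (\<phi> n) z) \<le> norm (thr' (\<delta> n) (conv (k n) wz z) *\<^sub>R G n z) + norm ((3 * \<delta> n) *\<^sub>R sgrad \<eta> z)"
      unfolding sg[OF z] by (rule norm_triangle_ineq)
    also have "\<dots> \<le> 4 * norm (G n z) + 3 * E"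
    proof (rule add_mono)
      show "norm (thr' (\<delta> n) (conv (k n) wz z) *\<^sub>R G n z) \<le> 4 * norm (G n z)"
        using thr'_nonneg[of "\<delta> n"] thr'_le_4[of "\<delta> n"] by (simp add: mult_right_mono)
      have "norm (sgrad \<eta> z) \<le> E" using E(2)[of z] R z by auto
      then have "\<delta> n * norm (sgrad \<eta> z) \<le> 1 * E" using \<delta>[of n] by (intro mult_mono) auto
      then show "norm ((3 * \<delta> n) *\<^sub>R sgrad \<eta> z) \<le> 3 * E" using \<delta>(1)[of n] by (simp add: abs_mult)
    qed
    finally have "norm (sgrad (\<phi> n) z) powr p \<le> (4 * norm (G n z) + 3 * E) powr p" using p by (intro powr_mono2) auto
    also have "\<dots> \<le> (8 * norm (G n z)) powr p + (6 * E) powr p"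
      using powr_add_le[of "4 * norm (G n z)" "3 * E" p] p E by simp
    also have "(8 * norm (G n z)) powr p = 8 powr p * norm (G n z) powr p" by (simp add: powr_mult)
    also have "\<dots> \<le> 8 powr p * ((2 * DIM('a)) powr p * conv (k n) P z)"
    proof (rule mult_left_mono)
      obtain B where "\<And>y. k n y \<le> B" using kB by blast
      from conv_vector_bound[OF kd this g_meas gn Pi[unfolded P_def]]
      show "norm (G n z) powr p \<le> (2 * DIM('a)) powr p * conv (k n) P z" unfolding G_def P_def using p by simp
    qed simp
    finally show ?thesis by (simp add: c_def mult.assoc)
  qed
  define nz where "nz z = (if w z = 0 then 0 else 1 :: real)" for z
  define F where "F z = indicator ?S z * (pflux p (gu z) \<bullet> (nz z *\<^sub>R g z - gu z) + pflux p (gv z) \<bullet> (nz z *\<^sub>R g z - gv z))" for z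
  define f where "f n z = indicator ?S z * (pflux p (gu z) \<bullet> (sgrad (\<phi> n) z - gu z) + pflux p (gv z) \<bullet> (sgrad (\<phi> n) z - gv z))" for n z
  define bb where "bb Q z = indicator ?S z * (2 * norm (gu z) powr p + 2 * norm (gv z) powr p + 2 * (c * Q z + (6 * E) powr p))" for Q z
  have f_nonneg: "0 \<le> (\<integral>z. f n z \<partial>lborel) + 2 * (C * \<delta> n)" for n
  proof -
    have p1: "p > 1" using p by simp
    note iu = flux_term_integrable[OF wu p1 gu s\<phi>, of n] and iv = flux_term_integrable[OF wv p1 gv s\<phi>, of n]
    note iu' = Bochner_Integration.integrable_add[OF iu U.time_term_integrable[OF s\<phi>], folded distrib_left]
      and iv' = Bochner_Integration.integrable_add[OF iv V.time_term_integrable[OF s\<phi>], folded distrib_left]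
    have "(\<integral>z. indicator ?S z * (pflux p (gu z) \<bullet> (sgrad (\<phi> n) z - gu z) + (\<phi> n z - u z) * dt (\<phi> n) z) \<partial>lborel)
      + (\<integral>z. indicator ?S z * (pflux p (gv z) \<bullet> (sgrad (\<phi> n) z - gv z) + (\<phi> n z - v z) * dt (\<phi> n) z) \<partial>lborel)
      = (\<integral>z. f n z + 2 * (indicator ?S z * ((\<phi> n z - w z) * dt (\<phi> n) z)) \<partial>lborel)"
      unfolding Bochner_Integration.integral_add[OF iu' iv', symmetric]
      by (intro Bochner_Integration.integral_cong refl) (simp add: f_def w_def algebra_simps)
    also have "\<dots> = (\<integral>z. f n z \<partial>lborel) + 2 * (\<integral>z. indicator ?S z * ((\<phi> n z - w z) * dt (\<phi> n) z) \<partial>lborel)"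
    proof -
      have "integrable lborel (f n)" unfolding f_def distrib_left by (intro Bochner_Integration.integrable_add iu iv)
      moreover have "integrable lborel (\<lambda>z. indicator ?S z * ((\<phi> n z - w z) * dt (\<phi> n) z))"
        by (rule time_term_integrable[OF s\<phi>])
      ultimately show ?thesis by simp
    qed
    finally show ?thesis using Iu[OF comp\<phi>, of n] Iv[OF comp\<phi>, of n] time[of n] by linarith
  qed
  have L1g: "(\<lambda>n. \<integral>z. indicator ?S z * \<bar>conv (k n) h z - h z\<bar> \<partial>lborel) \<longlonglongrightarrow> 0" if "integrable lborel h" for h
    unfolding k_def by (rule conv_L1_tendsto[OF con \<delta>0 kB[unfolded k_def] that bounded_cyl cyl_borel])
  have cint: "integrable lborel (\<lambda>z. indicator ?S z * \<bar>conv (k n) h z - h z\<bar>)" if "integrable lborel h" for h n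
    using integrable_mult_indicator[of ?S lborel "\<lambda>z. \<bar>conv (k n) h z - h z\<bar>"] conv_L1_contraction(1)[OF kd that, of n] that by simp
  define D where "D n z = (\<Sum>i\<in>Basis. indicator ?S z * \<bar>conv (k n) (\<lambda>y. g y \<bullet> i) z - g z \<bullet> i\<bar>)" for n z
  have Di: "integrable lborel (D n)" for n
    unfolding D_def by (rule Bochner_Integration.integrable_sum) (rule cint[OF g_int])
  have "(\<lambda>n. \<integral>z. norm (D n z) \<partial>lborel) \<longlonglongrightarrow> 0"
  proof -
    have "(\<integral>z. norm (D n z) \<partial>lborel) = (\<Sum>i\<in>Basis. \<integral>z. indicator ?S z * \<bar>conv (k n) (\<lambda>y. g y \<bullet> i) z - g z \<bullet> i\<bar> \<partial>lborel)" for n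
    proof -
      have "(\<integral>z. norm (D n z) \<partial>lborel) = (\<integral>z. D n z \<partial>lborel)"
        by (intro Bochner_Integration.integral_cong refl) (simp add: D_def sum_nonneg)
      also have "\<dots> = (\<Sum>i\<in>Basis. \<integral>z. indicator ?S z * \<bar>conv (k n) (\<lambda>y. g y \<bullet> i) z - g z \<bullet> i\<bar> \<partial>lborel)"
        unfolding D_def by (rule Bochner_Integration.integral_sum) (rule cint[OF g_int])
      finally show ?thesis .
    qed
    moreover have "(\<lambda>n. \<Sum>i\<in>Basis. \<integral>z. indicator ?S z * \<bar>conv (k n) (\<lambda>y. g y \<bullet> i) z - g z \<bullet> i\<bar> \<partial>lborel) \<longlonglongrightarrow> (\<Sum>i\<in>(Basis::'a set). 0)"
      by (intro tendsto_sum L1g g_int)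
    ultimately show ?thesis by simp
  qed
  from tendsto_L1_AE_subseq[OF Di this]
  obtain r :: "nat \<Rightarrow> nat" where r: "strict_mono r" "AE z in lborel. (\<lambda>n. D (r n) z) \<longlonglongrightarrow> 0" by blast
  have \<delta>r: "(\<lambda>n. \<delta> (r n)) \<longlonglongrightarrow> 0" using LIMSEQ_subseq_LIMSEQ[OF \<delta>0 r(1)] by (simp add: o_def)
  have sgm [measurable]: "sgrad (\<phi> n) \<in> borel_measurable borel" for n
    by (rule borel_measurable_continuous_onI[OF sgrad_continuous[OF s\<phi>]])
  have wm: "(\<lambda>z. indicator ?S z * nz z) \<in> borel_measurable borel"
  proof -
    have "(\<lambda>z. if wz z = 0 then 0 else 1 :: real) \<in> borel_measurable borel" by measurable
    then have "(\<lambda>z. indicator ?S z * (if wz z = 0 then 0 else 1 :: real)) \<in> borel_measurable borel" by measurable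
    also have "(\<lambda>z. indicator ?S z * (if wz z = 0 then 0 else 1 :: real)) = (\<lambda>z. indicator ?S z * nz z)"
      by (auto simp: fun_eq_iff wz_def nz_def indicator_def)
    finally show ?thesis .
  qed
  have Fm: "F \<in> borel_measurable lborel"
  proof -
    have "F = (\<lambda>z. pflux p (gu z) \<bullet> ((indicator ?S z * nz z) *\<^sub>R g z - indicator ?S z *\<^sub>R gu z) + pflux p (gv z) \<bullet> ((indicator ?S z * nz z) *\<^sub>R g z - indicator ?S z *\<^sub>R gv z))"
      by (auto simp: F_def fun_eq_iff indicator_def)
    moreover note [measurable] = wm
    ultimately show ?thesis by simp
  qed
  have bbi: "integrable lborel (bb Q)" if "integrable lborel Q" for Q
  proof -
    have "integrable lborel (\<lambda>z. indicator ?S z *\<^sub>R (2 * norm (gu z) powr p + 2 * norm (gv z) powr p + 2 * (c * Q z)) + 2 * (6 * E) powr p * indicator ?S z)"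
      by (intro Bochner_Integration.integrable_add integrable_mult_indicator integrable_mult_right)
        (use gu gv that indicator_cyl_integrable in auto)
    also have "(\<lambda>z. indicator ?S z *\<^sub>R (2 * norm (gu z) powr p + 2 * norm (gv z) powr p + 2 * (c * Q z)) + 2 * (6 * E) powr p * indicator ?S z) = bb Q"
      by (auto simp: bb_def fun_eq_iff algebra_simps)
    finally show ?thesis .
  qed
  have Fb: "\<bar>F z\<bar> \<le> bb P z" for z
  proof (cases "z \<in> ?S")
    case True
    have "norm (nz z *\<^sub>R g z) powr p \<le> P z" using p by (auto simp: nz_def P_def)
    also have "\<dots> \<le> c * P z" using c1 mult_right_mono[of 1 c "P z"] by (simp add: P_def)
    finally have "norm (nz z *\<^sub>R g z) powr p \<le> c * P z + (6 * E) powr p" by (simp add: add_increasing2)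
    moreover have "\<bar>pflux p (gu z) \<bullet> (nz z *\<^sub>R g z - gu z)\<bar> \<le> 2 * norm (gu z) powr p + norm (nz z *\<^sub>R g z) powr p"
      "\<bar>pflux p (gv z) \<bullet> (nz z *\<^sub>R g z - gv z)\<bar> \<le> 2 * norm (gv z) powr p + norm (nz z *\<^sub>R g z) powr p"
      by (rule pflux_inner_bound; use p in simp)+
    ultimately show ?thesis using True by (simp add: F_def bb_def)
  qed (simp add: F_def bb_def)
  have "(\<lambda>n. \<integral>z. f (r n) z \<partial>lborel) \<longlonglongrightarrow> (\<integral>z. F z \<partial>lborel)"
  proof (rule generalized_dominated_convergence[where b="\<lambda>n. bb (conv (k (r n)) P)" and c="bb P"])
    show "f (r n) \<in> borel_measurable lborel" for n unfolding f_def by simp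
    show "F \<in> borel_measurable lborel" by fact
    show "integrable lborel (bb (conv (k (r n)) P))" for n by (rule bbi[OF conv_L1_contraction(1)[OF kd Pi]])
    show "integrable lborel (bb P)" by (rule bbi[OF Pi])
    show "\<bar>f (r n) z\<bar> \<le> bb (conv (k (r n)) P) z" for n z
    proof (cases "z \<in> ?S")
      case True
      have "\<bar>pflux p (gu z) \<bullet> (sgrad (\<phi> (r n)) z - gu z)\<bar> \<le> 2 * norm (gu z) powr p + norm (sgrad (\<phi> (r n)) z) powr p"
        "\<bar>pflux p (gv z) \<bullet> (sgrad (\<phi> (r n)) z - gv z)\<bar> \<le> 2 * norm (gv z) powr p + norm (sgrad (\<phi> (r n)) z) powr p"
        by (rule pflux_inner_bound; use p in simp)+
      then show ?thesis using True sgp[OF True, of "r n"] by (simp add: f_def bb_def)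
    qed (simp add: f_def bb_def)
    show "\<bar>F z\<bar> \<le> bb P z" for z by (rule Fb)
    have "(\<integral>z. \<bar>bb (conv (k n) P) z - bb P z\<bar> \<partial>lborel) = 2 * c * (\<integral>z. indicator ?S z * \<bar>conv (k n) P z - P z\<bar> \<partial>lborel)" for n
    proof -
      have "(\<integral>z. \<bar>bb (conv (k n) P) z - bb P z\<bar> \<partial>lborel) = (\<integral>z. 2 * c * (indicator ?S z * \<bar>conv (k n) P z - P z\<bar>) \<partial>lborel)"
      proof (intro Bochner_Integration.integral_cong refl)
        fix z
        have "bb (conv (k n) P) z - bb P z = indicator ?S z * (2 * c * (conv (k n) P z - P z))" by (simp add: bb_def algebra_simps)
        then show "\<bar>bb (conv (k n) P) z - bb P z\<bar> = 2 * c * (indicator ?S z * \<bar>conv (k n) P z - P z\<bar>)"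
          using c1 by (simp add: abs_mult)
      qed
      then show ?thesis by simp
    qed
    moreover have "(\<lambda>n. 2 * c * (\<integral>z. indicator ?S z * \<bar>conv (k n) P z - P z\<bar> \<partial>lborel)) \<longlonglongrightarrow> 2 * c * 0"
      by (intro tendsto_mult tendsto_const L1g Pi)
    ultimately have "(\<lambda>n. \<integral>z. \<bar>bb (conv (k n) P) z - bb P z\<bar> \<partial>lborel) \<longlonglongrightarrow> 0" by simp
    from LIMSEQ_subseq_LIMSEQ[OF this r(1)]
    show "(\<lambda>n. \<integral>z. \<bar>bb (conv (k (r n)) P) z - bb P z\<bar> \<partial>lborel) \<longlonglongrightarrow> 0" by (simp add: o_def)
    show "AE z in lborel. (\<lambda>n. f (r n) z) \<longlonglongrightarrow> F z"
      using r(2)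
    proof eventually_elim
      case (elim z)
      show ?case
      proof (cases "z \<in> ?S")
        case z: True
        have comp: "(\<lambda>n. conv (k (r n)) (\<lambda>y. g y \<bullet> i) z) \<longlonglongrightarrow> g z \<bullet> i" if i: "i \<in> Basis" for i
        proof -
          have "(\<lambda>n. conv (k (r n)) (\<lambda>y. g y \<bullet> i) z - g z \<bullet> i) \<longlonglongrightarrow> 0"
          proof (rule Lim_null_comparison[OF _ elim], rule eventuallyI)
            fix n
            show "norm (conv (k (r n)) (\<lambda>y. g y \<bullet> i) z - g z \<bullet> i) \<le> D (r n) z"
              unfolding D_def using z member_le_sum[OF i, of "\<lambda>i. \<bar>conv (k (r n)) (\<lambda>y. g y \<bullet> i) z - g z \<bullet> i\<bar>"] by simp
          qed
          then show ?thesis by (simp add: LIM_zero_iff)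
        qed
        have Gl: "(\<lambda>n. G (r n) z) \<longlonglongrightarrow> g z"
        proof -
          have "(\<lambda>n. G (r n) z) \<longlonglongrightarrow> (\<Sum>i\<in>Basis. (g z \<bullet> i) *\<^sub>R i)"
            unfolding G_def by (intro tendsto_intros comp)
          then show ?thesis by (simp add: euclidean_representation)
        qed
        have Wl: "(\<lambda>n. conv (k (r n)) wz z) \<longlonglongrightarrow> w z"
        proof -
          have "(\<lambda>n. conv (k (r n)) wz z - w z) \<longlonglongrightarrow> 0"
          proof (rule Lim_null_comparison[OF _ \<delta>r], rule eventuallyI)
            fix n show "norm (conv (k (r n)) wz z - w z) \<le> \<delta> (r n)" using close[OF z, of "r n"] \<delta>(1)[of "r n"] by simp
          qed
          then show ?thesis by (simp add: LIM_zero_iff)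
        qed
        have tl: "(\<lambda>n. thr' (\<delta> (r n)) (conv (k (r n)) wz z)) \<longlonglongrightarrow> nz z"
        proof (cases "w z = 0")
          case True
          have "thr' (\<delta> (r n)) (conv (k (r n)) wz z) = 0" for n
            using close[OF z, of "r n"] True \<delta>(1)[of "r n"] by (intro thr'_eq_0) auto
          then show ?thesis using True by (simp add: nz_def)
        next
          case False
          then show ?thesis using thr'_tendsto_1[OF \<delta>(1) \<delta>r Wl] by (simp add: nz_def)
        qed
        have "(\<lambda>n. thr' (\<delta> (r n)) (conv (k (r n)) wz z) *\<^sub>R G (r n) z + (3 * \<delta> (r n)) *\<^sub>R sgrad \<eta> z) \<longlonglongrightarrow> nz z *\<^sub>R g z + (3 * 0) *\<^sub>R sgrad \<eta> z"
          by (intro tendsto_intros tl Gl \<delta>r)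
        then have "(\<lambda>n. sgrad (\<phi> (r n)) z) \<longlonglongrightarrow> nz z *\<^sub>R g z" by (simp add: sg[OF z])
        then show ?thesis unfolding f_def F_def by (intro tendsto_intros)
      qed (simp add: f_def F_def)
    qed
  qed
  moreover have "(\<lambda>n. 2 * (C * \<delta> (r n))) \<longlonglongrightarrow> 2 * (C * 0)" by (intro tendsto_intros \<delta>r)
  ultimately have "(\<lambda>n. (\<integral>z. f (r n) z \<partial>lborel) + 2 * (C * \<delta> (r n))) \<longlonglongrightarrow> (\<integral>z. F z \<partial>lborel) + 2 * (C * 0)" by (rule tendsto_add)
  then have F_ge: "(\<integral>z. F z \<partial>lborel) \<ge> 0" using f_nonneg LIMSEQ_le_const[of _ "(\<integral>z. F z \<partial>lborel) + 2 * (C * 0)" 0] by auto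
  have Fi: "integrable lborel F"
    by (rule Bochner_Integration.integrable_bound[OF bbi[OF Pi] Fm]) (use order_trans[OF Fb abs_ge_self] in simp)
  have pw: "F z \<le> 0" "F z = 0 \<Longrightarrow> gu z = gv z" for z
  proof -
    have "F z \<le> 0 \<and> (F z = 0 \<longrightarrow> gu z = gv z)"
    proof (cases "z \<in> ?S")
      case False
      then show ?thesis using U.g_zero V.g_zero by (simp add: F_def)
    next
      case z: True
      show ?thesis
      proof (cases "w z = 0")
        case True
        then have "F z = - (norm (gu z) powr p) - norm (gv z) powr p"
          using z by (simp add: F_def nz_def pflux_self)
        moreover have "norm (gu z) powr p \<ge> 0" "norm (gv z) powr p \<ge> 0" by (rule powr_ge_zero)+
        ultimately have "F z \<le> 0" "F z = 0 \<Longrightarrow> norm (gu z) powr p = 0 \<and> norm (gv z) powr p = 0" by linarith+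
        then show ?thesis by auto
      next
        case False
        then have "F z = - (1/2) * ((pflux p (gu z) - pflux p (gv z)) \<bullet> (gu z - gv z))"
          using z by (simp add: F_def nz_def g_def inner_diff_left inner_diff_right inner_add_right field_simps)
        then show ?thesis using pflux_monotone[OF p, of "gu z" "gv z"] by auto
      qed
    qed
    then show "F z \<le> 0" "F z = 0 \<Longrightarrow> gu z = gv z" by auto
  qed
  have "(\<integral>z. - F z \<partial>lborel) = 0"
  proof -
    have "(\<integral>z. - F z \<partial>lborel) \<ge> 0" by (rule Bochner_Integration.integral_nonneg) (use pw in auto)
    then show ?thesis using F_ge by simp
  qed
  then have "AE z in lborel. - F z = 0"
    using integral_nonneg_eq_0_iff_AE[of lborel "\<lambda>z. - F z"] Fi pw by auto
  then show ?thesis by eventually_elim (use pw in auto)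
qed

theorem theorem3p14:
  fixes \<Omega> :: "'a::euclidean_space set" and p T :: real
    and \<psi> u v :: "'a \<times> real \<Rightarrow> real"
  assumes "p > 2" and "T > 0" and "lipschitz_domain \<Omega>"
    and "C0_on (cyl \<Omega> T) \<psi>"
    and "variational_solution p \<Omega> T \<psi> u"
    and "variational_solution p \<Omega> T \<psi> v"
  shows "\<forall>z\<in>closure (cyl \<Omega> T). u z = v z"
proof -
  have \<Omega>: "open \<Omega>" "bounded \<Omega>" using assms(3) by (auto simp: lipschitz_domain_def)
  obtain gu where gu: "solution_gradient p \<Omega> T \<psi> u gu"
    using solution_gradient_exists[OF assms(1,2) \<Omega> assms(4,5)] by blast
  obtain gv where gv: "solution_gradient p \<Omega> T \<psi> v gv"
    using solution_gradient_exists[OF assms(1,2) \<Omega> assms(4,6)] by blast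
  have ge: "\<And>z. z \<in> cyl \<Omega> T \<Longrightarrow> \<psi> z \<le> u z" "\<And>z. z \<in> cyl \<Omega> T \<Longrightarrow> \<psi> z \<le> v z"
    using assms(5,6) by (auto simp: variational_solution_def F_class_def)
  have ae: "AE z in lborel. gu z = gv z"
    by (rule gradients_agree[OF assms(1,4) ge gu gv])
  interpret D: weak_cyl \<Omega> T "\<lambda>z. 1 * u z + (-1) * v z" "\<lambda>z. 1 *\<^sub>R gu z + (-1) *\<^sub>R gv z"
    using gu gv unfolding solution_gradient_def by (intro weak_cyl_combine) auto
  have wz0: "D.wz z = 0" for z
  proof (rule D.zero_gradient_imp_zero)
    show "AE z in lborel. (1 *\<^sub>R gu z + (-1) *\<^sub>R gv z) \<bullet> i = 0" for i using ae by eventually_elim simp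
  qed
  have eq: "1 * u z + (-1) * v z = 0" if "z \<in> cyl \<Omega> T" for z using wz0[of z] that unfolding D.wz_def by simp
  show ?thesis
  proof
    fix z assume "z \<in> closure (cyl \<Omega> T)"
    from continuous_on_closure_norm_le[OF D.w_cont _ this, of 0] show "u z = v z" using eq by simp
  qed
qed

end
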